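(* Let $\varphi,\psi:S^1\to F_g$ be two piecewise-geodesic loops which are determined by cyclically $D$-reduced words. Then for any lifting $\tilde\varphi$ of $\varphi$ and any lifting $\tilde\psi$ of $\psi$, the set $\mathrm{CVP}(\tilde\varphi,\tilde\psi)$ of common value pairs of $\tilde\varphi$ and $\tilde\psi$ is connected, and hence each common value class of $\varphi$ and $\psi$ is connected.
   Context: Surface. Let $g\ge2$ and let $\mathbb D^2$ be the Poincaré disk. For $j=1,\ldots,2g$ put $T(c_j)=(-1)^je^{\frac{(j-1)\pi}{2g}i}$, $T(c_j^{-1})=-T(c_j)$. Let $\delta_j$ be the hyperbolic translation of $\mathbb D^2$ whose axis is the diameter with attracting fixed point $T(c_j)$ and expanding fixed point $T(c_j^{-1})$, of translation length $2\log\frac{\cos\frac{\pi}{4g}+\sqrt{\cos\frac{\pi}{2g}}}{\sin\frac{\pi}{4g}}$. The $\delta_j$ generate a discrete group $\Gamma_g$ with $F_g=\mathbb D^2/\Gamma_g$ the closed oriented surface of genus $g$; $p:\mathbb D^2\to F_g$ is the universal covering, $\tilde y_0=0$, $y_0=p(\tilde y_0)$. Let $c_j\in\pi_1(F_g,y_0)$ be the class of the image of the geodesic segment from $\tilde y_0$ to $\delta_j(\tilde y_0)$; then $\pi_1(F_g,y_0)=\langle c_1,\ldots,c_{2g}\mid c_1\cdots c_{2g}=c_{2g}\cdots c_1\rangle$, identified with the deck group $\Gamma_g$ via $c_j\leftrightarrow\delta_j$. Piecewise-geodesic loops. For a word $u_1\cdots u_m$ in the letters $c_1^{\pm1},\ldots,c_{2g}^{\pm1}$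 giving a non-trivial element of $\pi_1(F_g,y_0)$, the piecewise-geodesic loop determined by it is the unique $\varphi:S^1\to F_g$ such that for $k=1,\ldots,m$ the path $[0,1]\ni\lambda\mapsto\varphi(e^{2\pi i(k+\lambda-1)/m})$ is the constant-speed unique geodesic loop at $y_0$ representing $u_k$. Common values. For maps $f,h:X\to Y$, $\mathrm{CVP}(f,h)=\{(u,v)\in X^2\mid f(u)=h(v)\}$. Let $p_{S^1}:\mathbb R\to S^1$, $p_{S^1}(\lambda)=e^{2\pi i\lambda}$. A lifting of $\varphi$ is a map $\tilde\varphi:\mathbb R\to\mathbb D^2$ with $p\tilde\varphi=\varphi p_{S^1}$. A common value class of $\varphi,\psi$ is a non-empty set of the form $(p_{S^1}\times p_{S^1})(\mathrm{CVP}(\tilde\varphi,\tilde\psi))$ with $\tilde\varphi,\tilde\psi$ liftings of $\varphi,\psi$. $D$-reduced words. A word is $D$-reducible if it contains as a subword one of: $c_j(c_{j-1}\cdots c_1c_{2g}^{-1}\cdots c_{j+1}^{-1})^sc_j^{-1}$ or $c_j(c_{j+1}\cdots c_{2g}c_1^{-1}\cdots c_{j-1}^{-1})^sc_j^{-1}$ ($2\le j\le2g$, $s\ge1$); $c_{2g}^{-1}\cdots c_1^{-1}$; $c_1\cdots c_{2g}$; $c_i^{-1}\cdots c_{2g}^{-1}c_1\cdots c_{i-1}$ or $c_{i-1}^{-1}\cdots c_1^{-1}c_{2g}\cdots c_i$ ($2\le i\le2g$); $c_i^{-1}c_i$ or $c_ic_i^{-1}$ ($1\le i\le 2g$). (Runs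 have consecutive indices; runs $c_{2g}^{-1}\cdots c_{j+1}^{-1}$, $c_{j+1}\cdots c_{2g}$ are empty for $j=2g$. These are the leading words of a Gröbner-Shirshov basis $D$ of the group.) Otherwise it is $D$-reduced. A word is cyclically $D$-reduced if all its rotations (cyclic permutations) are $D$-reduced. *)

theory Defs
  imports
    "HOL-Complex_Analysis.Complex_Analysis"
    "HOL-Algebra.Algebra"
    "HOL-Library.Sublist"
begin

section \<open>The hyperbolic plane\<close>

abbreviation poincare_disk :: "complex set" where
  "poincare_disk \<equiv> ball 0 1"

text \<open>Distance of the metric \<open>2 |dz| / (1 - |z|\<^sup>2)\<close>, of curvature \<open>-1\<close>.\<close>

definition hdist :: "complex \<Rightarrow> complex \<Rightarrow> real" where
  "hdist z w = 2 * artanh (cmod ((z - w) / (1 - cnj w * z)))"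

text \<open>For \<open>|T| = 1\<close>, the hyperbolic translation of length \<open>L\<close> along the diameter from
  \<open>-T\<close> (expanding) to \<open>T\<close> (attracting), i.e. \<open>z \<mapsto> (z + a) / (1 + cnj a * z)\<close> with
  \<open>a = tanh (L/2) T\<close>. It is made extensional to be an element of \<open>BijGroup\<close>.\<close>

definition hyp_translation :: "complex \<Rightarrow> real \<Rightarrow> complex \<Rightarrow> complex" where
  "hyp_translation T L =
     restrict (Moebius_function 0 (- (of_real (tanh (L / 2)) * T))) poincare_disk"

lemma cmod_tanh_unit:
  assumes "cmod T = 1"
  shows "cmod (of_real (tanh (L / 2)) * T) < 1"
  using assms tanh_real_bounds[of "L/2"] by (auto simp: norm_mult abs_less_iff)

lemma hyp_translation_Bij:
  assumes "cmod T = 1"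
  shows "hyp_translation T L \<in> Bij poincare_disk"
proof -
  define a where "a = of_real (tanh (L / 2)) * T"
  have a: "cmod a < 1" using cmod_tanh_unit[OF assms] by (simp add: a_def)
  have "bij_betw (Moebius_function 0 (-a)) poincare_disk poincare_disk"
    by (rule bij_betwI[where g = "Moebius_function 0 a"])
       (use a in \<open>auto simp: Moebius_function_norm_lt_1 Moebius_function_compose\<close>)
  then show ?thesis
    by (simp add: Bij_def hyp_translation_def a_def bij_betw_restrict_eq)
qed

lemma Moebius_fixes_endpoints:
  assumes "cmod T = 1"
  shows "Moebius_function 0 (- (of_real (tanh (L / 2)) * T)) T = T"
    and "Moebius_function 0 (- (of_real (tanh (L / 2)) * T)) (- T) = - T"
proof -
  have T: "cnj T * T = 1" using assms by (simp add: complex_norm_square[symmetric] mult.commute)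
  have "1 + tanh (L/2) \<noteq> 0" "1 - tanh (L/2) \<noteq> 0" using tanh_real_bounds[of "L/2"] by auto
  then have nz: "1 + complex_of_real (tanh (L/2)) \<noteq> 0" "1 - complex_of_real (tanh (L/2)) \<noteq> 0"
    by (metis of_real_0 of_real_1 of_real_add of_real_diff of_real_eq_iff)+
  have e: "cnj (of_real (tanh (L / 2)) * T) * T = of_real (tanh (L / 2))"
    using T by (simp add: mult.assoc)
  show "Moebius_function 0 (- (of_real (tanh (L / 2)) * T)) T = T"
    using nz e by (simp add: Moebius_function_simple del: complex_cnj_mult) (simp add: field_simps)
  show "Moebius_function 0 (- (of_real (tanh (L / 2)) * T)) (- T) = - T"
    using nz e by (simp add: Moebius_function_simple del: complex_cnj_mult) (simp add: field_simps)
qed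

lemma hyp_translation_zero: "hyp_translation T L 0 = of_real (tanh (L / 2)) * T"
  by (simp add: hyp_translation_def Moebius_function_simple)

lemma hdist_hyp_translation_zero:
  assumes "cmod T = 1" "0 \<le> L"
  shows "hdist 0 (hyp_translation T L 0) = L"
proof -
  have "0 \<le> tanh (L/2)" using assms by simp
  then show ?thesis
    using assms by (simp add: hyp_translation_zero hdist_def norm_mult artanh_tanh_real)
qed

text \<open>In the hyperbolic plane every geodesic segment minimizes distance.\<close>

definition constant_speed_geodesic :: "(real \<Rightarrow> complex) \<Rightarrow> bool" where
  "constant_speed_geodesic c \<longleftrightarrow>
     c ` {0..1} \<subseteq> poincare_disk \<and>
     (\<forall>s\<in>{0..1}. \<forall>t\<in>{0..1}. hdist (c s) (c t) = \<bar>s - t\<bar> * hdist (c 0) (c 1))"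


section \<open>Letters and words\<close>

text \<open>\<open>Pos j\<close> is \<open>c\<^sub>j\<close> and \<open>Neg j\<close> is \<open>c\<^sub>j\<^sup>-\<^sup>1\<close>, for \<open>1 \<le> j \<le> 2g\<close>.\<close>

datatype letter = Pos nat | Neg nat

definition letters :: "nat \<Rightarrow> letter set" where
  "letters g = Pos ` {1..2*g} \<union> Neg ` {1..2*g}"

text \<open>The runs \<open>c\<^sub>a c\<^sub>a\<^sub>+\<^sub>1 \<dots> c\<^sub>b\<close> (\<open>up\<close>) and \<open>c\<^sub>b c\<^sub>b\<^sub>-\<^sub>1 \<dots> c\<^sub>a\<close> (\<open>down\<close>), and the same with every
  letter inverted in place (\<open>up_inv\<close>, \<open>down_inv\<close>). The first argument is always the first
  index of the run; a run is empty if the range of its indices is.\<close>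

definition up :: "nat \<Rightarrow> nat \<Rightarrow> letter list" where
  "up a b = map Pos [a..<Suc b]"

definition down :: "nat \<Rightarrow> nat \<Rightarrow> letter list" where
  "down b a = map Pos (rev [a..<Suc b])"

definition up_inv :: "nat \<Rightarrow> nat \<Rightarrow> letter list" where
  "up_inv a b = map Neg [a..<Suc b]"

definition down_inv :: "nat \<Rightarrow> nat \<Rightarrow> letter list" where
  "down_inv b a = map Neg (rev [a..<Suc b])"

inductive_set D_leading :: "nat \<Rightarrow> letter list set" for g :: nat where
  "\<lbrakk>2 \<le> j; j \<le> 2*g; 1 \<le> s\<rbrakk> \<Longrightarrow>
     [Pos j] @ concat (replicate s (down (j-1) 1 @ down_inv (2*g) (j+1))) @ [Neg j] \<in> D_leading g"
| "\<lbrakk>2 \<le> j; j \<le> 2*g; 1 \<le> s\<rbrakk> \<Longrightarrow>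
     [Pos j] @ concat (replicate s (up (j+1) (2*g) @ up_inv 1 (j-1))) @ [Neg j] \<in> D_leading g"
| "down_inv (2*g) 1 \<in> D_leading g"
| "up 1 (2*g) \<in> D_leading g"
| "\<lbrakk>2 \<le> i; i \<le> 2*g\<rbrakk> \<Longrightarrow> up_inv i (2*g) @ up 1 (i-1) \<in> D_leading g"
| "\<lbrakk>2 \<le> i; i \<le> 2*g\<rbrakk> \<Longrightarrow> down_inv (i-1) 1 @ down (2*g) i \<in> D_leading g"
| "\<lbrakk>1 \<le> i; i \<le> 2*g\<rbrakk> \<Longrightarrow> [Neg i, Pos i] \<in> D_leading g"
| "\<lbrakk>1 \<le> i; i \<le> 2*g\<rbrakk> \<Longrightarrow> [Pos i, Neg i] \<in> D_leading g"

definition D_reducible :: "nat \<Rightarrow> letter list \<Rightarrow> bool" where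
  "D_reducible g w \<longleftrightarrow> (\<exists>d\<in>D_leading g. sublist d w)"

definition cyclically_D_reduced :: "nat \<Rightarrow> letter list \<Rightarrow> bool" where
  "cyclically_D_reduced g w \<longleftrightarrow> (\<forall>n. \<not> D_reducible g (rotate n w))"


section \<open>The surface group and the universal covering\<close>

definition attracting_pt :: "nat \<Rightarrow> nat \<Rightarrow> complex" where
  "attracting_pt g j = (-1) ^ j * cis ((real j - 1) * pi / (2 * real g))"

definition transl_length :: "nat \<Rightarrow> real" where
  "transl_length g =
     2 * ln ((cos (pi / (4 * real g)) + sqrt (cos (pi / (2 * real g)))) / sin (pi / (4 * real g)))"

definition delta :: "nat \<Rightarrow> nat \<Rightarrow> complex \<Rightarrow> complex" where
  "delta g j = hyp_translation (attracting_pt g j) (transl_length g)"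

lemma delta_Bij: "delta g j \<in> carrier (BijGroup poincare_disk)"
  unfolding delta_def BijGroup_def
  by (simp add: hyp_translation_Bij attracting_pt_def norm_mult norm_power)

text \<open>\<open>\<pi>\<^sub>1(F\<^sub>g, y\<^sub>0)\<close>, identified with the group \<open>\<Gamma>\<^sub>g\<close> of deck transformations.\<close>

definition surface_group :: "nat \<Rightarrow> (complex \<Rightarrow> complex) monoid" where
  "surface_group g = (BijGroup poincare_disk)
     \<lparr>carrier := generate (BijGroup poincare_disk) (delta g ` {1..2*g})\<rparr>"

text \<open>The points of \<open>F\<^sub>g\<close> are the orbits of \<open>\<Gamma>\<^sub>g\<close> on the disk.\<close>

definition covering :: "nat \<Rightarrow> complex \<Rightarrow> complex set" where
  "covering g z = orbit (surface_group g) (\<lambda>\<gamma>. \<gamma>) z"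

fun letter_elt :: "nat \<Rightarrow> letter \<Rightarrow> complex \<Rightarrow> complex" where
  "letter_elt g (Pos j) = delta g j"
| "letter_elt g (Neg j) = inv\<^bsub>BijGroup poincare_disk\<^esub> (delta g j)"

definition word_elt :: "nat \<Rightarrow> letter list \<Rightarrow> complex \<Rightarrow> complex" where
  "word_elt g w = foldr (\<lambda>u \<gamma>. letter_elt g u \<otimes>\<^bsub>surface_group g\<^esub> \<gamma>) w \<one>\<^bsub>surface_group g\<^esub>"


section \<open>Piecewise-geodesic loops\<close>

text \<open>A path in \<open>F\<^sub>g\<close> is a constant-speed geodesic loop at \<open>y\<^sub>0 = p(0)\<close> representing \<open>\<gamma>\<close> if its
  lift starting at \<open>0\<close> is a constant-speed geodesic that ends at \<open>\<gamma>(0)\<close>.\<close>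

definition geodesic_loop_representing ::
    "nat \<Rightarrow> (complex \<Rightarrow> complex) \<Rightarrow> (real \<Rightarrow> complex set) \<Rightarrow> bool" where
  "geodesic_loop_representing g \<gamma> l \<longleftrightarrow>
     (\<exists>c. constant_speed_geodesic c \<and> c 0 = 0 \<and> c 1 = \<gamma> 0 \<and> (\<forall>t\<in>{0..1}. l t = covering g (c t)))"

definition p_circle :: "real \<Rightarrow> complex" where
  "p_circle t = cis (2 * pi * t)"

text \<open>Loops are functions on \<open>\<complex>\<close> of which only the values on the unit circle matter. Letters are
  numbered from \<open>0\<close>, whence \<open>k + t\<close> in place of \<open>k + t - 1\<close>.\<close>

definition piecewise_geodesic_loop ::
    "nat \<Rightarrow> letter list \<Rightarrow> (complex \<Rightarrow> complex set) \<Rightarrow> bool" where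
  "piecewise_geodesic_loop g w \<phi> \<longleftrightarrow>
     w \<in> lists (letters g) \<and> word_elt g w \<noteq> \<one>\<^bsub>surface_group g\<^esub> \<and>
     (\<forall>k<length w. geodesic_loop_representing g (letter_elt g (w ! k))
        (\<lambda>t. \<phi> (p_circle ((real k + t) / real (length w)))))"


section \<open>Common values\<close>

definition CVP :: "('a \<Rightarrow> 'b) \<Rightarrow> ('a \<Rightarrow> 'b) \<Rightarrow> ('a \<times> 'a) set" where
  "CVP f h = {(u, v). f u = h v}"

definition lifting :: "nat \<Rightarrow> (complex \<Rightarrow> complex set) \<Rightarrow> (real \<Rightarrow> complex) \<Rightarrow> bool" where
  "lifting g \<phi> f \<longleftrightarrow>
     continuous_on UNIV f \<and> range f \<subseteq> poincare_disk \<and> (\<forall>t. covering g (f t) = \<phi> (p_circle t))"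

definition common_value_class ::
    "nat \<Rightarrow> (complex \<Rightarrow> complex set) \<Rightarrow> (complex \<Rightarrow> complex set) \<Rightarrow> (complex \<times> complex) set \<Rightarrow> bool"
  where
  "common_value_class g \<phi> \<psi> K \<longleftrightarrow>
     K \<noteq> {} \<and>
     (\<exists>f h. lifting g \<phi> f \<and> lifting g \<psi> h \<and> K = map_prod p_circle p_circle ` CVP f h)"

end

theory Submission
  imports Defs
begin

text \<open>Let \<open>P\<close> be the regular \<open>4g\<close>-gon around \<open>0\<close> cut out by the perpendicular bisectors (walls) of
  the segments from \<open>0\<close> to \<open>\<delta>\<^sub>j(0)\<close> and \<open>\<delta>\<^sub>j\<^sup>-\<^sup>1(0)\<close>. Its angles are \<open>\<pi> / (2g)\<close>, two walls that are not
  adjacent are disjoint, and going once around a corner gives the defining relation. A ping-pong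
  argument shows that a non-empty \<open>D\<close>-reduced word with first letter \<open>u\<close> maps \<open>P\<close> beyond the wall
  \<open>u\<close>, and beyond an adjacent wall as well only if it begins by running around the common corner in a
  way that \<open>D\<close> permits in just one of the two directions. Hence distinct \<open>D\<close>-reduced words give
  disjoint images of \<open>P\<close>, and since every element of the group has a \<open>D\<close>-reduced word, these are
  normal forms and the edges of the Cayley graph meet only in vertices.

  The leading words are stable under inversion, and every subword of a periodic word with a
  cyclically \<open>D\<close>-reduced period is \<open>D\<close>-reduced. So the lifts of the two loops are edge paths of
  which all finite pieces are normal forms, in either direction, and two such paths coincide between
  any two common vertices.\<close>

section \<open>The side functions of the polygon\<close>

text \<open>In the Klein model the equations of all walls through a corner are combinations of those
  of two adjacent sides, and a step round the corner shifts \<open>n\<close> in the coefficients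
  \<open>sin (n * alpha)\<close>. Ping-pong is delicate because the half-planes of adjacent sides
  overlap: the image of the polygon may lie beyond both, and the letter put in front could then
  bring it back over a wall. After a run of \<open>2g - 1\<close> letters round a corner, the rest
  of the word is only known to be in the sector next to the polygon. It may then finish the half
  turn or begin the same turn anew. The second possibility, repeated \<open>s\<close> times, is the
  origin of the infinite families of leading words, which the induction has to exclude. The open
  images of the polygon contain each edge except for its midpoint, which lies on a wall; midpoints
  are reached by continuity and need cases of their own. After rescaling, every edge takes unit
  time, so a shared edge gives a segment of slope 1 or -1 in the plane of parameters.\<close>

definition disk_transl :: "real \<Rightarrow> complex \<Rightarrow> complex \<Rightarrow> complex" where
  "disk_transl a T z = (z + of_real a * T) / (1 + of_real a * cnj T * z)"

text \<open>Affine in the Klein coordinate \<open>2z / (1 + |z|\<^sup>2)\<close>, and positive on the half-plane whose boundary is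
  orthogonal to the radius towards \<open>S\<close>, at Klein distance \<open>a\<close> from \<open>0\<close>.\<close>

definition wall :: "real \<Rightarrow> complex \<Rightarrow> complex \<Rightarrow> real" where
  "wall a S z = 2 * Re (z * cnj S) - a * (1 + (cmod z)\<^sup>2)"

lemma disk_transl_denom_nonzero:
  assumes "cmod T = 1" "0 \<le> a" "a < 1" "cmod z < 1"
  shows "1 + of_real a * cnj T * z \<noteq> 0"
proof
  assume "1 + of_real a * cnj T * z = 0"
  then have "of_real a * cnj T * z = -1" by (simp add: add_eq_0_iff)
  then have "cmod (of_real a * cnj T * z) = 1" by simp
  then have "a * cmod z = 1" using assms by (simp add: norm_mult)
  moreover have "a * cmod z < 1" using assms
    using mult_right_mono[of a 1 "cmod z"] by simp
  ultimately show False by simp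
qed

lemma disk_transl_norm_lt_1:
  assumes "cmod T = 1" "0 \<le> a" "a < 1" "cmod z < 1"
  shows "cmod (disk_transl a T z) < 1"
proof -
  have "disk_transl a T z = Moebius_function 0 (- (of_real a * T)) z"
    by (simp add: disk_transl_def Moebius_function_simple)
  then show ?thesis
    using Moebius_function_norm_lt_1[of "- (of_real a * T)" z 0] assms by (simp add: norm_mult)
qed

lemma disk_transl_inverse:
  assumes "cmod T = 1" "0 \<le> a" "a < 1" "cmod z < 1"
  shows "disk_transl a (- T) (disk_transl a T z) = z"
proof -
  have "disk_transl a T z = Moebius_function 0 (- (of_real a * T)) z" "\<And>z. disk_transl a (- T) z = Moebius_function 0 (of_real a * T) z"
    by (simp_all add: disk_transl_def Moebius_function_simple)
  then show ?thesis
    using Moebius_function_compose[of "of_real a * T" "-(of_real a * T)" z] assms by (simp add: norm_mult)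
qed

text \<open>Translations are projective maps of the Klein model. Once the squared denominator is
  cleared, the pullback of a wall is therefore again affine in the Klein coordinate of
  \<open>z\<close>, up to the factor \<open>1 + |z|^2\<close>.\<close>

lemma wall_disk_transl:
  assumes "cmod T = 1" "0 \<le> a" "a < 1" "cmod z < 1"
  defines "x \<equiv> Re (z * cnj T)" and "y \<equiv> Im (z * cnj T)"
  shows "wall a (T * cis \<theta>) (disk_transl a T z) * (cmod (1 + of_real a * cnj T * z))\<^sup>2 =
    2 * cos \<theta> * ((1 + a\<^sup>2) * x + a * (1 + (cmod z)\<^sup>2)) + 2 * sin \<theta> * (1 - a\<^sup>2) * y
     - a * ((1 + a\<^sup>2) * (1 + (cmod z)\<^sup>2) + 4 * a * x)"
proof -
  define u where "u = z * cnj T"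
  have TT: "T * cnj T = 1" using assms(1) by (simp add: complex_norm_square[symmetric])
  have zu: "z = T * u" using TT by (simp add: u_def mult.left_commute)
  define N where "N = u + of_real a"
  define D where "D = 1 + of_real a * u"
  have u: "u = Complex x y" by (simp add: u_def x_def y_def complex_eq_iff)
  have D: "1 + of_real a * cnj T * z = D" by (simp add: D_def u_def mult_ac)
  then have D0: "D \<noteq> 0" using disk_transl_denom_nonzero[OF assms(1-4)] by simp
  have m: "disk_transl a T z = T * (N / D)"
  proof -
    have "z + of_real a * T = T * N" unfolding zu N_def by (simp add: algebra_simps)
    then show ?thesis unfolding disk_transl_def D by simp
  qed
  have cz: "cmod z = cmod u" using assms(1) by (simp add: zu norm_mult)
  have n: "(cmod z)\<^sup>2 = x\<^sup>2 + y\<^sup>2" by (simp add: cz u cmod_power2)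
  have Dn: "(cmod D)\<^sup>2 = (1 + a * x)\<^sup>2 + (a * y)\<^sup>2" by (simp add: D_def u cmod_power2)
  have Nn: "(cmod N)\<^sup>2 = (x + a)\<^sup>2 + y\<^sup>2" by (simp add: N_def u cmod_power2)
  have ND: "N / D = N * cnj D / of_real ((cmod D)\<^sup>2)"
  proof -
    have "N / D = (N * cnj D) / (D * cnj D)" using D0 by simp
    then show ?thesis unfolding complex_norm_square .
  qed
  have e1: "disk_transl a T z * cnj (T * cis \<theta>) = (N / D) * cis (-\<theta>)"
    using TT by (simp add: m cis_cnj mult_ac)
  have e2: "Re ((N / D) * cis (-\<theta>)) * (cmod D)\<^sup>2 = Re (N * cnj D * cis (-\<theta>))"
  proof -
    have "(N / D) * cis (-\<theta>) * of_real ((cmod D)\<^sup>2) = N * cnj D * cis (-\<theta>)"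
      using D0 by (simp add: ND)
    moreover have "Re (w * of_real t) = Re w * t" for w t by simp
    ultimately show ?thesis by metis
  qed
  have e3: "Re (N * cnj D * cis (-\<theta>)) = cos \<theta> * ((1 + a\<^sup>2) * x + a * (1 + x\<^sup>2 + y\<^sup>2)) + sin \<theta> * (1 - a\<^sup>2) * y"
    by (simp add: N_def D_def u algebra_simps power2_eq_square)
  have e4: "(cmod (disk_transl a T z))\<^sup>2 * (cmod D)\<^sup>2 = (cmod N)\<^sup>2"
    using D0 assms(1) by (simp add: m norm_mult norm_divide power_divide)
  have "wall a (T * cis \<theta>) (disk_transl a T z) * (cmod D)\<^sup>2
     = 2 * (Re ((N / D) * cis (-\<theta>)) * (cmod D)\<^sup>2) - a * ((cmod D)\<^sup>2 + (cmod (disk_transl a T z))\<^sup>2 * (cmod D)\<^sup>2)"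
  proof -
    define R where "R = Re ((N / D) * cis (-\<theta>))"
    show ?thesis unfolding wall_def e1 R_def[symmetric] by (simp only: algebra_simps)
  qed
  also have "\<dots> = 2 * (cos \<theta> * ((1 + a\<^sup>2) * x + a * (1 + x\<^sup>2 + y\<^sup>2)) + sin \<theta> * (1 - a\<^sup>2) * y)
      - a * (((1 + a * x)\<^sup>2 + (a * y)\<^sup>2) + ((x + a)\<^sup>2 + y\<^sup>2))"
    unfolding e2 e3 e4 unfolding Dn Nn ..
  finally show ?thesis unfolding D n by (simp add: algebra_simps power2_eq_square)
qed

locale genus =
  fixes g :: nat
  assumes g2: "2 \<le> g"
begin

definition alpha :: real where "alpha = pi / (2 * real g)"
definition cos_alpha :: real where "cos_alpha = cos alpha"
text \<open>The Klein distance from \<open>0\<close> to the sides for which adjacent sides make the angle \<open>alpha\<close>; it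
  is also \<open>tanh (L / 2)\<close> for the translation length \<open>L\<close>.\<close>

definition apothem :: real where "apothem = sqrt (2 * cos_alpha / (1 + cos_alpha))"

text \<open>A letter is numbered, modulo \<open>4g\<close>, by its position in the relator
  \<open>c\<^sub>1 \<dots> c\<^sub>2\<^sub>g c\<^sub>1\<^sup>-\<^sup>1 \<dots> c\<^sub>2\<^sub>g\<^sup>-\<^sup>1\<close>, so that going around a corner of the polygon changes the number by
  \<open>1\<close> or \<open>-1\<close> in each step. Inversion adds \<open>2g\<close>, and the two directions at angle \<open>alpha\<close> from
  direction \<open>k\<close> have the numbers \<open>k + 2g + 1\<close> and \<open>k + 2g - 1\<close>.\<close>

definition dirn :: "int \<Rightarrow> complex" where "dirn k = cis (pi + of_int k * (pi + alpha))"
definition side :: "int \<Rightarrow> complex \<Rightarrow> real" where "side k = wall apothem (dirn k)"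
definition transl :: "int \<Rightarrow> complex \<Rightarrow> complex" where "transl k = disk_transl apothem (dirn k)"

abbreviation N :: int where "N \<equiv> 4 * int g"

lemma alpha_bounds: "0 < alpha" "alpha \<le> pi / 4" "2 * real g * alpha = pi"
  using g2 by (auto simp: alpha_def field_simps)

lemma cos_alpha_bounds: "0 < cos_alpha" "cos_alpha < 1"
proof -
  have "alpha < pi/2" using alpha_bounds pi_gt_zero by linarith
  then show "0 < cos_alpha" using alpha_bounds(1) by (simp add: cos_alpha_def cos_gt_zero)
  show "cos_alpha < 1" unfolding cos_alpha_def using cos_monotone_0_pi[of 0 alpha] alpha_bounds pi_gt_zero by simp
qed

text \<open>Two sides at Klein distance \<open>apothem\<close> whose normals make the angle
  \<open>alpha\<close> have an interior angle with cosine
  \<open>(apothem^2 - cos_alpha) / (1 - apothem^2)\<close>. Equating this with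
  \<open>cos_alpha\<close> gives the formula.\<close>

lemma apothem_sq: "apothem\<^sup>2 * (1 + cos_alpha) = 2 * cos_alpha"
  using cos_alpha_bounds by (simp add: apothem_def)

lemma apothem_bounds: "0 < apothem" "apothem < 1" "cos_alpha \<le> apothem"
proof -
  show "0 < apothem" using cos_alpha_bounds by (simp add: apothem_def)
  show "apothem < 1" using cos_alpha_bounds unfolding apothem_def real_sqrt_lt_1_iff by (simp add: field_simps)
  have "cos_alpha * (1 + cos_alpha) \<le> 2" using mult_mono[of cos_alpha 1 "1 + cos_alpha" 2] cos_alpha_bounds by simp
  then have "cos_alpha * (cos_alpha * (1 + cos_alpha)) \<le> cos_alpha * 2" using cos_alpha_bounds by (intro mult_left_mono) auto
  then have "cos_alpha\<^sup>2 \<le> 2 * cos_alpha / (1 + cos_alpha)" using cos_alpha_bounds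
    by (simp add: field_simps power2_eq_square)
  then show "cos_alpha \<le> apothem" unfolding apothem_def by (rule real_le_rsqrt)
qed

lemma cmod_dirn [simp]: "cmod (dirn k) = 1"
  by (simp add: dirn_def)

lemma dirn_add: "dirn (k + m) = dirn k * cis (of_int m * (pi + alpha))"
  by (simp add: dirn_def cis_mult algebra_simps)

lemma dirn_opp: "dirn (k + 2 * int g) = - dirn k"
proof -
  have "of_int (2 * int g) * (pi + alpha) = pi + 2 * pi * of_int (int g)"
    using alpha_bounds(3) by (simp add: algebra_simps)
  then have "cis (of_int (2 * int g) * (pi + alpha)) = cis pi * cis (2 * pi * of_int (int g))"
    by (simp only: cis_mult)
  then show ?thesis by (simp only: dirn_add cis_multiple_2pi[of "of_int (int g)"]) (simp add: cis_multiple_2pi)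
qed

lemma dirn_period: "dirn (k + N * m) = dirn k"
proof -
  have *: "dirn (k + N) = dirn k" for k
    using dirn_opp[of k] dirn_opp[of "k + 2 * int g"] by (simp add: algebra_simps)
  have **: "dirn (k + N * int m) = dirn k" for k m
  proof (induction m)
    case (Suc m)
    have "k + N * int (Suc m) = (k + N * int m) + N" by (simp add: algebra_simps)
    then show ?case using *[of "k + N * int m"] Suc by (simp only:)
  qed simp
  show ?thesis
    by (cases m rule: int_cases2) (use **[of k] **[of "k + N * m" "nat (-m)"] in auto)
qed

lemma dirn_mod: "dirn (k mod N) = dirn k"
  by (metis mod_mult_div_eq dirn_period)

lemma dirn_nb:
  assumes "e \<in> {1, -1}"
  shows "dirn (k + 2 * int g - e) = dirn k * cis (- of_int e * alpha)"
    and "dirn (k + e) = - (dirn k * cis (of_int e * alpha))"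
proof -
  have 1: "dirn (j + e) = - (dirn j * cis (of_int e * alpha))" if "e \<in> {1,-1}" for e j
  proof -
    have "cis (- (pi + alpha)) = - cis (- alpha)" by (simp add: complex_eq_iff cos_diff sin_diff del: minus_add_distrib)
    moreover have "cis (pi + alpha) = - cis alpha" by (simp add: complex_eq_iff)
    ultimately show ?thesis using that by (auto simp: dirn_add[of j] simp del: minus_add_distrib)
  qed
  show "dirn (k + e) = - (dirn k * cis (of_int e * alpha))" by (rule 1[OF assms])
  have "dirn (k + 2 * int g - e) = - (dirn (k + 2 * int g) * cis (of_int (-e) * alpha))"
    using 1[of "-e" "k + 2 * int g"] assms by auto
  then show "dirn (k + 2 * int g - e) = dirn k * cis (- of_int e * alpha)" by (simp add: dirn_opp)
qed

text \<open>\<open>transl k\<close> carries the wall \<open>k + 2g\<close> to the wall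
  \<open>k\<close>, exchanging the sides, and the corner between \<open>k + e\<close> and
  \<open>k + 2g\<close> to the corner between \<open>k\<close> and \<open>k + 2g - e\<close>. The
  pullback of the wall \<open>k + 2g - e\<close> thus passes through the former corner and is a
  combination of the two sides there.\<close>

lemma side_transl:
  fixes k :: int
  assumes "cmod z < 1"
  defines "r \<equiv> (cmod (1 + of_real apothem * cnj (dirn k) * z))\<^sup>2"
  shows "r > 0"
    and "side k (transl k z) * r = - (1 - apothem\<^sup>2) * side (k + 2 * int g) z"
    and "e \<in> {1, -1} \<Longrightarrow> side (k + 2 * int g - e) (transl k z) * r
      = (1 - apothem\<^sup>2) * (side (k + e) z + 2 * cos_alpha * side (k + 2 * int g) z)"
proof -
  have a: "0 \<le> apothem" "apothem < 1" using apothem_bounds by auto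
  show "r > 0" unfolding r_def using disk_transl_denom_nonzero[OF cmod_dirn a assms(1), of k] by simp
  define x y where "x = Re (z * cnj (dirn k))" and "y = Im (z * cnj (dirn k))"
  note L = wall_disk_transl[OF cmod_dirn a assms(1), of k, folded r_def x_def y_def]
  have l2: "side (k + 2 * int g) z = - 2 * x - apothem * (1 + (cmod z)\<^sup>2)"
    by (simp add: side_def wall_def dirn_opp x_def)
  show "side k (transl k z) * r = - (1 - apothem\<^sup>2) * side (k + 2 * int g) z"
    unfolding l2 using L[of 0] by (simp add: side_def transl_def algebra_simps power2_eq_square)
  assume e: "e \<in> {1, -1}"
  have l1: "side (k + e) z = - 2 * (cos_alpha * x + of_int e * sin alpha * y) - apothem * (1 + (cmod z)\<^sup>2)"
    using e unfolding side_def wall_def dirn_nb[OF e] x_def y_def cos_alpha_def by (auto simp: algebra_simps)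
  have s: "2 * cos (- of_int e * alpha) * t + 2 * sin (- of_int e * alpha) * u = 2 * cos_alpha * t - 2 * of_int e * sin alpha * u" for t u
    using e by (auto simp: cos_alpha_def)
  define n where "n = 1 + (cmod z)\<^sup>2"
  have "side (k + 2 * int g - e) (transl k z) * r = 
    2 * cos (- of_int e * alpha) * ((1 + apothem\<^sup>2) * x + apothem * n) + 2 * sin (- of_int e * alpha) * ((1 - apothem\<^sup>2) * y)
     - apothem * ((1 + apothem\<^sup>2) * n + 4 * apothem * x)"
    using L[of "- of_int e * alpha"] unfolding side_def transl_def dirn_nb[OF e] n_def by (simp add: mult.assoc)
  also have "\<dots> = 2 * cos_alpha * ((1 + apothem\<^sup>2) * x + apothem * n) - 2 * of_int e * sin alpha * ((1 - apothem\<^sup>2) * y) - apothem * ((1 + apothem\<^sup>2) * n + 4 * apothem * x)"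
    unfolding s ..
  also have "\<dots> = (1 - apothem\<^sup>2) * (- 2 * (cos_alpha * x + of_int e * sin alpha * y) - apothem * n + 2 * cos_alpha * (- 2 * x - apothem * n))"
  proof -
    \<comment> \<open>The two sides differ by a multiple of the defect of \<open>apothem_sq\<close>:
      here the choice of \<open>apothem\<close> enters.\<close>
    have "(2 * cos_alpha * ((1 + apothem\<^sup>2) * x + apothem * n) - apothem * ((1 + apothem\<^sup>2) * n + 4 * apothem * x))
        - (1 - apothem\<^sup>2) * (- 2 * (cos_alpha * x) - apothem * n + 2 * cos_alpha * (- 2 * x - apothem * n))
       = (2 * cos_alpha - apothem\<^sup>2 * (1 + cos_alpha)) * (4 * x + 2 * n * apothem)"
      by (simp add: algebra_simps power2_eq_square)
    then have "2 * cos_alpha * ((1 + apothem\<^sup>2) * x + apothem * n) - apothem * ((1 + apothem\<^sup>2) * n + 4 * apothem * x)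
        = (1 - apothem\<^sup>2) * (- 2 * (cos_alpha * x) - apothem * n + 2 * cos_alpha * (- 2 * x - apothem * n))" using apothem_sq by simp
    then show ?thesis by (simp only: algebra_simps)
  qed
  finally show "side (k + 2 * int g - e) (transl k z) * r
      = (1 - apothem\<^sup>2) * (side (k + e) z + 2 * cos_alpha * side (k + 2 * int g) z)"
    unfolding l1 l2 n_def .
qed


section \<open>Angles between directions, and which half-planes meet\<close>

lemma dirn_cong: "k mod N = m mod N \<Longrightarrow> dirn k = dirn m"
  by (metis dirn_mod)

lemma side_cong: "k mod N = m mod N \<Longrightarrow> side k = side m"
  by (simp add: side_def dirn_cong[of k m])

lemma transl_cong: "k mod N = m mod N \<Longrightarrow> transl k = transl m"
  by (simp add: transl_def dirn_cong[of k m])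

lemma transl_norm: "cmod z < 1 \<Longrightarrow> cmod (transl k z) < 1"
  using disk_transl_norm_lt_1[of "dirn k" apothem z] apothem_bounds by (simp add: transl_def)

lemma transl_inverse:
  assumes "cmod z < 1"
  shows "transl (k + 2 * int g) (transl k z) = z" "transl k (transl (k + 2 * int g) z) = z"
  using disk_transl_inverse[of "dirn k" apothem z] disk_transl_inverse[of "- dirn k" apothem z] apothem_bounds assms
  by (simp_all add: transl_def dirn_opp)

text \<open>Consecutive numbers differ by the angle \<open>pi + alpha = (2g + 1) * alpha\<close>,
  and \<open>2g + 1\<close> is its own inverse modulo \<open>4g\<close>. So the difference of the
  numbers and the angle \<open>d\<close>, in units of \<open>alpha\<close>, determine each
  other.\<close>

lemma dirn_angle:
  obtains d where "- 2 * int g \<le> d" "d < 2 * int g" "(m - k) mod N = (d * (2 * int g + 1)) mod N"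
    "Re (dirn m * cnj (dirn k)) = cos (of_int d * alpha)"
proof
  define j where "j = m - k"
  define d where "d = (j * (2 * int g + 1) + 2 * int g) mod N - 2 * int g"
  show "- 2 * int g \<le> d" using g2 by (simp add: d_def)
  have "(j * (2 * int g + 1) + 2 * int g) mod N < N" using g2 by (intro pos_mod_bound) simp
  then show "d < 2 * int g" by (simp add: d_def)
  obtain q where q: "j * (2 * int g + 1) = d + N * q"
  proof
    show "j * (2 * int g + 1) = d + N * ((j * (2 * int g + 1) + 2 * int g) div N)"
      unfolding d_def using mult_div_mod_eq[of N "j * (2 * int g + 1) + 2 * int g"] by linarith
  qed
  have "j = (j * (2 * int g + 1)) * (2 * int g + 1) - N * (j * (int g + 1))"
    by (simp add: algebra_simps)
  also have "\<dots> = d * (2 * int g + 1) + N * (q * (2 * int g + 1) - j * (int g + 1))"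
    unfolding q by (simp add: algebra_simps)
  finally show "(m - k) mod N = (d * (2 * int g + 1)) mod N" unfolding j_def[symmetric]
    by (metis mod_mult_self2)
  have pa: "pi + alpha = of_int (2 * int g + 1) * alpha" using alpha_bounds(3) by (simp add: algebra_simps)
  have "Re (dirn m * cnj (dirn k)) = cos (of_int j * (pi + alpha))"
    by (simp add: dirn_def cis_cnj cis_mult j_def algebra_simps)
  also have "\<dots> = cos (of_int (j * (2 * int g + 1)) * alpha)" unfolding pa by (simp only: of_int_mult mult.assoc)
  also have "\<dots> = cos (of_int d * alpha + 2 * pi * of_int q)"
    unfolding q alpha_bounds(3)[symmetric] by (simp add: algebra_simps)
  also have "\<dots> = cos (of_int d * alpha)" by (simp add: cos_add)
  finally show "Re (dirn m * cnj (dirn k)) = cos (of_int d * alpha)" .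
qed

lemma cos_step:
  assumes "- 2 * int g \<le> d" "d < 2 * int g" "0 \<le> n" "n * alpha \<le> pi" "cos (of_int d * alpha) > cos (n * alpha)"
  shows "\<bar>of_int d\<bar> < n"
proof (rule ccontr)
  assume "\<not> ?thesis"
  then have 1: "n * alpha \<le> \<bar>of_int d\<bar> * alpha" using alpha_bounds(1) by (intro mult_right_mono) auto
  have "\<bar>d\<bar> \<le> 2 * int g" using assms by auto
  then have "\<bar>real_of_int d\<bar> \<le> 2 * real g" by linarith
  then have "\<bar>real_of_int d\<bar> * alpha \<le> 2 * real g * alpha" using alpha_bounds(1) by (intro mult_right_mono) auto
  then have 2: "\<bar>real_of_int d\<bar> * alpha \<le> pi" using alpha_bounds(3) by simp
  have "cos (\<bar>of_int d\<bar> * alpha) = cos (of_int d * alpha)"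
    by (cases "d \<ge> 0") auto
  moreover have "cos (\<bar>of_int d\<bar> * alpha) \<le> cos (n * alpha)"
    using 1 2 assms(3) alpha_bounds(1) by (intro cos_monotone_0_pi_le) auto
  ultimately show False using assms(5) by linarith
qed

lemma dirn_inj: "dirn m = dirn k \<longleftrightarrow> m mod N = k mod N"
proof
  assume "dirn m = dirn k"
  obtain d where d: "- 2 * int g \<le> d" "d < 2 * int g" "(m - k) mod N = (d * (2 * int g + 1)) mod N"
    "Re (dirn m * cnj (dirn k)) = cos (of_int d * alpha)" by (rule dirn_angle)
  have "dirn m * cnj (dirn k) = 1" using \<open>dirn m = dirn k\<close> cmod_dirn[of k]
    by (simp add: complex_norm_square[symmetric])
  then have "cos (of_int d * alpha) = 1" using d(4) by simp
  then have "\<bar>of_int d :: real\<bar> < 1" using cos_step[OF d(1,2), of 1] cos_alpha_bounds alpha_bounds pi_gt_zero by (simp add: cos_alpha_def)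
  then have "d = 0" by linarith
  then show "m mod N = k mod N" using d(3) by (simp add: mod_eq_dvd_iff mod_0_imp_dvd)
qed (rule dirn_cong)

text \<open>Adding the inequalities and using \<open>2 * |z| <= 1 + |z|^2\<close> gives
  \<open>|dirn k + dirn m| > 2 * apothem >= 2 * cos_alpha\<close>. Hence the angle is less than
  \<open>2 * alpha\<close>, and being a multiple of \<open>alpha\<close> it is at most
  \<open>alpha\<close>. One inequality is weak so that points on a wall are covered.\<close>

lemma half_planes_disjoint:
  assumes "cmod z < 1" "side k z > 0" "side m z \<ge> 0"
  shows "m mod N = k mod N \<or> (\<exists>e\<in>{1,-1}. m mod N = (k + 2 * int g - e) mod N)"
proof -
  obtain d where d: "- 2 * int g \<le> d" "d < 2 * int g" "(m - k) mod N = (d * (2 * int g + 1)) mod N"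
    "Re (dirn m * cnj (dirn k)) = cos (of_int d * alpha)" by (rule dirn_angle)
  have "2 * Re (z * cnj (dirn k + dirn m)) > 2 * (apothem * (1 + (cmod z)\<^sup>2))"
    using assms(2,3) by (simp add: side_def wall_def algebra_simps)
  moreover have "Re (z * cnj (dirn k + dirn m)) \<le> cmod z * cmod (dirn k + dirn m)"
    by (metis complex_Re_le_cmod complex_mod_cnj norm_mult)
  moreover have "apothem * (2 * cmod z) \<le> apothem * (1 + (cmod z)\<^sup>2)"
    using apothem_bounds sum_squares_bound[of 1 "cmod z"] by (intro mult_left_mono) auto
  ultimately have "cmod z * (2 * apothem) < cmod z * cmod (dirn k + dirn m)" by (simp add: algebra_simps)
  then have "2 * apothem < cmod (dirn k + dirn m)" by (simp add: mult_less_cancel_left)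
  then have "2 * cos_alpha < cmod (dirn k + dirn m)" using apothem_bounds by linarith
  then have "(2 * cos_alpha)\<^sup>2 < (cmod (dirn k + dirn m))\<^sup>2" using cos_alpha_bounds by (intro power_strict_mono) auto
  moreover have "(cmod (dirn k + dirn m))\<^sup>2 = 2 + 2 * Re (dirn m * cnj (dirn k))"
  proof -
    have "(cmod (dirn k))\<^sup>2 = 1" "(cmod (dirn m))\<^sup>2 = 1" by simp_all
    then show ?thesis unfolding cmod_power2 by (simp add: algebra_simps power2_eq_square)
  qed
  ultimately have "cos (2 * alpha) < cos (of_int d * alpha)" unfolding d(4)
    using cos_double_cos[of alpha] by (simp add: cos_alpha_def power_mult_distrib)
  then have "\<bar>of_int d :: real\<bar> < 2" using cos_step[OF d(1,2), of 2] alpha_bounds pi_gt_zero by simp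
  then have "d \<in> {-1, 0, 1}" by auto
  moreover have "m mod N = (k + d * (2 * int g + 1)) mod N"
    using d(3) by (simp only: mod_eq_dvd_iff diff_diff_eq)
  moreover have "(k - (2 * int g + 1)) mod N = (k + 2 * int g - 1) mod N"
  proof -
    have "k + 2 * int g - 1 = (k - (2 * int g + 1)) + N" by simp
    then show ?thesis by (metis mod_add_self2)
  qed
  ultimately show ?thesis by (auto simp: algebra_simps)
qed

text \<open>Up to a positive factor, the equation of the \<open>n\<close>-th wall through the
  corner: \<open>n = 1\<close> gives the side \<open>k\<close>, and \<open>n = 0\<close> the side
  \<open>k + 2g - e\<close> with the opposite sign. As a function of \<open>n\<close> it satisfies
  \<open>f (n + 1) + f (n - 1) = 2 * cos_alpha * f n\<close>.\<close>

definition corner_fun :: "int \<Rightarrow> real \<Rightarrow> int \<Rightarrow> complex \<Rightarrow> real" where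
  "corner_fun e n k z = sin (n * alpha) * side k z + sin ((n - 1) * alpha) * side (k + 2 * int g - e) z"

text \<open>The coefficient \<open>2 * cos_alpha\<close> in \<open>side_transl\<close> is that of
  the recurrence of the sines, so a step lowers the index by one. The factor \<open>r\<close> is the
  same for all \<open>n\<close>, hence both inequalities of a sector are preserved.\<close>

lemma corner_fun_transl:
  fixes e k :: int
  assumes "cmod z < 1" "e \<in> {1, -1}"
  obtains r where "r > 0" "\<And>n. corner_fun e n k (transl k z) = r * corner_fun e (n - 1) (k + e) z"
proof
  define r where "r = (cmod (1 + of_real apothem * cnj (dirn k) * z))\<^sup>2"
  note L = side_transl[OF assms(1), where k = k, folded r_def]
  have "apothem\<^sup>2 < 1" using apothem_bounds by (simp add: power_less_one_iff)
  then show "(1 - apothem\<^sup>2) / r > 0" using L(1) by simp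
  fix n
  have "2 * cos_alpha * sin ((n - 1) * alpha) - sin (n * alpha) = sin ((n - 1 - 1) * alpha)"
    using sin_add[of "(n - 1) * alpha" alpha] sin_diff[of "(n - 1) * alpha" alpha]
    by (simp add: cos_alpha_def algebra_simps)
  then have *: "sin ((n - 1 - 1) * alpha) = 2 * cos_alpha * sin ((n - 1) * alpha) - sin (n * alpha)" by simp
  have "corner_fun e n k (transl k z) * r = sin (n * alpha) * (side k (transl k z) * r) + sin ((n - 1) * alpha) * (side (k + 2 * int g - e) (transl k z) * r)"
    by (simp add: corner_fun_def algebra_simps)
  also have "\<dots> = (1 - apothem\<^sup>2) * corner_fun e (n - 1) (k + e) z"
    unfolding L(2) L(3)[OF assms(2)] corner_fun_def[of _ "n - 1"] * by (simp add: algebra_simps)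
  finally show "corner_fun e n k (transl k z) = (1 - apothem\<^sup>2) / r * corner_fun e (n - 1) (k + e) z"
    using L(1) by (simp add: field_simps)
qed

text \<open>The \<open>n\<close>-th of the \<open>4g\<close> sectors cut out by the walls through the corner of the polygon
  between the sides \<open>k\<close> and \<open>k + 2g - e\<close>; the polygon itself lies in sector \<open>0\<close>.\<close>

definition sector :: "int \<Rightarrow> nat \<Rightarrow> int \<Rightarrow> complex \<Rightarrow> bool" where
  "sector e n k z \<longleftrightarrow> corner_fun e (real n) k z \<ge> 0 \<and> corner_fun e (real n + 1) k z < 0"

lemma sector_transl:
  assumes "cmod z < 1" "e \<in> {1, -1}"
  shows "sector e (Suc n) k (transl k z) \<longleftrightarrow> sector e n (k + e) z"
proof -
  obtain r where r: "r > 0" "\<And>n. corner_fun e n k (transl k z) = r * corner_fun e (n - 1) (k + e) z"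
    using corner_fun_transl[OF assms, where k = k] by blast
  show ?thesis using r(1) by (simp add: sector_def r(2) mult_less_0_iff zero_le_mult_iff algebra_simps)
qed

lemma sin_step:
  assumes "0 < n" "n < 2 * g"
  shows "sin (real n * alpha) > 0"
proof -
  have "real n * alpha < 2 * real g * alpha" using assms alpha_bounds by (intro mult_strict_right_mono) auto
  then show ?thesis using alpha_bounds assms by (intro sin_gt_zero) auto
qed

lemma sin_step': "n \<le> 2 * g \<Longrightarrow> sin (real n * alpha) \<ge> 0"
  using sin_step[of n] alpha_bounds(3) by (cases "n = 0 \<or> n = 2 * g") auto

text \<open>Half a turn, \<open>2 * g * alpha = pi\<close>, leads from the polygon to the opposite
  sector, beyond both sides.\<close>

lemma sector_top:
  assumes "side k z > 0" "side (k + 2 * int g - e) z \<ge> 0"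
  shows "sector e (2 * g) k z"
proof -
  have 1: "sin (2 * real g * alpha) = 0" using alpha_bounds(3) by simp
  have 2: "sin ((2 * real g + 1) * alpha) = - sin alpha" "sin ((2 * real g - 1) * alpha) = sin alpha"
    using alpha_bounds(3) by (simp_all add: distrib_right left_diff_distrib)
  have "sin alpha > 0" using sin_step[of 1] g2 by simp
  then show ?thesis using assms by (simp add: sector_def corner_fun_def 1 2)
qed

text \<open>Cramer's rule for two consecutive corner functions. The determinant \<open>sin (n *
  alpha)^2 - sin ((n - 1) * alpha) * sin ((n + 1) * alpha)\<close> is \<open>sin alpha^2\<close> for
  every \<open>n\<close>.\<close>

lemma sector_solve:
  fixes n :: real
  shows "sin alpha ^ 2 * side k z = sin (n * alpha) * corner_fun e n k z - sin ((n - 1) * alpha) * corner_fun e (n + 1) k z"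
    and "sin alpha ^ 2 * side (k + 2 * int g - e) z = sin (n * alpha) * corner_fun e (n + 1) k z - sin ((n + 1) * alpha) * corner_fun e n k z"
proof -
  have "sin ((n - 1) * alpha) * sin ((n + 1) * alpha) = sin (n * alpha) ^ 2 - sin alpha ^ 2"
  proof -
    have "sin ((n - 1) * alpha) * sin ((n + 1) * alpha) = (sin (n * alpha) * cos alpha)\<^sup>2 - (cos (n * alpha) * sin alpha)\<^sup>2"
      by (simp add: distrib_right left_diff_distrib sin_add sin_diff power2_eq_square algebra_simps)
    also have "\<dots> = sin (n * alpha) ^ 2 - sin alpha ^ 2"
      by (simp add: power_mult_distrib cos_squared_eq algebra_simps)
    finally show ?thesis .
  qed
  then have *: "sin alpha ^ 2 = sin (n * alpha) ^ 2 - sin ((n - 1) * alpha) * sin ((n + 1) * alpha)" by simp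
  show "sin alpha ^ 2 * side k z = sin (n * alpha) * corner_fun e n k z - sin ((n - 1) * alpha) * corner_fun e (n + 1) k z"
    "sin alpha ^ 2 * side (k + 2 * int g - e) z = sin (n * alpha) * corner_fun e (n + 1) k z - sin ((n + 1) * alpha) * corner_fun e n k z"
    unfolding * corner_fun_def by (simp_all add: algebra_simps power2_eq_square)
qed

lemma sin_alpha_sq: "sin alpha ^ 2 > 0"
  using sin_step[of 1] g2 by simp

lemma sector_pos:
  assumes "sector e n k z" "2 \<le> n" "n \<le> 2 * g"
  shows "side k z > 0"
proof -
  have "sin (real (n - 1) * alpha) > 0" "sin (real n * alpha) \<ge> 0" using sin_step[of "n-1"] sin_step'[of n] assms by auto
  then have "0 < sin (real n * alpha) * corner_fun e n k z - sin ((real n - 1) * alpha) * corner_fun e (real n + 1) k z"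
  proof -
    have "0 \<le> sin (real n * alpha) * corner_fun e n k z" using assms \<open>0 \<le> sin (real n * alpha)\<close> by (simp add: sector_def)
    moreover have "sin ((real n - 1) * alpha) > 0" using \<open>sin (real (n - 1) * alpha) > 0\<close> assms by (simp add: of_nat_diff)
    then have "sin ((real n - 1) * alpha) * corner_fun e (real n + 1) k z < 0" using assms by (simp add: sector_def mult_pos_neg)
    ultimately show ?thesis by linarith
  qed
  then show ?thesis unfolding sector_solve(1)[of k z "real n" e, symmetric]
    using sin_alpha_sq by (simp add: zero_less_mult_iff)
qed

lemma sector_one: "sector e 1 k z \<Longrightarrow> side k z \<ge> 0"
  using sin_step[of 1] g2 by (simp add: sector_def corner_fun_def zero_le_mult_iff)

lemma sector_neighbour:
  assumes "sector e n k z" "1 \<le> n" "n < 2 * g"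
  shows "side (k + 2 * int g - e) z < 0"
proof -
  have "sin (real n * alpha) > 0" "sin (real (n + 1) * alpha) \<ge> 0" using sin_step[of n] sin_step'[of "n+1"] assms by auto
  then have "sin (real n * alpha) * corner_fun e (real n + 1) k z < 0" "sin ((real n + 1) * alpha) * corner_fun e n k z \<ge> 0"
    using assms(1) by (auto simp: sector_def mult_pos_neg add.commute)
  then have "sin alpha ^ 2 * side (k + 2 * int g - e) z < 0" unfolding sector_solve(2)[of k e z "real n"] by linarith
  then show ?thesis using sin_alpha_sq by (simp add: mult_less_0_iff)
qed

text \<open>Pulled back over the wall \<open>k\<close>, a counterexample would lie beyond both
  \<open>k + e\<close> and \<open>k - e\<close>. These directions make the angle
  \<open>2 * alpha\<close>, so \<open>half_planes_disjoint\<close> excludes it.\<close>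

lemma sector_other_side:
  assumes z: "cmod z < 1" and e: "e \<in> {1, -1}" and s: "sector e n k z" "2 \<le> n" "n \<le> 2 * g"
  shows "side (k + 2 * int g + e) z \<le> 0"
proof (rule ccontr)
  assume "\<not> ?thesis"
  then have pos: "side (k + 2 * int g + e) z > 0" by simp
  define y where "y = transl (k + 2 * int g) z"
  have y: "cmod y < 1" "transl k y = z" using z by (auto simp: y_def transl_norm transl_inverse)
  have "sector e (n - 1) (k + e) y" using sector_transl[OF y(1) e, of "n - 1" k] s by (simp add: y)
  then have 1: "side (k + e) y \<ge> 0"
  proof (cases "n = 2")
    case True
    then show ?thesis using sector_one \<open>sector e (n - 1) (k + e) y\<close> by simp
  next
    case False
    then show ?thesis using sector_pos[of e "n - 1" "k + e" y] \<open>sector e (n - 1) (k + e) y\<close> s by linarith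
  qed
  define r where "r = (cmod (1 + of_real apothem * cnj (dirn k) * y))\<^sup>2"
  note L = side_transl[OF y(1), where k = k, folded r_def, unfolded y(2)]
  have a1: "1 - apothem\<^sup>2 > 0" using apothem_bounds by (simp add: power_less_one_iff)
  have "side k z * r > 0" using sector_pos[OF s] L(1) by simp
  then have 2: "side (k + 2 * int g) y < 0" using a1 unfolding L(2) by (simp add: mult_less_0_iff zero_less_mult_iff)
  have "side (k + 2 * int g - (-e)) z * r > 0" using pos L(1) by simp
  then have "side (k - e) y + 2 * cos_alpha * side (k + 2 * int g) y > 0"
  proof -
    have "-e \<in> {1, -1}" using e by auto
    from L(3)[OF this] have "side (k + 2 * int g - (-e)) z * r = (1 - apothem\<^sup>2) * (side (k - e) y + 2 * cos_alpha * side (k + 2 * int g) y)"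
      by simp
    then show ?thesis using \<open>side (k + 2 * int g - (-e)) z * r > 0\<close> a1 by (simp only: zero_less_mult_iff) linarith
  qed
  then have 3: "side (k - e) y > 0" using 2 cos_alpha_bounds by (smt (verit) mult_pos_neg)
  have "(k + e) mod N = (k - e) mod N \<or> (\<exists>e'\<in>{1,-1}. (k + e) mod N = (k - e + 2 * int g - e') mod N)"
    by (rule half_planes_disjoint[OF y(1) 3 1])
  then have "N dvd 2 * e \<or> (\<exists>e'\<in>{1,-1}. N dvd 2 * e - 2 * int g + e')"
    by (auto simp: mod_eq_dvd_iff algebra_simps)
  moreover have "\<not> N dvd 2 * e" using e g2 zdvd_imp_le[of N 2] by auto
  \<comment> \<open>Parity: \<open>e'\<close> is odd and all other terms are even.\<close>
  moreover have "\<not> N dvd 2 * e - 2 * int g + e'" if "e' \<in> {1,-1}" for e'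
  proof
    assume "N dvd 2 * e - 2 * int g + e'"
    then have "2 dvd 2 * (e - int g) + e'" by (metis dvd_trans dvd_triv_left mult_2 add_mult_distrib2 numeral_Bit0 right_diff_distrib' mult.assoc dvd_mult2 even_numeral)
    then show False using that by auto
  qed
  ultimately show False by blast
qed

end

section \<open>Rotation about a corner\<close>

fun linv :: "letter \<Rightarrow> letter" where
  "linv (Pos j) = Neg j"
| "linv (Neg j) = Pos j"

lemma linv_linv [simp]: "linv (linv u) = u"
  by (cases u) auto

definition winv :: "letter list \<Rightarrow> letter list" where
  "winv w = rev (map linv w)"

lemma winv_simps [simp]: "winv [] = []" "winv (u # w) = winv w @ [linv u]"
  "winv (v @ w) = winv w @ winv v" "winv (winv w) = w" "length (winv w) = length w"
  by (simp_all add: winv_def rev_map o_def)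

context genus begin

text \<open>The corner between the sides \<open>k\<close> and \<open>k + 2g - e\<close>. The circumradius \<open>R\<close> satisfies
  \<open>cosh R = (cot (alpha / 2))\<^sup>2\<close>, which makes \<open>(tanh (R / 2))\<^sup>2\<close> equal to \<open>cos alpha\<close>.\<close>

definition corner :: "int \<Rightarrow> int \<Rightarrow> complex" where
  "corner e k = of_real (sqrt cos_alpha) * dirn k * cis (- of_int e * alpha / 2)"

text \<open>The rotation that \<open>transl k\<close> becomes when the corners
  \<open>corner e (k + e)\<close> and \<open>corner e k\<close> are both moved to 0, see
  \<open>transl_rotates\<close>.\<close>

definition turn :: "int \<Rightarrow> complex" where
  "turn e = - cis (- 2 * of_int e * alpha)"

lemma turn_power: "e \<in> {1, -1} \<Longrightarrow> turn e ^ (4 * g) = 1"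
proof -
  assume e: "e \<in> {1, -1}"
  have "turn e ^ (4 * g) = cis (- 2 * of_int e * alpha) ^ (4 * g)" by (simp add: turn_def)
  also have "\<dots> = cis (2 * pi * of_int (- 2 * e))"
  proof -
    have "real (4 * g) * (- 2 * of_int e * alpha) = 2 * pi * of_int (- 2 * e)"
      unfolding alpha_bounds(3)[symmetric] by simp
    then show ?thesis unfolding Complex.DeMoivre by (rule arg_cong)
  qed
  also have "\<dots> = 1" by (rule cis_multiple_2pi) simp
  finally show ?thesis .
qed

lemma half_angle: "1 + cos_alpha = 2 * cos (alpha / 2) ^ 2" "1 - cos_alpha = 2 * sin (alpha / 2) ^ 2"
  "sin alpha = 2 * sin (alpha / 2) * cos (alpha / 2)" "cos (alpha / 2) > 0" "sin (alpha / 2) > 0"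
  "apothem * cos (alpha / 2) = sqrt cos_alpha" "apothem * sqrt cos_alpha * cos (alpha / 2) = cos_alpha"
proof -
  show c: "1 + cos_alpha = 2 * cos (alpha / 2) ^ 2" using cos_double_cos[of "alpha / 2"] by (simp add: cos_alpha_def)
  show "1 - cos_alpha = 2 * sin (alpha / 2) ^ 2" using cos_double_sin[of "alpha / 2"] by (simp add: cos_alpha_def)
  show "sin alpha = 2 * sin (alpha / 2) * cos (alpha / 2)" using sin_double[of "alpha / 2"] by simp
  have b: "0 < alpha / 2" "alpha / 2 < pi / 2" using alpha_bounds pi_gt_zero by linarith+
  show p: "cos (alpha / 2) > 0" using b by (intro cos_gt_zero) auto
  show "sin (alpha / 2) > 0" using b by (intro sin_gt_zero) auto
  have "(apothem * cos (alpha / 2))\<^sup>2 = cos_alpha" using apothem_sq unfolding c by (simp add: power_mult_distrib)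
  then show q: "apothem * cos (alpha / 2) = sqrt cos_alpha" using apothem_bounds p
    by (metis real_sqrt_unique mult_nonneg_nonneg less_imp_le)
  have "apothem * sqrt cos_alpha * cos (alpha / 2) = (apothem * cos (alpha / 2)) * sqrt cos_alpha" by simp
  then show "apothem * sqrt cos_alpha * cos (alpha / 2) = cos_alpha" unfolding q using cos_alpha_bounds by simp
qed

lemma corner_norm: "cmod (corner e k) < 1"
  using cos_alpha_bounds by (simp add: corner_def norm_mult)

text \<open>An isometry that takes one corner to the other is a rotation in coordinates centred at
  these corners. The factor does not depend on \<open>k\<close>, so a walk round a corner multiplies
  up to a power of \<open>turn e\<close>.\<close>

lemma transl_rotates:
  assumes z: "cmod z < 1" and e: "e \<in> {1, -1}"
  shows "Moebius_function 0 (corner e k) (transl k z) = turn e * Moebius_function 0 (corner e (k + e)) z"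
proof -
  define T where "T = dirn k"
  have T1: "cmod T = 1" by (simp add: T_def)
  have TT: "T * cnj T = 1" using T1 by (simp add: complex_norm_square[symmetric])
  define p where "p = of_real (sqrt cos_alpha) * cis (- of_int e * alpha / 2)"
  define a where "a = complex_of_real apothem"
  define y where "y = z * cnj T"
  have zy: "z = T * y" using TT by (simp add: y_def mult.left_commute)
  have c1: "corner e k = T * p" by (simp add: corner_def p_def T_def mult_ac)
  have "cis (of_int e * alpha) * cis (- of_int e * alpha / 2) = cis (of_int e * alpha / 2)"
  proof -
    have "of_int e * alpha + - of_int e * alpha / 2 = of_int e * alpha / 2" by simp
    then show ?thesis by (simp only: cis_mult)
  qed
  then have c2: "corner e (k + e) = - T * cnj p"
    unfolding corner_def dirn_nb(2)[OF e] by (simp add: p_def T_def cis_cnj mult_ac)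
  define D where "D = 1 + a * y"
  have D0: "D \<noteq> 0" using disk_transl_denom_nonzero[OF T1 _ _ z, of apothem] apothem_bounds by (simp add: D_def a_def y_def mult_ac)
  have dD: "transl k z * D = T * (y + a)"
  proof -
    have "1 + a * cnj T * z = D" by (simp add: D_def y_def mult_ac)
    moreover have "z + a * T = T * (y + a)" by (simp add: zy distrib_left mult.commute)
    ultimately show ?thesis using D0 by (simp add: transl_def disk_transl_def T_def a_def)
  qed
  \<comment> \<open>This says that the corner \<open>T * p\<close> lies on the wall in direction
    \<open>T\<close>.\<close>
  have ap: "a * (1 + p * cnj p) = p + cnj p"
  proof -
    have "(cmod p)\<^sup>2 = cos_alpha" using cos_alpha_bounds by (simp add: p_def norm_mult)
    then have "p * cnj p = of_real cos_alpha" by (metis complex_norm_square)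
    moreover have "p + cnj p = of_real (2 * sqrt cos_alpha * cos (alpha / 2))"
      using e by (auto simp: complex_eq_iff p_def)
    moreover have "apothem * (1 + cos_alpha) = 2 * sqrt cos_alpha * cos (alpha / 2)"
      unfolding half_angle(1) half_angle(6)[symmetric] by (simp add: power2_eq_square)
    ultimately show ?thesis by (simp add: a_def flip: of_real_mult of_real_add) (metis of_real_1 of_real_add of_real_mult)
  qed
  have n1: "(y + a) - p * D = (1 - a * p) * (y + cnj p)"
    using ap by (simp add: D_def algebra_simps)
  have n2: "D - cnj p * (y + a) = (1 - a * cnj p) * (1 + p * y)"
  proof -
    have "D - cnj p * (y + a) - (1 - a * cnj p) * (1 + p * y) = y * (a * (1 + p * cnj p) - (p + cnj p))"
      by (simp add: D_def algebra_simps)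
    then show ?thesis using ap by simp
  qed
  \<comment> \<open>The constant factors left in \<open>n1\<close> and \<open>n2\<close> are complex
    conjugates, so their quotient is a rotation.\<close>
  have m: "1 - a * p = turn e * (1 - a * cnj p)"
  proof -
    define C S where "C = cos (alpha / 2)" and "S = sin (alpha / 2)"
    have CS: "C > 0" "S > 0" "1 - cos_alpha = 2 * S\<^sup>2" "sin alpha = 2 * S * C" "apothem * sqrt cos_alpha = cos_alpha / C"
      using half_angle by (auto simp: C_def S_def field_simps)
    have *: "1 - a * cnj p = of_real (S / C) * (- \<i> * of_int e) * cis (of_int e * alpha)"
    proof (rule complex_eqI)
      have "Re (a * cnj p) = apothem * sqrt cos_alpha * C" "Im (a * cnj p) = apothem * sqrt cos_alpha * (of_int e * S)"
        using e by (auto simp: a_def p_def C_def S_def)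
      then have "Re (a * cnj p) = cos_alpha" "Im (a * cnj p) = cos_alpha / C * (of_int e * S)"
        unfolding CS(5) using CS(1) by auto
      then show "Re (1 - a * cnj p) = Re (of_real (S / C) * (- \<i> * of_int e) * cis (of_int e * alpha))"
        "Im (1 - a * cnj p) = Im (of_real (S / C) * (- \<i> * of_int e) * cis (of_int e * alpha))"
        using e CS(1-4) by (auto simp: power2_eq_square cos_alpha_def)
    qed
    have "1 - a * p = cnj (1 - a * cnj p)" by (simp add: a_def)
    also have "\<dots> = of_real (S / C) * (\<i> * of_int e) * cis (- of_int e * alpha)"
      unfolding * by (simp add: cis_cnj)
    also have "\<dots> = turn e * (of_real (S / C) * (- \<i> * of_int e) * cis (of_int e * alpha))"
    proof -
      have "cis (- of_int e * alpha) = cis (- 2 * of_int e * alpha) * cis (of_int e * alpha)"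
        unfolding cis_mult by (rule arg_cong[where f = cis]) simp
      then show ?thesis unfolding turn_def by (simp only:) simp
    qed
    finally show ?thesis unfolding * .
  qed
  have pn: "cmod p < 1" using cos_alpha_bounds by (simp add: p_def norm_mult)
  have nz: "1 - a * cnj p \<noteq> 0"
  proof
    assume "1 - a * cnj p = 0"
    then have "cmod (a * cnj p) = 1" by (metis eq_iff_diff_eq_0 norm_one)
    moreover have "cmod (a * cnj p) \<le> cmod p" using apothem_bounds mult_right_mono[of apothem 1 "cmod p"]
      by (simp add: a_def norm_mult)
    ultimately show False using pn by simp
  qed
  have "Moebius_function 0 (corner e k) (transl k z) = (transl k z - T * p) / (1 - cnj T * cnj p * transl k z)"
    by (simp add: Moebius_function_simple c1)
  also have "\<dots> = ((transl k z - T * p) * D) / ((1 - cnj T * cnj p * transl k z) * D)" using D0 by simp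
  also have "(transl k z - T * p) * D = T * ((y + a) - p * D)" by (simp add: left_diff_distrib dD right_diff_distrib)
  also have "(1 - cnj T * cnj p * transl k z) * D = D - cnj p * (y + a)"
  proof -
    have "(1 - cnj T * cnj p * transl k z) * D = D - cnj T * cnj p * (transl k z * D)" by (simp add: left_diff_distrib)
    also have "\<dots> = D - (T * cnj T) * (cnj p * (y + a))" unfolding dD by (simp add: mult_ac)
    finally show ?thesis by (simp add: TT)
  qed
  also have "T * ((y + a) - p * D) / (D - cnj p * (y + a)) = turn e * (T * (y + cnj p) / (1 + p * y))"
    unfolding n1 n2 m using nz by simp
  also have "T * (y + cnj p) / (1 + p * y) = Moebius_function 0 (corner e (k + e)) z"
  proof -
    have "1 - cnj (corner e (k + e)) * z = 1 + p * (T * cnj T) * y" unfolding c2 zy by (simp add: mult_ac)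
    moreover have "z - corner e (k + e) = T * (y + cnj p)" unfolding c2 zy by (simp add: distrib_left)
    ultimately show ?thesis by (simp add: Moebius_function_simple TT)
  qed
  finally show ?thesis .
qed

section \<open>Runs of letters round a corner and the defining relation\<close>

definition irun :: "int \<Rightarrow> int \<Rightarrow> nat \<Rightarrow> int list" where
  "irun e k n = map (\<lambda>i. k + e * int i) [0..<n]"

lemma irun_0 [simp]: "irun e k 0 = []"
  by (simp add: irun_def)

lemma irun_Suc: "irun e k (Suc n) = k # irun e (k + e) n"
  unfolding irun_def upt_conv_Cons[OF zero_less_Suc] map_Suc_upt[symmetric] list.map map_map
  by (simp add: o_def algebra_simps)

lemma foldr_transl_norm: "cmod z < 1 \<Longrightarrow> cmod (foldr transl ks z) < 1"
  by (induction ks) (auto simp: transl_norm)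

lemma foldr_transl_irun:
  assumes z: "cmod z < 1" and e: "e \<in> {1, -1}"
  shows "Moebius_function 0 (corner e k) (foldr transl (irun e k n) z)
     = turn e ^ n * Moebius_function 0 (corner e (k + e * int n)) z"
proof (induction n arbitrary: k)
  case (Suc n)
  show ?case
    using transl_rotates[OF foldr_transl_norm[OF z] e, where k = k] Suc[of "k + e"]
    by (simp add: irun_Suc algebra_simps)
qed simp

text \<open>The corner has period \<open>4g\<close> in its number, and
  \<open>turn e ^ (4 * g) = 1\<close>. This is the defining relation as an identity of maps; the
  rewriting of leading words rests on it.\<close>

lemma foldr_transl_full_run:
  assumes z: "cmod z < 1" and e: "e \<in> {1, -1}"
  shows "foldr transl (irun e k (4 * g)) z = z"
proof -
  have "k + e * int (4 * g) = k + N * e" by simp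
  then have "corner e (k + e * int (4 * g)) = corner e k" unfolding corner_def by (simp only: dirn_period)
  then have *: "Moebius_function 0 (corner e k) (foldr transl (irun e k (4 * g)) z) = Moebius_function 0 (corner e k) z"
    using foldr_transl_irun[OF z e, of k "4 * g"] turn_power[OF e] by simp
  have "Moebius_function 0 (- corner e k) (Moebius_function 0 (corner e k) x) = x" if "cmod x < 1" for x
    using Moebius_function_compose[of "- corner e k" "corner e k" x] that corner_norm by simp
  then show ?thesis using * z foldr_transl_norm[OF z] by metis
qed


section \<open>Leading words\<close>

definition letter_of :: "int \<Rightarrow> letter" where
  "letter_of k = (let r = k mod N in if r < 2 * int g then Pos (nat r + 1) else Neg (nat (r - 2 * int g) + 1))"

fun index :: "letter \<Rightarrow> int" where
  "index (Pos j) = int j - 1"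
| "index (Neg j) = 2 * int g + int j - 1"

lemma mod_bounds: "0 \<le> k mod N" "k mod N < N"
  using g2 by auto

lemma index_letter_of: "index (letter_of k) = k mod N"
  using mod_bounds[of k] by (auto simp: letter_of_def Let_def)

lemma letter_of_eq_iff: "letter_of k = letter_of m \<longleftrightarrow> k mod N = m mod N"
  by (metis letter_of_def index_letter_of)

lemma letter_of_Pos: "1 \<le> j \<Longrightarrow> j \<le> 2 * g \<Longrightarrow> letter_of (int j - 1) = Pos j"
  by (auto simp: letter_of_def Let_def)

lemma letter_of_Neg: "1 \<le> j \<Longrightarrow> j \<le> 2 * g \<Longrightarrow> letter_of (2 * int g + int j - 1) = Neg j"
  by (auto simp: letter_of_def Let_def)

lemma letter_of_index: "u \<in> letters g \<Longrightarrow> letter_of (index u) = u"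
  by (auto simp: letters_def letter_of_Pos letter_of_Neg)

lemma letter_of_letters: "letter_of k \<in> letters g"
  using mod_bounds[of k] by (auto simp: letter_of_def Let_def letters_def image_iff)

lemma mod_opp: "(k + 2 * int g) mod N = (if k mod N < 2 * int g then k mod N + 2 * int g else k mod N - 2 * int g)"
proof -
  have "(k + 2 * int g) mod N = (k mod N + 2 * int g) mod N" by (simp add: mod_add_left_eq)
  moreover have "(k mod N + 2 * int g) mod N = k mod N - 2 * int g" if "\<not> k mod N < 2 * int g"
  proof -
    have "k mod N + 2 * int g = (k mod N - 2 * int g) + N" by simp
    then have "(k mod N + 2 * int g) mod N = (k mod N - 2 * int g) mod N" by (metis mod_add_self2)
    also have "\<dots> = k mod N - 2 * int g" using that mod_bounds[of k] by (intro mod_pos_pos_trivial) auto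
    finally show ?thesis .
  qed
  ultimately show ?thesis using mod_bounds[of k] by (auto intro: mod_pos_pos_trivial)
qed

lemma linv_letter_of: "linv (letter_of k) = letter_of (k + 2 * int g)"
  unfolding letter_of_def[of "k + 2 * int g"] mod_opp Let_def
  using mod_bounds[of k] by (auto simp: letter_of_def Let_def)

definition run :: "int \<Rightarrow> int \<Rightarrow> nat \<Rightarrow> letter list" where
  "run e k n = map letter_of (irun e k n)"

lemma length_run [simp]: "length (run e k n) = n"
  by (simp add: run_def irun_def)

lemma nth_run: "i < n \<Longrightarrow> run e k n ! i = letter_of (k + e * int i)"
  by (simp add: run_def irun_def)

lemma mod_add_cong: "(k::int) mod m = l mod m \<Longrightarrow> (k + i) mod m = (l + i) mod m"
  by (metis mod_add_left_eq)

lemma run_cong: "k mod N = m mod N \<Longrightarrow> run e k n = run e m n"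
  by (rule nth_equalityI) (auto simp: nth_run letter_of_eq_iff intro: mod_add_cong)

lemma run_append: "run e k m @ run e (k + e * int m) n = run e k (m + n)"
  by (rule nth_equalityI) (auto simp: nth_append nth_run algebra_simps of_nat_diff)

lemma run_append': "(k + e * int m) mod N = l mod N \<Longrightarrow> run e k m @ run e l n = run e k (m + n)"
  using run_append run_cong by metis

lemma run_1: "run e k 1 = [letter_of k]"
  by (simp add: run_def irun_def)

lemma run_Suc: "run e k (Suc n) = letter_of k # run e (k + e) n"
  by (simp add: run_def irun_Suc)

lemma runs_eq:
  assumes "1 \<le> a" "b \<le> 2 * g"
  shows "up a b = run 1 (int a - 1) (Suc b - a)"
    and "up_inv a b = run 1 (2 * int g + int a - 1) (Suc b - a)"
    and "down b a = run (-1) (int b - 1) (Suc b - a)"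
    and "down_inv b a = run (-1) (2 * int g + int b - 1) (Suc b - a)"
proof -
  have P: "Pos (a + i) = letter_of (int a - 1 + int i)" "Neg (a + i) = letter_of (2 * int g + int a - 1 + int i)" if "i < Suc b - a" for i
    using letter_of_Pos[of "a + i"] letter_of_Neg[of "a + i"] that assms by (auto simp: algebra_simps)
  have Q: "Pos (b - i) = letter_of (int b - 1 - int i)" "Neg (b - i) = letter_of (2 * int g + int b - 1 - int i)" if "i < Suc b - a" for i
    using letter_of_Pos[of "b - i"] letter_of_Neg[of "b - i"] that assms by (auto simp: algebra_simps of_nat_diff)
  show "up a b = run 1 (int a - 1) (Suc b - a)" "up_inv a b = run 1 (2 * int g + int a - 1) (Suc b - a)"
    unfolding up_def up_inv_def by (rule nth_equalityI; simp add: nth_run P del: upt_Suc)+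
  show "down b a = run (-1) (int b - 1) (Suc b - a)" "down_inv b a = run (-1) (2 * int g + int b - 1) (Suc b - a)"
    unfolding down_def down_inv_def
    by (rule nth_equalityI; simp add: nth_run rev_map[symmetric] rev_nth Q[symmetric] del: upt_Suc)+
qed

text \<open>\<open>tail e k s\<close> is the word along which a \<open>D\<close>-reduced word starting with \<open>letter_of k\<close> can get across
  the wall \<open>k + 2g - e\<close> next to \<open>k\<close>.\<close>

definition tail :: "int \<Rightarrow> int \<Rightarrow> nat \<Rightarrow> letter list" where
  "tail e k s = concat (replicate s (run e k (2 * g - 1))) @ [letter_of (k + 2 * int g - e)]"

text \<open>Whether the half of the relator that starts with \<open>letter_of k\<close> and goes in direction \<open>e\<close> is a
  leading word.\<close>

definition bad :: "int \<Rightarrow> int \<Rightarrow> bool" where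
  "bad e k \<longleftrightarrow> 2 * int g \<le> (if e = 1 then (k - 1) mod N else k mod N)"

text \<open>The shape of the first two families of leading words, with an arbitrary letter in place
  of \<open>c_j\<close>. The last letter has the number \<open>k + 2g\<close> and so is inverse to
  the first.\<close>

definition chain :: "int \<Rightarrow> int \<Rightarrow> nat \<Rightarrow> letter list" where
  "chain e k s = letter_of k # tail e (k + e) s"

lemma tail_cong: "k mod N = m mod N \<Longrightarrow> tail e k s = tail e m s"
  using run_cong[of k m] mod_add_cong[of k N m "2 * int g - e"] by (simp add: tail_def letter_of_eq_iff algebra_simps)

lemma chain_cong: "k mod N = m mod N \<Longrightarrow> chain e k s = chain e m s"
  using tail_cong[OF mod_add_cong[of k N m e]] by (simp add: chain_def letter_of_eq_iff)

text \<open>In the cyclic numbering \<open>c_2g\<close> is followed by \<open>c_1^-1\<close> and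
  \<open>c_2g^-1\<close> by \<open>c_1\<close>. Each concatenation of two runs is therefore a single
  run modulo \<open>4g\<close>.\<close>

lemma leading_eqs:
  "2 \<le> j \<Longrightarrow> j \<le> 2*g \<Longrightarrow>
     [Pos j] @ concat (replicate s (down (j-1) 1 @ down_inv (2*g) (j+1))) @ [Neg j] = chain (-1) (int j - 1) s"
  "2 \<le> j \<Longrightarrow> j \<le> 2*g \<Longrightarrow>
     [Pos j] @ concat (replicate s (up (j+1) (2*g) @ up_inv 1 (j-1))) @ [Neg j] = chain 1 (int j - 1) s"
  "down_inv (2*g) 1 = run (-1) (N - 1) (2 * g)"
  "up 1 (2*g) = run 1 0 (2 * g)"
  "2 \<le> i \<Longrightarrow> i \<le> 2*g \<Longrightarrow> up_inv i (2*g) @ up 1 (i-1) = run 1 (2 * int g + int i - 1) (2 * g)"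
  "2 \<le> i \<Longrightarrow> i \<le> 2*g \<Longrightarrow> down_inv (i-1) 1 @ down (2*g) i = run (-1) (2 * int g + int i - 2) (2 * g)"
  "1 \<le> i \<Longrightarrow> i \<le> 2*g \<Longrightarrow> [Neg i, Pos i] = [letter_of (2 * int g + int i - 1), letter_of (2 * int g + int i - 1 + 2 * int g)]"
  "1 \<le> i \<Longrightarrow> i \<le> 2*g \<Longrightarrow> [Pos i, Neg i] = [letter_of (int i - 1), letter_of (int i - 1 + 2 * int g)]"
proof -
  assume j: "2 \<le> j" "j \<le> 2*g"
  have d: "Pos j = letter_of (int j - 1)" "Neg j = letter_of (int j - 1 + 2 * int g)"
    using letter_of_Pos[of j] letter_of_Neg[of j] j by (auto simp: algebra_simps)
  have "down (j-1) 1 @ down_inv (2*g) (j+1) = run (-1) (int j - 2) (2 * g - 1)"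
  proof -
    have "down (j-1) 1 = run (-1) (int j - 2) (j - 1)"
      using runs_eq(3)[of 1 "j - 1"] j by (simp add: of_nat_diff)
    moreover have "down_inv (2*g) (j+1) = run (-1) (N - 1) (2 * g - j)"
      using runs_eq(4)[of "j + 1" "2 * g"] j by simp
    moreover have "(int j - 2 + - 1 * int (j - 1)) mod N = (N - 1) mod N"
      using j by (simp add: of_nat_diff mod_eq_dvd_iff)
    moreover have "j - 1 + (2 * g - j) = 2 * g - 1" using j by simp
    ultimately show ?thesis using run_append' by metis
  qed
  then show "[Pos j] @ concat (replicate s (down (j-1) 1 @ down_inv (2*g) (j+1))) @ [Neg j] = chain (-1) (int j - 1) s"
    by (simp add: chain_def tail_def d algebra_simps)
  have "up (j+1) (2*g) @ up_inv 1 (j-1) = run 1 (int j) (2 * g - 1)"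
  proof -
    have "up (j+1) (2*g) = run 1 (int j) (2 * g - j)"
      using runs_eq(1)[of "j + 1" "2 * g"] j by simp
    moreover have "up_inv 1 (j-1) = run 1 (2 * int g) (j - 1)"
      using runs_eq(2)[of 1 "j - 1"] j by simp
    moreover have "(int j + 1 * int (2 * g - j)) mod N = (2 * int g) mod N"
      using j by (simp add: of_nat_diff)
    moreover have "(2 * g - j) + (j - 1) = 2 * g - 1" using j by simp
    ultimately show ?thesis using run_append' by metis
  qed
  then show "[Pos j] @ concat (replicate s (up (j+1) (2*g) @ up_inv 1 (j-1))) @ [Neg j] = chain 1 (int j - 1) s"
    by (simp add: chain_def tail_def d algebra_simps)
next
  show "down_inv (2*g) 1 = run (-1) (N - 1) (2 * g)" using runs_eq(4)[of 1 "2 * g"] g2 by simp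
  show "up 1 (2*g) = run 1 0 (2 * g)" using runs_eq(1)[of 1 "2 * g"] g2 by simp
next
  assume i: "2 \<le> i" "i \<le> 2*g"
  show "up_inv i (2*g) @ up 1 (i-1) = run 1 (2 * int g + int i - 1) (2 * g)"
  proof -
    have "up_inv i (2*g) = run 1 (2 * int g + int i - 1) (Suc (2 * g) - i)"
      using runs_eq(2)[of i "2 * g"] i by simp
    moreover have "up 1 (i-1) = run 1 0 (i - 1)"
      using runs_eq(1)[of 1 "i - 1"] i by simp
    moreover have "(2 * int g + int i - 1 + 1 * int (Suc (2 * g) - i)) mod N = 0 mod N"
      using i by (simp add: of_nat_diff)
    moreover have "Suc (2 * g) - i + (i - 1) = 2 * g" using i by simp
    ultimately show ?thesis using run_append' by metis
  qed
  show "down_inv (i-1) 1 @ down (2*g) i = run (-1) (2 * int g + int i - 2) (2 * g)"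
  proof -
    have "down_inv (i-1) 1 = run (-1) (2 * int g + int i - 2) (i - 1)"
      using runs_eq(4)[of 1 "i - 1"] i by (simp add: of_nat_diff algebra_simps)
    moreover have "down (2*g) i = run (-1) (2 * int g - 1) (Suc (2 * g) - i)"
      using runs_eq(3)[of i "2 * g"] i by simp
    moreover have "(2 * int g + int i - 2 + -1 * int (i - 1)) mod N = (2 * int g - 1) mod N"
      using i by (simp add: of_nat_diff)
    moreover have "(i - 1) + (Suc (2 * g) - i) = 2 * g" using i by simp
    ultimately show ?thesis using run_append' by metis
  qed
next
  assume i: "1 \<le> i" "i \<le> 2*g"
  have d: "Pos i = letter_of (int i - 1)" "Neg i = letter_of (2 * int g + int i - 1)"
    using letter_of_Pos[of i] letter_of_Neg[of i] i by (auto simp: algebra_simps)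
  show "[Neg i, Pos i] = [letter_of (2 * int g + int i - 1), letter_of (2 * int g + int i - 1 + 2 * int g)]"
    "[Pos i, Neg i] = [letter_of (int i - 1), letter_of (int i - 1 + 2 * int g)]"
    unfolding d by (auto simp: letter_of_eq_iff mod_eq_dvd_iff algebra_simps)
qed

lemma D_leading_cases:
  assumes "d \<in> D_leading g"
  obtains (half) e k where "e \<in> {1, -1}" "bad e k" "d = run e k (2 * g)"
  | (pair) k where "d = [letter_of k, letter_of (k + 2 * int g)]"
  | (chain) e k s where "e \<in> {1, -1}" "1 \<le> k" "k < 2 * int g" "1 \<le> s" "d = chain e k s"
  using assms
proof cases
  case (1 j s) then show ?thesis using chain[of "-1" "int j - 1" s] leading_eqs(1)[of j s] by auto
next
  case (2 j s) then show ?thesis using chain[of "1" "int j - 1" s] leading_eqs(2)[of j s] by auto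
next
  case 3 then show ?thesis using half[of "-1" "N - 1"] leading_eqs(3) g2 by (auto simp: bad_def zmod_minus1)
next
  case 4 then show ?thesis using half[of 1 0] leading_eqs(4) g2 by (auto simp: bad_def zmod_minus1)
next
  case (5 i) then show ?thesis using half[of 1 "2 * int g + int i - 1"] leading_eqs(5)[of i] g2 by (auto simp: bad_def)
next
  case (6 i) then show ?thesis using half[of "-1" "2 * int g + int i - 2"] leading_eqs(6)[of i] g2 by (auto simp: bad_def)
next
  case (7 i) then show ?thesis using pair[of "2 * int g + int i - 1"] leading_eqs(7)[of i] by simp
next
  case (8 i) then show ?thesis using pair leading_eqs(8)[of i] by auto
qed

lemma half_run_leading:
  assumes "e \<in> {1, -1}" "bad e k"
  shows "run e k (2 * g) \<in> D_leading g"
proof (cases "e = 1")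
  case True
  define m where "m = (k - 1) mod N + 1"
  have m: "2 * int g + 1 \<le> m" "m \<le> N" using assms mod_bounds[of "k - 1"] by (auto simp: True bad_def m_def)
  have km: "k mod N = m mod N" unfolding m_def by (metis diff_add_cancel mod_add_left_eq)
  show ?thesis
  proof (cases "m = N")
    case True
    then show ?thesis using D_leading.intros(4)[of g] leading_eqs(4) run_cong[of k 0 1 "2 * g"] km \<open>e = 1\<close> by simp
  next
    case False
    define i where "i = nat (m - 2 * int g + 1)"
    have i: "2 \<le> i" "i \<le> 2 * g" "2 * int g + int i - 1 = m" using m False by (auto simp: i_def)
    show ?thesis using D_leading.intros(5)[OF i(1,2)] leading_eqs(5)[OF i(1,2)] run_cong[OF km] i(3) \<open>e = 1\<close> by simp
  qed
next
  case False
  then have e: "e = -1" using assms by simp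
  define m where "m = k mod N"
  have m: "2 * int g \<le> m" "m < N" using assms mod_bounds[of k] by (auto simp: False bad_def m_def)
  have km: "k mod N = m mod N" by (simp add: m_def)
  show ?thesis
  proof (cases "m = N - 1")
    case True
    then show ?thesis using D_leading.intros(3)[of g] leading_eqs(3) run_cong[OF km] e by simp
  next
    case False
    define i where "i = nat (m - 2 * int g + 2)"
    have i: "2 \<le> i" "i \<le> 2 * g" "2 * int g + int i - 2 = m" using m False by (auto simp: i_def)
    show ?thesis using D_leading.intros(6)[OF i(1,2)] leading_eqs(6)[OF i(1,2)] run_cong[OF km] i(3) e by simp
  qed
qed

lemma pair_leading: "[letter_of k, letter_of (k + 2 * int g)] \<in> D_leading g"
proof (cases "letter_of k")
  case (Pos i)
  then have "1 \<le> i" "i \<le> 2 * g" "letter_of (k + 2 * int g) = Neg i" using letter_of_letters[of k] linv_letter_of[of k] by (auto simp: letters_def)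
  then show ?thesis using D_leading.intros(8) Pos by simp
next
  case (Neg i)
  then have "1 \<le> i" "i \<le> 2 * g" "letter_of (k + 2 * int g) = Pos i" using letter_of_letters[of k] linv_letter_of[of k] by (auto simp: letters_def)
  then show ?thesis using D_leading.intros(7) Neg by simp
qed

lemma chain_leading:
  assumes "e \<in> {1, -1}" "1 \<le> k mod N" "k mod N < 2 * int g" "1 \<le> s"
  shows "chain e k s \<in> D_leading g"
proof -
  define j where "j = nat (k mod N + 1)"
  have j: "2 \<le> j" "j \<le> 2 * g" "int j - 1 = k mod N" using assms by (auto simp: j_def)
  have "chain e k s = chain e (int j - 1) s" by (rule chain_cong) (simp add: j(3))
  then show ?thesis
    using D_leading.intros(1,2)[OF j(1,2) assms(4)] leading_eqs(1,2)[OF j(1,2), of s] assms(1) by auto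
qed

lemma D_reducible_sublist: "D_reducible g v \<Longrightarrow> sublist v w \<Longrightarrow> D_reducible g w"
  unfolding D_reducible_def using sublist_order.order_trans by blast

lemma D_reducible_leading: "d \<in> D_leading g \<Longrightarrow> D_reducible g d"
  unfolding D_reducible_def by blast

text \<open>Only the chains of \<open>c_2, ..., c_2g\<close> are leading words. For
  \<open>c_1\<close> and the inverse letters, the first or the last \<open>2g\<close> letters of the
  chain form a leading half of the relator.\<close>

lemma chain_reducible:
  assumes e: "e \<in> {1, -1}" and s: "1 \<le> s"
  shows "D_reducible g (chain e k s)"
proof -
  obtain s' where s': "s = Suc s'" using s by (cases s) auto
  define xs where "xs = run e (k + e) (2 * g - 1)"
  have g1: "Suc (2 * g - 1) = 2 * g" using g2 by simp
  have c1: "chain e k s = (letter_of k # xs) @ concat (replicate s' xs) @ [letter_of (k + 2 * int g)]"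
    by (simp add: chain_def tail_def s' xs_def)
  have c2: "chain e k s = (letter_of k # concat (replicate s' xs)) @ (xs @ [letter_of (k + 2 * int g)])"
    using c1 by (simp add: replicate_append_same[symmetric] flip: concat_append concat.simps(2) replicate_Suc)
      (metis append.assoc append_Cons concat.simps(2) concat_append concat.simps(1) append_Nil2 replicate_append_same replicate_Suc)
  have h1: "letter_of k # xs = run e k (2 * g)" unfolding xs_def using run_Suc[of e k "2 * g - 1"] g1 by simp
  have h2: "xs @ [letter_of (k + 2 * int g)] = run e (k + e) (2 * g)"
  proof -
    have "int (2 * g - 1) = 2 * int g - 1" using g2 by (simp add: of_nat_diff)
    then have "(k + e + e * int (2 * g - 1)) mod N = (k + 2 * int g) mod N"
      using e by (auto simp: mod_eq_dvd_iff algebra_simps)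
    from run_append'[OF this, of 1] show ?thesis using g1 unfolding xs_def run_1 by simp
  qed
  \<comment> \<open>The second alternative serves the boundary cases: \<open>k = 2g\<close> modulo
    \<open>4g\<close> for \<open>e = 1\<close>, and \<open>k = 0\<close> for
    \<open>e = -1\<close>.\<close>
  have "bad e k \<or> bad e (k + e) \<or> (1 \<le> k mod N \<and> k mod N < 2 * int g)"
  proof (cases "e = 1")
    case True
    then show ?thesis
    proof (cases "k mod N = 0")
      case True
      then have "(k - 1) mod N = N - 1"
        using zmod_minus1[of N] g2 by (metis mod_diff_left_eq diff_0 mod_bounds(2) le_less_trans mod_bounds(1))
      then show ?thesis using \<open>e = 1\<close> g2 by (simp add: bad_def)
    next
      case False
      then show ?thesis using \<open>e = 1\<close> mod_bounds[of k] by (auto simp: bad_def)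
    qed
  next
    case False
    then have e: "e = -1" using e by simp
    show ?thesis
    proof (cases "k mod N = 0")
      case True
      then have "(k - 1) mod N = N - 1"
        using zmod_minus1[of N] g2 by (metis mod_diff_left_eq diff_0 mod_bounds(2) le_less_trans mod_bounds(1))
      then show ?thesis using e g2 by (simp add: bad_def)
    next
      case False
      then show ?thesis using e mod_bounds[of k] by (auto simp: bad_def)
    qed
  qed
  then show ?thesis
  proof (elim disjE conjE)
    assume "bad e k"
    then have "D_reducible g (letter_of k # xs)" unfolding h1 using half_run_leading[OF e] D_reducible_leading by blast
    then show ?thesis unfolding c1 by (rule D_reducible_sublist) (rule sublist_append_rightI)
  next
    assume "bad e (k + e)"
    then have "D_reducible g (xs @ [letter_of (k + 2 * int g)])" unfolding h2 using half_run_leading[OF e] D_reducible_leading by blast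
    then show ?thesis unfolding c2 by (rule D_reducible_sublist) (rule sublist_append_leftI)
  qed (use chain_leading[OF e _ _ s] D_reducible_leading in blast)
qed


section \<open>Ping-pong\<close>

text \<open>The interior of the polygon \<open>P\<close>.\<close>

definition cell :: "complex \<Rightarrow> bool" where
  "cell z \<longleftrightarrow> cmod z < 1 \<and> (\<forall>m. side m z < 0)"

lemma mod_shift: "(a::int) mod n = b mod n \<Longrightarrow> c - d = a - b \<Longrightarrow> c mod n = d mod n"
  by (simp only: mod_eq_dvd_iff)

lemma neighbour_sym:
  assumes "m mod N = (k + 2 * int g - e) mod N"
  shows "k mod N = (m + 2 * int g + e) mod N"
proof -
  have "N dvd m - (k + 2 * int g - e)" using assms by (simp add: mod_eq_dvd_iff)
  then have "N dvd (m - (k + 2 * int g - e)) + N" using dvd_add dvd_refl by blast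
  then have "N dvd - ((m - (k + 2 * int g - e)) + N)" by (simp only: dvd_minus_iff)
  moreover have "- ((m - (k + 2 * int g - e)) + N) = k - (m + 2 * int g + e)" by simp
  ultimately show ?thesis by (simp only: mod_eq_dvd_iff)
qed

lemma tail_Suc: "tail e k (Suc s) = run e k (2 * g - 1) @ tail e k s"
  by (simp add: tail_def)

lemma run_snoc: "run e k (Suc n) = run e k n @ [letter_of (k + e * int n)]"
  using run_append[of e k n 1] unfolding run_1 by simp

text \<open>If the image of a cell under a \<open>D\<close>-reduced word starting with \<open>letter_of k\<close> lies beyond
  a second wall \<open>k + 2g - e\<close>, it lies in the sector opposite to the cell at their common corner, so
  the word runs around this corner, except that it may take the detour recorded in \<open>tail\<close> just
  before the last step.\<close>

lemma ping_pong:
  assumes z: "cell z"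
  shows "ks = k # ks' \<Longrightarrow> \<not> D_reducible g (map letter_of ks) \<Longrightarrow>
    side k (foldr transl ks z) > 0 \<and>
    (\<forall>e\<in>{1, -1}. side (k + 2 * int g - e) (foldr transl ks z) \<ge> 0 \<longrightarrow> (\<exists>s\<ge>1. prefix (tail e k s) (map letter_of ks)))"
proof (induction "length ks" arbitrary: ks k ks' rule: less_induct)
  case less
  note ks = less.prems(1) and red = less.prems(2)
  have z1: "cmod z < 1" and zP: "\<And>m. side m z < 0" using z by (auto simp: cell_def)
  \<comment> \<open>The hypothesis is needed for all proper suffixes, as the walk round a corner
    strips many letters. It is phrased with letters because the walk determines numbers only modulo
    \<open>4g\<close>.\<close>
  have IH: "side k1 (foldr transl (k1 # l) z) > 0"
      "\<And>e. e \<in> {1,-1} \<Longrightarrow> side (k1 + 2 * int g - e) (foldr transl (k1 # l) z) \<ge> 0 \<Longrightarrow> \<exists>s\<ge>1. prefix (tail e k1 s) (map letter_of (k1 # l))"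
    if "map letter_of ks = v @ map letter_of (k1 # l)" "v \<noteq> []" for v k1 l
  proof -
    have "length ks = length v + length (k1 # l)" using arg_cong[OF that(1), of length] by simp
    then have 1: "length (k1 # l) < length ks" using that(2) by simp
    have 2: "\<not> D_reducible g (map letter_of (k1 # l))"
      using red D_reducible_sublist sublist_append_leftI unfolding that(1) by blast
    show "side k1 (foldr transl (k1 # l) z) > 0"
      "\<And>e. e \<in> {1,-1} \<Longrightarrow> side (k1 + 2 * int g - e) (foldr transl (k1 # l) z) \<ge> 0 \<Longrightarrow> \<exists>s\<ge>1. prefix (tail e k1 s) (map letter_of (k1 # l))"
      using less.hyps[OF 1 refl 2] by blast+
  qed
  define y where "y = foldr transl ks' z"
  have y1: "cmod y < 1" unfolding y_def by (rule foldr_transl_norm[OF z1])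
  have fy: "foldr transl ks z = transl k y" by (simp add: ks y_def)
  \<comment> \<open>If \<open>y\<close> were on or beyond the wall \<open>k + 2g\<close>, its first
    letter would be the inverse of \<open>k\<close>, giving a leading pair, or adjacent to it. Then
    the tail supplied by the hypothesis, preceded by \<open>letter_of k\<close>, would be a
    chain.\<close>
  have behind: "side (k + 2 * int g) y < 0"
  proof (cases ks')
    case Nil
    then show ?thesis by (simp add: y_def zP)
  next
    case (Cons k2 l)
    have IH2: "side k2 y > 0" "\<And>e. e \<in> {1,-1} \<Longrightarrow> side (k2 + 2 * int g - e) y \<ge> 0 \<Longrightarrow> \<exists>s\<ge>1. prefix (tail e k2 s) (map letter_of ks')"
      using IH[of "[letter_of k]" k2 l] unfolding y_def Cons by (auto simp: ks Cons)
    show ?thesis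
    proof (rule ccontr)
      assume "\<not> ?thesis"
      then have nn: "side (k + 2 * int g) y \<ge> 0" by simp
      from half_planes_disjoint[OF y1 IH2(1) nn]
      consider "(k + 2 * int g) mod N = k2 mod N"
        | e where "e \<in> {1,-1}" "(k + 2 * int g) mod N = (k2 + 2 * int g - e) mod N" by blast
      then show False
      proof cases
        case 1
        then have "letter_of k2 = letter_of (k + 2 * int g)" by (simp add: letter_of_eq_iff)
        then have "map letter_of ks = [letter_of k, letter_of (k + 2 * int g)] @ map letter_of l" by (simp add: ks Cons)
        then show False using red pair_leading[of k] D_reducible_leading D_reducible_sublist sublist_append_rightI by metis
      next
        case 2
        have k2: "k2 mod N = (k + e) mod N"
          by (rule mod_shift[OF 2(2), symmetric]) simp
        have "side (k2 + 2 * int g - e) y \<ge> 0" using nn side_cong[OF 2(2)] by simp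
        then obtain s where s: "s \<ge> 1" "prefix (tail e k2 s) (map letter_of ks')" using IH2(2)[OF 2(1)] by blast
        have "prefix (chain e k s) (map letter_of ks)" using s(2) tail_cong[OF k2] by (simp add: chain_def ks)
        then have "sublist (chain e k s) (map letter_of ks)" by (rule prefix_imp_sublist)
        then show False using red chain_reducible[OF 2(1) s(1)] D_reducible_sublist by blast
      qed
    qed
  qed
  have a1: "1 - apothem\<^sup>2 > 0" using apothem_bounds by (simp add: power_less_one_iff)
  have first: "side k (foldr transl ks z) > 0"
  proof -
    note L = side_transl(1,2)[OF y1, where k = k]
    have "side k (transl k y) * (cmod (1 + of_real apothem * cnj (dirn k) * y))\<^sup>2 > 0"
      unfolding L(2) using behind a1 by (simp add: mult_neg_neg)
    then show ?thesis using L(1) unfolding fy by (simp add: zero_less_mult_iff)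
  qed
  moreover have "\<exists>s\<ge>1. prefix (tail e k s) (map letter_of ks)"
    if e: "e \<in> {1,-1}" and nn: "side (k + 2 * int g - e) (foldr transl ks z) \<ge> 0" for e
  proof -
    \<comment> \<open>In the sectors from 2 to \<open>2g - 1\<close> the point is beyond the wall
      \<open>c\<close> and beyond neither neighbour, which forces the next letter; in sector
      \<open>2g\<close>, at \<open>n = 0\<close>, the letter is \<open>k\<close> itself. The walk
      stops on reaching sector 1, where these estimates fail.\<close>
    have walk: "\<exists>l. map letter_of ks = run e k n @ map letter_of l \<and> (n = 0 \<longrightarrow> l = ks) \<and> sector e (2 * g - n) (k + e * int n) (foldr transl l z)"
      if "n < 2 * g" for n using that
    proof (induction n)
      case 0
      then show ?case using sector_top[OF first nn] by (auto simp: run_def)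
    next
      case (Suc n)
      then obtain l where l: "map letter_of ks = run e k n @ map letter_of l" "n = 0 \<longrightarrow> l = ks"
        "sector e (2 * g - n) (k + e * int n) (foldr transl l z)" by auto
      define c where "c = k + e * int n"
      define x where "x = foldr transl l z"
      have x1: "cmod x < 1" unfolding x_def by (rule foldr_transl_norm[OF z1])
      have sec: "sector e (2 * g - n) c x" "2 \<le> 2 * g - n" "2 * g - n \<le> 2 * g" using l(3) Suc.prems by (auto simp: c_def x_def)
      have pc: "side c x > 0" by (rule sector_pos[OF sec])
      obtain k3 l3 where l3: "l = k3 # l3" using pc zP[of c] by (cases l) (auto simp: x_def)
      have k3c: "k3 mod N = c mod N"
      proof (cases "n = 0")
        case True
        then show ?thesis using l(2) l3 ks by (simp add: c_def)
      next
        case False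
        then have ne: "run e k n \<noteq> []" by (metis length_run list.size(3))
        have pk: "side k3 x > 0" unfolding x_def l3 using IH(1)[OF l(1)[unfolded l3] ne] .
        from half_planes_disjoint[OF x1 pk less_imp_le[OF pc]]
        consider "c mod N = k3 mod N" | e' where "e' \<in> {1,-1}" "c mod N = (k3 + 2 * int g - e') mod N" by blast
        then show ?thesis
        proof cases
          case 2
          have k3: "side k3 = side (c + 2 * int g + e')" using neighbour_sym[OF 2(2)] by (rule side_cong)
          have "e' = e \<or> e' = - e" using 2(1) e by auto
          moreover have False if "e' = e"
            using sector_other_side[OF x1 e sec] pk k3 that by simp
          moreover have False if "e' = - e"
            using sector_neighbour[OF sec(1)] False sec Suc.prems pk k3 that by simp
          ultimately show ?thesis by blast
        qed simp
      qed
      have "sector e (Suc (2 * g - Suc n)) c (transl c (foldr transl l3 z))"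
        using sec(1) Suc.prems transl_cong[OF k3c] by (simp add: x_def l3 Suc_diff_Suc)
      then have "sector e (2 * g - Suc n) (c + e) (foldr transl l3 z)"
        using sector_transl[OF foldr_transl_norm[OF z1] e] by blast
      moreover have "map letter_of ks = run e k (Suc n) @ map letter_of l3"
        using l(1) k3c by (simp add: run_snoc l3 c_def letter_of_eq_iff)
      ultimately show ?case by (intro exI[of _ l3]) (simp add: c_def algebra_simps)
    qed
    have g1: "2 * g - 1 < 2 * g" "2 * g - (2 * g - 1) = 1" "2 * g - 1 \<noteq> 0" using g2 by auto
    define c where "c = k + 2 * int g - e"
    have cN: "(k + e * int (2 * g - 1)) mod N = c mod N"
      using e g2 by (auto simp: c_def of_nat_diff mod_eq_dvd_iff algebra_simps)
    obtain l where l: "map letter_of ks = run e k (2 * g - 1) @ map letter_of l"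
      "sector e 1 (k + e * int (2 * g - 1)) (foldr transl l z)" using walk[OF g1(1)] g1(2) by auto
    define x where "x = foldr transl l z"
    have x1: "cmod x < 1" unfolding x_def by (rule foldr_transl_norm[OF z1])
    have sec: "sector e 1 c x"
    proof -
      have "side (k + e * int (2 * g - 1)) = side c" "side (k + e * int (2 * g - 1) + 2 * int g - e) = side (c + 2 * int g - e)"
        using side_cong[OF cN] side_cong[OF mod_add_cong[OF cN, of "2 * int g - e"]] by (simp_all add: algebra_simps)
      then show ?thesis using l(2) by (simp add: sector_def corner_fun_def x_def)
    qed
    have pc: "side c x \<ge> 0" by (rule sector_one[OF sec])
    obtain k3 l3 where l3: "l = k3 # l3" using pc zP[of c] by (cases l) (auto simp: x_def)
    have ne: "run e k (2 * g - 1) \<noteq> []" using g1(3) by (metis length_run list.size(3))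
    note IH3 = IH[OF l(1)[unfolded l3] ne, folded l3, folded x_def]
    from half_planes_disjoint[OF x1 IH3(1) pc]
    consider "c mod N = k3 mod N" | e' where "e' \<in> {1,-1}" "c mod N = (k3 + 2 * int g - e') mod N" by blast
    then show ?thesis
    proof cases
      case 1
      then have "letter_of k3 = letter_of (k + 2 * int g - e)" by (simp add: letter_of_eq_iff c_def)
      then have "map letter_of ks = tail e k 1 @ map letter_of l3" using l(1) by (simp add: tail_def l3)
      then show ?thesis by (intro exI[of _ 1]) simp
    next
      \<comment> \<open>The next letter is \<open>k\<close> again, and the point is on or beyond
        \<open>c\<close> as well. The suffix is thus in the situation of the whole word, and the
        completed run adds one round to its tail.\<close>
      case 2
      have k3: "k3 mod N = (c + 2 * int g + e') mod N" using neighbour_sym[OF 2(2)] .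
      have "e' = e \<or> e' = - e" using 2(1) e by auto
      moreover have "e' \<noteq> - e"
        using sector_neighbour[OF sec] g2 IH3(1) side_cong[OF k3] by auto
      ultimately have e': "e' = e" by blast
      have "c + 2 * int g + e = k + N" by (simp add: c_def)
      then have k3k: "k3 mod N = k mod N" using k3 unfolding e' by (simp only: mod_add_self2)
      have "side (k3 + 2 * int g - e) x \<ge> 0" using pc side_cong[OF 2(2)] e' by simp
      then obtain s where s: "s \<ge> 1" "prefix (tail e k3 s) (map letter_of l)" using IH3(2)[OF e] by auto
      have "prefix (tail e k (Suc s)) (map letter_of ks)"
        using s(2) tail_cong[OF k3k] by (simp add: l(1) tail_Suc)
      then show ?thesis by (intro exI[of _ "Suc s"]) simp
    qed
  qed
  ultimately show ?case by blast
qed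


section \<open>Normal forms\<close>

definition act :: "letter list \<Rightarrow> complex \<Rightarrow> complex" where
  "act w z = foldr (\<lambda>u. transl (index u)) w z"

definition same_elt :: "letter list \<Rightarrow> letter list \<Rightarrow> bool" where
  "same_elt v w \<longleftrightarrow> (\<forall>z. cmod z < 1 \<longrightarrow> act v z = act w z)"

lemma act_simps [simp]: "act [] z = z" "act (u # w) z = transl (index u) (act w z)" "act (v @ w) z = act v (act w z)"
  by (simp_all add: act_def)

lemma act_map_letter_of: "act (map letter_of ks) z = foldr transl ks z"
  by (induction ks) (auto simp: index_letter_of intro: fun_cong[OF transl_cong])

lemma act_norm: "cmod z < 1 \<Longrightarrow> cmod (act w z) < 1"
  by (induction w) (auto simp: transl_norm)

lemma transl_linv: "cmod z < 1 \<Longrightarrow> transl (index (linv u)) (transl (index u) z) = z"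
proof (cases u)
  case (Pos j)
  assume z: "cmod z < 1"
  have "index (linv u) = index u + 2 * int g" by (simp add: Pos)
  then show ?thesis using transl_inverse(1)[OF z] by (simp only:)
next
  case (Neg j)
  assume z: "cmod z < 1"
  have "index u = index (linv u) + 2 * int g" by (simp add: Neg)
  then show ?thesis using transl_inverse(2)[OF z] by metis
qed

lemma act_winv: "cmod z < 1 \<Longrightarrow> act (winv w) (act w z) = z"
  by (induction w arbitrary: z) (auto simp: transl_linv act_norm)

lemma act_winv': "cmod z < 1 \<Longrightarrow> act w (act (winv w) z) = z"
  using act_winv[of z "winv w"] by simp

lemma winv_letters: "w \<in> lists (letters g) \<Longrightarrow> winv w \<in> lists (letters g)"
  by (induction w) (auto simp: letters_def)

lemma weqD: "same_elt v w \<Longrightarrow> cmod z < 1 \<Longrightarrow> act v z = act w z"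
  by (simp add: same_elt_def)

lemma same_elt_refl [simp]: "same_elt w w"
  by (simp add: same_elt_def)

lemma same_elt_sym: "same_elt v w \<Longrightarrow> same_elt w v"
  by (simp add: same_elt_def)

lemma same_elt_trans [trans]: "same_elt u v \<Longrightarrow> same_elt v w \<Longrightarrow> same_elt u w"
  by (simp add: same_elt_def)

lemma same_elt_append: "same_elt v v' \<Longrightarrow> same_elt w w' \<Longrightarrow> same_elt (v @ w) (v' @ w')"
  by (simp add: same_elt_def act_norm)

lemma same_elt_cancel_iff: "same_elt (winv v @ w) [] \<longleftrightarrow> same_elt v w"
proof
  assume *: "same_elt (winv v @ w) []"
  show "same_elt v w" unfolding same_elt_def
  proof (intro allI impI)
    fix z :: complex assume z: "cmod z < 1"
    have "act (winv v) (act w z) = z" using weqD[OF * z] by simp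
    then show "act v z = act w z" using act_winv'[OF act_norm[OF z], of v w] by simp
  qed
next
  assume *: "same_elt v w"
  then show "same_elt (winv v @ w) []" unfolding same_elt_def
    using act_winv[of _ v] by (simp add: weqD[OF *, symmetric])
qed

lemma act_inj:
  assumes "same_elt v w" "cmod y < 1" "cmod z < 1" "act v y = act w z"
  shows "y = z"
proof -
  have "act v y = act v z" using assms(4) weqD[OF assms(1,3)] by simp
  then have "act (winv v) (act v y) = act (winv v) (act v z)" by simp
  then show ?thesis using assms(2,3) by (simp add: act_winv)
qed

lemma winv_run:
  "winv (run e k n) = run (- e) (k + e * (int n - 1) + 2 * int g) n"
  by (rule nth_equalityI)
     (auto simp: winv_def rev_nth nth_run linv_letter_of of_nat_diff algebra_simps)

text \<open>A full turn is the product of two half runs and acts trivially. The inverse of the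
  second half is the run in the other direction.\<close>

lemma half_runs_same_elt:
  assumes e: "e \<in> {1, -1}"
  shows "same_elt (run e k (2 * g)) (run (- e) (k + 2 * int g - e) (2 * g))"
  unfolding same_elt_def
proof (intro allI impI)
  fix z :: complex assume z: "cmod z < 1"
  define v where "v = run e (k + 2 * int g) (2 * g)"
  have "(k + e * int (2 * g)) mod N = (k + 2 * int g) mod N"
    using e by (auto simp: mod_eq_dvd_iff)
  then have "run e k (2 * g) @ v = run e k (4 * g)"
    using run_append'[of k e "2 * g" "k + 2 * int g" "2 * g"] by (simp add: v_def)
  then have full: "act (run e k (2 * g)) (act v x) = x" if "cmod x < 1" for x
    using foldr_transl_full_run[OF that e, of k] unfolding act_map_letter_of[symmetric] run_def[symmetric]
    by (metis act_simps(3))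
  have "winv v = run (- e) (k + 2 * int g - e) (2 * g)"
    unfolding v_def winv_run using e by (intro run_cong) (auto simp: mod_eq_dvd_iff)
  then show "act (run e k (2 * g)) z = act (run (- e) (k + 2 * int g - e) (2 * g)) z"
    using full[of "act (winv v) z"] act_norm[OF z, of "winv v"] act_winv'[OF z, of v] by simp
qed

lemma same_elt_pair: "same_elt [letter_of k, letter_of (k + 2 * int g)] []"
  unfolding linv_letter_of[symmetric] same_elt_def using transl_linv[of _ "linv (letter_of k)"] by simp

text \<open>By \<open>half_runs_same_elt\<close>, \<open>letter_of k\<close> can be moved past a run
  \<open>v\<close>, which becomes \<open>w\<close>. After \<open>s\<close> moves it stands next to
  its inverse and cancels, which saves two letters.\<close>

lemma same_elt_chain:
  assumes e: "e \<in> {1, -1}"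
  shows "same_elt (chain e k s) (concat (replicate s (run (- e) (k + 2 * int g - e) (2 * g - 1))))"
proof -
  define v where "v = run e (k + e) (2 * g - 1)"
  define w where "w = run (- e) (k + 2 * int g - e) (2 * g - 1)"
  have g1: "Suc (2 * g - 1) = 2 * g" using g2 by simp
  have 1: "[letter_of k] @ v = run e k (2 * g)"
    using run_Suc[of e k "2 * g - 1"] g1 by (simp add: v_def)
  have "(k + 2 * int g - e + - e * int (2 * g - 1)) mod N = k mod N"
    using e g2 by (auto simp: mod_eq_dvd_iff of_nat_diff algebra_simps)
  then have 2: "run (- e) (k + 2 * int g - e) (2 * g) = w @ [letter_of k]"
    using run_snoc[of "-e" "k + 2 * int g - e" "2 * g - 1"] g1 by (simp add: w_def letter_of_eq_iff)
  have vw: "same_elt ([letter_of k] @ v) (w @ [letter_of k])" using half_runs_same_elt[OF e, of k] unfolding 1 2 .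
  have "same_elt ([letter_of k] @ concat (replicate s v)) (concat (replicate s w) @ [letter_of k])"
  proof (induction s)
    case (Suc s)
    have "same_elt (([letter_of k] @ v) @ concat (replicate s v)) ((w @ [letter_of k]) @ concat (replicate s v))"
      by (intro same_elt_append vw same_elt_refl)
    also have "same_elt ((w @ [letter_of k]) @ concat (replicate s v)) (w @ (concat (replicate s w) @ [letter_of k]))"
      using same_elt_append[OF same_elt_refl[of w] Suc] by simp
    finally show ?case by simp
  qed simp
  then have "same_elt (([letter_of k] @ concat (replicate s v)) @ [letter_of (k + 2 * int g)]) ((concat (replicate s w) @ [letter_of k]) @ [letter_of (k + 2 * int g)])"
    by (rule same_elt_append[OF _ same_elt_refl])
  also have "same_elt ((concat (replicate s w) @ [letter_of k]) @ [letter_of (k + 2 * int g)]) (concat (replicate s w) @ [])"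
    using same_elt_append[OF same_elt_refl same_elt_pair[of k]] by simp
  finally show ?thesis by (simp add: chain_def tail_def v_def w_def)
qed

text \<open>The order \<open>c_2g < ... < c_1 < c_1^-1 < ... < c_2g^-1\<close>. For it a
  \<open>bad\<close> half run begins with a greater letter than the equal half run in the other
  direction.\<close>

fun rank :: "letter \<Rightarrow> nat" where
  "rank (Pos j) = 2 * g - j"
| "rank (Neg j) = 2 * g + j"

definition word_order :: "(letter list \<times> letter list) set" where
  "word_order = inv_image (lenlex less_than) (map rank)"

lemma wf_word_order: "wf word_order"
  unfolding word_order_def by (intro wf_inv_image wf_lenlex wf_less_than)

lemma rank_letter_of: "rank (letter_of k) = (if k mod N < 2 * int g then nat (2 * int g - 1 - k mod N) else nat (k mod N + 1))"
  using mod_bounds[of k] by (auto simp: letter_of_def Let_def)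

lemma bad_rank:
  assumes e: "e \<in> {1, -1}" and "bad e k"
  shows "rank (letter_of (k + 2 * int g - e)) < rank (letter_of k)"
proof (cases "e = 1")
  case True
  define m where "m = (k - 1) mod N"
  have m: "2 * int g \<le> m" "m < N" using assms mod_bounds[of "k - 1"] by (auto simp: True bad_def m_def)
  have 1: "(k + 2 * int g - e) mod N = m - 2 * int g"
    using mod_opp[of "k - 1"] m by (simp add: True m_def algebra_simps)
  have "k mod N = (m + 1) mod N" unfolding m_def by (metis diff_add_cancel mod_add_left_eq)
  also have "\<dots> = (if m = N - 1 then 0 else m + 1)" using m by auto
  finally show ?thesis unfolding rank_letter_of 1 using m g2 by auto
next
  case False
  then have e: "e = -1" using e by simp
  define m where "m = k mod N"
  have m: "2 * int g \<le> m" "m < N" using assms mod_bounds[of k] by (auto simp: False bad_def m_def)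
  have "(k + 2 * int g - e) mod N = (k mod N + (2 * int g + 1)) mod N"
  proof -
    have "k + 2 * int g - e = k + (2 * int g + 1)" by (simp add: e)
    then show ?thesis by (simp only: mod_add_left_eq)
  qed
  also have "\<dots> = (m - 2 * int g + 1) mod N" by (rule mod_shift[of N _ 0]) (auto simp: m_def)
  also have "\<dots> = m - 2 * int g + 1" using m by (intro mod_pos_pos_trivial) auto
  finally show ?thesis unfolding rank_letter_of m_def[symmetric] using m g2 by auto
qed

text \<open>Chains and pairs lose two letters. A half run keeps its length but gets a smaller first
  letter.\<close>

lemma leading_rewrite:
  assumes "d \<in> D_leading g"
  shows "\<exists>d'\<in>lists (letters g). same_elt d d' \<and> (map rank d', map rank d) \<in> lenlex less_than"
  using assms
proof (cases rule: D_leading_cases)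
  case (half e k)
  define d' where "d' = run (- e) (k + 2 * int g - e) (2 * g)"
  have "(map rank d', map rank d) \<in> lenlex less_than"
  proof -
    have g1: "2 * g = Suc (2 * g - 1)" using g2 by simp
    have "d' = letter_of (k + 2 * int g - e) # run (- e) (k + 2 * int g - e - e) (2 * g - 1)"
      "d = letter_of k # run e (k + e) (2 * g - 1)"
      unfolding d'_def half(3) by (subst g1, subst run_Suc, simp)+
    then show ?thesis using bad_rank[OF half(1,2)] by (simp add: Cons_lenlex_iff)
  qed
  moreover have "same_elt d d'" unfolding half d'_def by (rule half_runs_same_elt[OF half(1)])
  moreover have "d' \<in> lists (letters g)" by (auto simp: d'_def run_def letter_of_letters)
  ultimately show ?thesis by blast
next
  case (pair k)
  then show ?thesis using same_elt_pair by (intro bexI[of _ "[]"]) auto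
next
  case (chain e k s)
  define d' where "d' = concat (replicate s (run (- e) (k + 2 * int g - e) (2 * g - 1)))"
  have l: "length (concat (replicate s w)) = s * length w" for w :: "letter list" by (induction s) auto
  have "length (map rank d') < length (map rank d)"
    by (simp add: d'_def chain chain_def tail_def l)
  then have "(map rank d', map rank d) \<in> lenlex less_than" unfolding lenlex_conv by blast
  moreover have "d' \<in> lists (letters g)" by (auto simp: d'_def run_def letter_of_letters split: if_splits)
  ultimately show ?thesis using same_elt_chain[OF chain(1)] unfolding chain d'_def by blast
qed

lemma normal_form_exists:
  assumes "w \<in> lists (letters g)"
  shows "\<exists>w'\<in>lists (letters g). same_elt w w' \<and> \<not> D_reducible g w'"
  using assms
proof (induction w rule: wf_induct_rule[OF wf_word_order])
  case (1 w)
  show ?case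
  proof (cases "D_reducible g w")
    case True
    then obtain d x y where d: "d \<in> D_leading g" and w: "w = x @ d @ y" unfolding D_reducible_def sublist_def by blast
    obtain d' where d': "d' \<in> lists (letters g)" "same_elt d d'" "(map rank d', map rank d) \<in> lenlex less_than"
      using leading_rewrite[OF d] by blast
    define w' where "w' = x @ d' @ y"
    have "(map rank w', map rank w) \<in> lenlex less_than"
      unfolding w w'_def map_append
      by (subst lenlex_append2) (auto simp: irrefl_def intro!: lenlex_append1 d'(3))
    then have "(w', w) \<in> word_order" by (simp add: word_order_def)
    moreover have "w' \<in> lists (letters g)" using d'(1) 1(2) by (simp add: w w'_def)
    ultimately obtain w'' where "w'' \<in> lists (letters g)" "same_elt w' w''" "\<not> D_reducible g w''" using 1(1) by blast
    moreover have "same_elt w w'" unfolding w w'_def by (intro same_elt_append same_elt_refl d'(2))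
    ultimately show ?thesis using same_elt_trans by blast
  next
    case False
    then show ?thesis using 1(2) same_elt_refl by blast
  qed
qed

section \<open>Disjoint cells and uniqueness of normal forms\<close>

lemma ping_pong_word:
  assumes "cell z" "u # w \<in> lists (letters g)" "\<not> D_reducible g (u # w)"
  shows "side (index u) (act (u # w) z) > 0"
    and "e \<in> {1, -1} \<Longrightarrow> side (index u + 2 * int g - e) (act (u # w) z) \<ge> 0 \<Longrightarrow> \<exists>s\<ge>1. prefix (tail e (index u) s) (u # w)"
proof -
  have m: "map letter_of (map index (u # w)) = u # w" using assms(2) by (simp add: letter_of_index map_idI in_lists_conv_set)
  have r: "\<not> D_reducible g (map letter_of (map index (u # w)))" unfolding m by (rule assms(3))
  have a: "foldr transl (map index (u # w)) z = act (u # w) z" by (simp only: act_map_letter_of[symmetric] m)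
  have e: "map index (u # w) = index u # map index w" by simp
  note P = ping_pong[OF assms(1) e r, unfolded a m]
  show "side (index u) (act (u # w) z) > 0" using P by (rule conjunct1)
  show "\<exists>s\<ge>1. prefix (tail e (index u) s) (u # w)"
    if "e \<in> {1, -1}" "side (index u + 2 * int g - e) (act (u # w) z) \<ge> 0"
    using P[THEN conjunct2] that by (simp only: Ball_def)
qed

text \<open>A normal form of \<open>winv v @ w\<close> would take a point of the cell into the cell.
  If it were non-empty, ping-pong would put the image beyond a wall.\<close>

lemma cells_disjoint:
  assumes "v \<in> lists (letters g)" "w \<in> lists (letters g)" "cell y" "cell z" "act v y = act w z"
  shows "same_elt v w" "y = z"
proof -
  have yz: "cmod y < 1" "cmod z < 1" using assms by (auto simp: cell_def)
  obtain r where r: "r \<in> lists (letters g)" "same_elt (winv v @ w) r" "\<not> D_reducible g r"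
    using normal_form_exists[of "winv v @ w"] winv_letters assms(1,2) by auto
  have ry: "act r z = y" using weqD[OF r(2) yz(2)] assms(5) act_winv[OF yz(1), of v] by simp
  have "r = []"
  proof (cases r)
    case (Cons u r')
    then have "side (index u) y > 0" using ping_pong_word(1)[OF assms(4), of u r'] r ry by simp
    then show ?thesis using assms(3) by (auto simp: cell_def dest: less_asym)
  qed
  then show "same_elt v w" using r(2) by (simp add: same_elt_cancel_iff)
  then show "y = z" by (rule act_inj[OF _ yz assms(5)])
qed

lemma cell_0: "cell 0"
  using apothem_bounds by (simp add: cell_def side_def wall_def)


text \<open>The half runs with these two starts represent the same element, so this says that they
  cannot both be reduced.\<close>

lemma bad_or_bad:
  assumes "e \<in> {1, -1}"
  shows "bad e k \<or> bad (- e) (k + 2 * int g - e)"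
proof (cases "e = 1")
  case True
  then show ?thesis using mod_opp[of "k - 1"] mod_bounds[of "k - 1"] by (auto simp: bad_def algebra_simps)
next
  case False
  then have "e = -1" using assms by simp
  then show ?thesis using mod_opp[of k] mod_bounds[of k] by (auto simp: bad_def algebra_simps)
qed

lemma half_run_in_tail:
  assumes e: "e \<in> {1, -1}" and s: "s \<ge> 1"
  shows "sublist (run e k (2 * g)) (tail e k s)"
proof -
  obtain s' where s': "s = Suc s'" using s by (cases s) auto
  have g1: "Suc (2 * g - 1) = 2 * g" using g2 by simp
  have "(k + e * int (2 * g - 1)) mod N = (k + 2 * int g - e) mod N"
    using e g2 by (auto simp: of_nat_diff mod_eq_dvd_iff algebra_simps)
  then have "run e k (2 * g) = run e k (2 * g - 1) @ [letter_of (k + 2 * int g - e)]"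
    using run_snoc[of e k "2 * g - 1"] unfolding g1 by (simp add: letter_of_eq_iff)
  moreover have "tail e k s = concat (replicate s' (run e k (2 * g - 1))) @ (run e k (2 * g - 1) @ [letter_of (k + 2 * int g - e)])"
    unfolding tail_def s' replicate_Suc replicate_append_same[symmetric] by simp
  ultimately show ?thesis by (simp only: sublist_append_leftI)
qed

lemma D_reduced_unique:
  "\<lbrakk>v \<in> lists (letters g); w \<in> lists (letters g); \<not> D_reducible g v; \<not> D_reducible g w; same_elt v w\<rbrakk> \<Longrightarrow> v = w"
proof (induction v arbitrary: w)
  case Nil
  show ?case
  proof (cases w)
    case (Cons u w')
    then have "side (index u) 0 > 0" using ping_pong_word(1)[OF cell_0, of u w'] Nil weqD[OF Nil(5), of 0] by simp
    then show ?thesis using cell_0 by (auto simp: cell_def dest: less_asym)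
  qed simp
next
  case (Cons u v)
  have pv: "side (index u) (act (u # v) 0) > 0" using ping_pong_word(1)[OF cell_0] Cons.prems by blast
  show ?case
  proof (cases w)
    case Nil
    then have "side (index u) 0 > 0" using pv weqD[OF Cons.prems(5), of 0] by simp
    then show ?thesis using cell_0 by (auto simp: cell_def dest: less_asym)
  next
    case w: (Cons u' w')
    have pw: "side (index u') (act (u # v) 0) > 0"
      using ping_pong_word(1)[OF cell_0, of u' w'] Cons.prems weqD[OF Cons.prems(5), of 0] unfolding w by simp
    have a1: "cmod (act (u # v) 0) < 1" by (rule act_norm) simp
    have ul: "u \<in> letters g" "u' \<in> letters g" using Cons.prems w by auto
    from half_planes_disjoint[OF a1 pv less_imp_le[OF pw]]
    consider "index u' mod N = index u mod N" | e where "e \<in> {1,-1}" "index u' mod N = (index u + 2 * int g - e) mod N" by blast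
    then show ?thesis
    proof cases
      case 1
      then have uu: "u' = u" using ul by (metis letter_of_eq_iff letter_of_index)
      have "same_elt v w'" unfolding same_elt_def
      proof (intro allI impI)
        fix z :: complex assume z: "cmod z < 1"
        have "transl (index u) (act v z) = transl (index u) (act w' z)" using weqD[OF Cons.prems(5) z] by (simp add: w uu)
        then have "transl (index (linv u)) (transl (index u) (act v z)) = transl (index (linv u)) (transl (index u) (act w' z))" by simp
        then show "act v z = act w' z" using z by (simp add: transl_linv act_norm)
      qed
      moreover have "\<not> D_reducible g v" "\<not> D_reducible g w'"
        using Cons.prems(3,4) D_reducible_sublist[of v "u # v"] D_reducible_sublist[of w' "u' # w'"] unfolding w
        by (auto simp: sublist_Cons_right)
      ultimately show ?thesis using Cons.IH[of w'] Cons.prems w uu by auto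
    next
      \<comment> \<open>The common image of 0 lies beyond two adjacent walls. Ping-pong in direction
        \<open>e\<close> for one word and \<open>- e\<close> for the other shows that they contain
        the two equal half runs, one of which is leading.\<close>
      case 2
      define k where "k = index u"
      obtain s where s: "s \<ge> 1" "prefix (tail e k s) (u # v)"
        using ping_pong_word(2)[OF cell_0 Cons.prems(1,3) 2(1)] pw side_cong[OF 2(2)] by (auto simp: k_def)
      have e': "- e \<in> {1,-1}" using 2(1) by auto
      have eq: "index u mod N = (index u' + 2 * int g - (- e)) mod N" using neighbour_sym[OF 2(2)] by simp
      have aw: "act w 0 = act (u # v) 0" using weqD[OF Cons.prems(5), of 0] by simp
      have "side (index u' + 2 * int g - (- e)) (act w 0) \<ge> 0"
        unfolding aw side_cong[OF eq, symmetric] using pv by (rule less_imp_le)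
      then obtain s' where s': "s' \<ge> 1" "prefix (tail (- e) (index u') s') w"
        using ping_pong_word(2)[OF cell_0 Cons.prems(2,4)[unfolded w] e'] unfolding w by blast
      have t: "tail (- e) (index u') s' = tail (- e) (k + 2 * int g - e) s'" using 2(2) by (intro tail_cong) (simp add: k_def)
      have "sublist (run e k (2 * g)) (u # v)"
        by (rule sublist_order.order_trans[OF half_run_in_tail[OF 2(1) s(1)] prefix_imp_sublist[OF s(2)]])
      then have "\<not> bad e k"
        using half_run_leading[OF 2(1)] D_reducible_leading D_reducible_sublist Cons.prems(3) by blast
      moreover have "sublist (run (- e) (k + 2 * int g - e) (2 * g)) w"
        using sublist_order.order_trans[OF half_run_in_tail[OF e' s'(1)] prefix_imp_sublist[OF s'(2)[unfolded t]]] .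
      then have "\<not> bad (- e) (k + 2 * int g - e)"
        using half_run_leading[OF e'] D_reducible_leading D_reducible_sublist Cons.prems(4) by blast
      ultimately show ?thesis using bad_or_bad[OF 2(1), of k] by blast
    qed
  qed
qed

text \<open>Allows paths to be traversed backwards. Inversion reverses the direction
  \<open>e\<close>: for half runs the condition \<open>bad\<close> stays the same, and a chain keeps
  its letter and its \<open>s\<close>.\<close>

lemma winv_leading:
  assumes "d \<in> D_leading g"
  shows "winv d \<in> D_leading g"
  using assms
proof (cases rule: D_leading_cases)
  case (half e k)
  have "- e \<in> {1,-1}" using half(1) by auto
  moreover have "bad (- e) (k + e * (int (2 * g) - 1) + 2 * int g)"
  proof (cases "e = 1")
    case True
    have "(k + e * (int (2 * g) - 1) + 2 * int g) mod N = (k - 1) mod N" using True by (simp add: mod_eq_dvd_iff)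
    then show ?thesis using half(2) True by (simp add: bad_def)
  next
    case False
    then have "e = -1" using half by auto
    then show ?thesis using half(2) by (simp add: bad_def)
  qed
  ultimately show ?thesis unfolding half winv_run by (rule half_run_leading)
next
  case (pair k)
  have "winv d = [letter_of k, letter_of (k + 2 * int g)]" unfolding pair by (simp add: linv_letter_of[symmetric])
  then show ?thesis using pair_leading by simp
next
  case (chain e k s)
  have cr: "winv (concat (replicate s x)) = concat (replicate s (winv x))" for x
  proof (induction s)
    case (Suc s)
    have "winv (concat (replicate (Suc s) x)) = winv (x @ concat (replicate s x))" by simp
    also have "\<dots> = concat (replicate s (winv x) @ [winv x])" unfolding winv_simps Suc by simp
    finally show ?case unfolding replicate_append_same by simp
  qed simp
  have "winv (run e (k + e) (2 * g - 1)) = run (- e) (k + (- e)) (2 * g - 1)"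
    unfolding winv_run using chain(1) g2 by (intro run_cong) (auto simp: of_nat_diff mod_eq_dvd_iff algebra_simps)
  then have "winv d = chain (- e) k s"
    by (simp add: chain chain_def tail_def cr linv_letter_of letter_of_eq_iff)
  moreover have "- e \<in> {1,-1}" using chain(1) by auto
  ultimately show ?thesis using chain_leading[of "-e" k s] chain by simp
qed

lemma D_reducible_winv: "D_reducible g (winv w) \<longleftrightarrow> D_reducible g w"
proof -
  have "D_reducible g (winv w)" if r: "D_reducible g w" for w
  proof -
    obtain d x y where d: "d \<in> D_leading g" "w = x @ d @ y" using r unfolding D_reducible_def sublist_def by blast
    have "winv w = winv y @ winv d @ winv x" by (simp add: d)
    then show ?thesis using winv_leading[OF d(1)] unfolding D_reducible_def sublist_def by blast
  qed
  then show ?thesis by (metis winv_simps(4))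
qed

text \<open>A run of at most \<open>2g\<close> letters does not return to its start. The runs of a
  chain only visit \<open>k + e, ..., k + (2g - 1) * e\<close>, and its end is opposite to
  \<open>k\<close>.\<close>

lemma leading_hd_not_repeated:
  assumes "d \<in> D_leading g" "0 < i" "i < length d"
  shows "d ! i \<noteq> d ! 0"
  using assms(1)
proof (cases rule: D_leading_cases)
  case (half e k)
  have "\<not> N dvd e * int i"
    using half assms(2,3) zdvd_imp_le[of N "int i"] by auto
  then show ?thesis using assms(2,3) half by (simp add: nth_run letter_of_eq_iff mod_eq_dvd_iff)
next
  case (pair k)
  have "\<not> N dvd 2 * int g" using zdvd_imp_le[of N "2 * int g"] g2 by auto
  moreover have "i = 1" using assms(2,3) pair by simp
  ultimately show ?thesis by (simp add: pair letter_of_eq_iff mod_eq_dvd_iff)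
next
  case (chain e k s)
  have "d ! i \<in> set (tail e (k + e) s)" using assms(2,3) by (cases i) (auto simp: chain chain_def)
  then consider "d ! i = letter_of (k + 2 * int g)" | t where "t < 2 * g - 1" "d ! i = letter_of (k + e + e * int t)"
    by (auto simp: tail_def run_def irun_def split: if_splits)
  then have "d ! i \<noteq> letter_of k"
  proof cases
    case 1
    have "\<not> N dvd 2 * int g" using zdvd_imp_le[of N "2 * int g"] g2 by auto
    then show ?thesis by (simp add: 1 letter_of_eq_iff mod_eq_dvd_iff)
  next
    case 2
    have "\<not> N dvd int t + 1" using 2(1) zdvd_imp_le[of N "int t + 1"] by auto
    moreover have "e * (int t + 1) = int t + 1 \<or> e * (int t + 1) = - (int t + 1)" using chain(1) by auto
    ultimately have "\<not> N dvd e * (int t + 1)" by (auto simp only: dvd_minus_iff)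
    then show ?thesis by (simp add: 2 letter_of_eq_iff mod_eq_dvd_iff algebra_simps)
  qed
  then show ?thesis by (simp add: chain chain_def)
qed

text \<open>A leading word not longer than the period fits into a rotation of \<open>w\<close>. In a
  longer one the first letter would recur after one period.\<close>

lemma periodic_D_reduced:
  assumes "w \<noteq> []" "cyclically_D_reduced g w"
  shows "\<not> D_reducible g (map (\<lambda>r. w ! nat ((i + int r) mod int (length w))) [0..<m])"
proof
  define n where "n = length w"
  have n: "n > 0" using assms(1) by (simp add: n_def)
  define u where "u k = w ! nat (k mod int n)" for k
  assume "D_reducible g (map (\<lambda>r. w ! nat ((i + int r) mod int (length w))) [0..<m])"
  then obtain d x y where d: "d \<in> D_leading g" "map (\<lambda>r. u (i + int r)) [0..<m] = x @ d @ y"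
    unfolding D_reducible_def sublist_def u_def n_def by blast
  define j where "j = i + int (length x)"
  have lm: "m = length x + length d + length y" using arg_cong[OF d(2), of length] by simp
  have dn: "d ! r = u (j + int r)" if "r < length d" for r
  proof -
    have "d ! r = (x @ d @ y) ! (length x + r)" using that by (simp add: nth_append)
    also have "\<dots> = u (i + int (length x + r))" unfolding d(2)[symmetric] using lm that by simp
    finally show ?thesis by (simp add: j_def algebra_simps)
  qed
  show False
  proof (cases "length d \<le> n")
    case True
    define q where "q = nat (j mod int n)"
    have "d = take (length d) (rotate q w)"
    proof (rule nth_equalityI)
      fix r assume r: "r < length d"
      have "nat ((j + int r) mod int n) = (q + r) mod n"
      proof -
        have "int ((q + r) mod n) = (j mod int n + int r) mod int n"
          using n by (simp add: q_def zmod_int)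
        then show ?thesis by (simp add: mod_add_left_eq)
      qed
      then show "d ! r = take (length d) (rotate q w) ! r"
        using r True by (simp add: dn u_def nth_rotate n_def)
    qed (use True in \<open>simp add: n_def\<close>)
    then have "sublist d (rotate q w)" by (metis sublist_take)
    then show False using d(1) assms(2) unfolding cyclically_D_reduced_def D_reducible_def by blast
  next
    case False
    then have "n < length d" "0 < length d" using n by auto
    then have "d ! n = d ! 0" using dn[of n] dn[of 0] by (simp only: u_def) simp
    then show False using leading_hd_not_repeated[OF d(1) n] False by simp
  qed
qed

section \<open>Edges and their midpoints\<close>

abbreviation len :: real where "len \<equiv> transl_length g"

text \<open>Makes the wall \<open>k\<close> the perpendicular bisector of the edge from 0 to
  \<open>transl k 0\<close>.\<close>

lemma tanh_half_len: "tanh (len / 2) = apothem"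
proof -
  define C S q where "C = cos (alpha / 2)" and "S = sin (alpha / 2)" and "q = sqrt cos_alpha"
  have h: "C > 0" "S > 0" "q > 0" "apothem * C = q" using half_angle cos_alpha_bounds by (auto simp: C_def S_def q_def)
  have q2: "q\<^sup>2 = C\<^sup>2 - S\<^sup>2" using half_angle(1,2) cos_alpha_bounds by (simp add: q_def C_def S_def)
  have "len / 2 = ln ((C + q) / S)"
    by (simp add: transl_length_def C_def S_def q_def cos_alpha_def alpha_def)
  then have "tanh (len / 2) = (((C + q) / S)\<^sup>2 - 1) / (((C + q) / S)\<^sup>2 + 1)"
    using h by (simp only: tanh_ln_real divide_pos_pos add_pos_pos)
  also have "\<dots> = ((C + q)\<^sup>2 - S\<^sup>2) / ((C + q)\<^sup>2 + S\<^sup>2)"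
  proof -
    have "(a / b - 1) / (a / b + 1) = (a - b) / (a + b)" if "b > 0" for a b :: real
    proof -
      have "a / b - 1 = (a - b) / b" "a / b + 1 = (a + b) / b" using that by (simp_all add: field_simps)
      then show ?thesis using that by simp
    qed
    then show ?thesis using h by (simp add: power_divide)
  qed
  also have "\<dots> = (2 * q * (q + C)) / (2 * C * (q + C))"
  proof -
    have "(C + q)\<^sup>2 - S\<^sup>2 = 2 * q * (q + C)" "(C + q)\<^sup>2 + S\<^sup>2 = 2 * C * (q + C)"
      using q2 by (simp_all add: algebra_simps power2_eq_square)
    then show ?thesis by (simp only:)
  qed
  also have "\<dots> = q / C" using h by simp
  also have "\<dots> = apothem" using h by (simp add: field_simps)
  finally show ?thesis .
qed

lemma len_pos: "len > 0"
  using tanh_half_len apothem_bounds by (metis tanh_real_pos_iff half_gt_zero_iff)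

text \<open>The constant-speed geodesic from 0 to \<open>transl k 0\<close>, which it reaches at
  \<open>t = 1\<close>.\<close>

definition edge_pt :: "int \<Rightarrow> real \<Rightarrow> complex" where
  "edge_pt k t = of_real (tanh (t * len / 2)) * dirn k"

lemma edge_pt_norm: "cmod (edge_pt k t) < 1"
  using tanh_real_bounds[of "t * len / 2"] by (auto simp: edge_pt_def norm_mult abs_less_iff)

lemma edge_pt_cong: "k mod N = m mod N \<Longrightarrow> edge_pt k = edge_pt m"
  by (simp add: edge_pt_def dirn_cong[of k m] fun_eq_iff)

lemma edge_pt_0: "edge_pt k 0 = 0"
  by (simp add: edge_pt_def)

text \<open>By the addition formula, the Klein radius of \<open>edge_pt k t\<close> is
  \<open>tanh (t * len)\<close>. At \<open>t = 1/2\<close> it equals \<open>apothem\<close>.\<close>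

lemma side_edge_pt: "side m (edge_pt k t) = (1 + (tanh (t * len / 2))\<^sup>2) * (tanh (t * len) * Re (dirn k * cnj (dirn m)) - apothem)"
proof -
  define r where "r = tanh (t * len / 2)"
  have "tanh (t * len / 2 + t * len / 2) = (r + r) / (1 + r * r)"
    unfolding r_def by (rule tanh_add) auto
  moreover have "1 + r * r > 0" by (simp add: add_pos_nonneg)
  ultimately have d: "2 * r = (1 + r\<^sup>2) * tanh (t * len)"
    by (simp add: power2_eq_square)
  have "side m (edge_pt k t) = 2 * r * Re (dirn k * cnj (dirn m)) - apothem * (1 + r\<^sup>2)"
    by (simp add: side_def wall_def edge_pt_def r_def norm_mult algebra_simps)
  then show ?thesis unfolding d r_def[symmetric] by (simp add: algebra_simps)
qed

lemma Re_dirn_le: "Re (dirn k * cnj (dirn m)) \<le> 1"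
  using complex_Re_le_cmod[of "dirn k * cnj (dirn m)"] by (simp add: norm_mult)

lemma cell_edge_pt:
  assumes "0 \<le> t" "t < 1/2"
  shows "cell (edge_pt k t)"
  unfolding cell_def
proof (intro conjI allI edge_pt_norm)
  fix m
  have 1: "tanh (t * len) < apothem" "0 \<le> tanh (t * len)"
    unfolding tanh_half_len[symmetric] using assms len_pos by auto
  have "tanh (t * len) * Re (dirn k * cnj (dirn m)) \<le> tanh (t * len)"
    using mult_left_mono[OF Re_dirn_le 1(2), of k m] by simp
  then have "tanh (t * len) * Re (dirn k * cnj (dirn m)) - apothem < 0" using 1 by simp
  then show "side m (edge_pt k t) < 0" unfolding side_edge_pt by (intro mult_pos_neg) (simp_all add: add_pos_nonneg)
qed

lemma side_midpoint:
  shows "side m (edge_pt k (1/2)) \<le> 0" and "side m (edge_pt k (1/2)) \<ge> 0 \<longleftrightarrow> m mod N = k mod N"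
proof -
  define c where "c = 1 + (tanh (1/2 * len / 2))\<^sup>2"
  have c: "c > 0" by (simp add: c_def add_pos_nonneg)
  obtain p where p: "p > 0" and l: "side m (edge_pt k (1/2)) = p * (Re (dirn k * cnj (dirn m)) - 1)"
  proof
    show "c * apothem > 0" using c apothem_bounds by simp
    show "side m (edge_pt k (1/2)) = c * apothem * (Re (dirn k * cnj (dirn m)) - 1)"
      using side_edge_pt[of m k "1/2"] tanh_half_len by (simp add: c_def algebra_simps)
  qed
  show "side m (edge_pt k (1/2)) \<le> 0" unfolding l using p Re_dirn_le[of k m] by (simp only: mult_le_0_iff) simp
  have iff: "side m (edge_pt k (1/2)) \<ge> 0 \<longleftrightarrow> Re (dirn k * cnj (dirn m)) \<ge> 1" unfolding l using p by (simp only: zero_le_mult_iff) linarith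
  show "side m (edge_pt k (1/2)) \<ge> 0 \<longleftrightarrow> m mod N = k mod N" unfolding iff
  proof
    assume *: "Re (dirn k * cnj (dirn m)) \<ge> 1"
    obtain d where d: "- 2 * int g \<le> d" "d < 2 * int g" "(k - m) mod N = (d * (2 * int g + 1)) mod N"
      "Re (dirn k * cnj (dirn m)) = cos (of_int d * alpha)" by (rule dirn_angle)
    then have "\<bar>of_int d :: real\<bar> < 1" using cos_step[OF d(1,2), of 1] * cos_alpha_bounds alpha_bounds pi_gt_zero by (simp add: cos_alpha_def)
    then have "d = 0" by linarith
    then show "m mod N = k mod N" using d(3) by (metis mod_shift mult_zero_left diff_zero)
  next
    assume "m mod N = k mod N"
    then have "dirn m = dirn k" by (rule dirn_cong)
    then show "Re (dirn k * cnj (dirn m)) \<ge> 1" by (simp add: complex_norm_square[symmetric])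
  qed
qed

lemma transl_edge_pt: "transl k (edge_pt (k + 2 * int g) (1 - t)) = edge_pt k t"
proof -
  define s where "s = tanh ((1 - t) * len / 2)"
  have TT: "cnj (dirn k) * dirn k = 1" using complex_norm_square[of "dirn k"] by (simp add: mult.commute)
  have "tanh (t * len / 2) = tanh (len / 2 + - ((1 - t) * len / 2))" by (rule arg_cong[where f = tanh]) (simp add: field_simps)
  also have "\<dots> = (apothem - s) / (1 - apothem * s)"
    by (subst tanh_add) (auto simp: tanh_half_len s_def)
  finally have r: "tanh (t * len / 2) = (apothem - s) / (1 - apothem * s)" .
  have "transl k (edge_pt (k + 2 * int g) (1 - t)) = (of_real apothem * dirn k - of_real s * dirn k) / (1 - of_real apothem * of_real s * (cnj (dirn k) * dirn k))"
    unfolding transl_def disk_transl_def edge_pt_def dirn_opp s_def[symmetric] by (simp add: mult_ac)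
  also have "\<dots> = of_real ((apothem - s) / (1 - apothem * s)) * dirn k" unfolding TT by (simp add: left_diff_distrib)
  finally show ?thesis by (simp add: edge_pt_def r)
qed

section \<open>Ping-pong at the midpoints, by continuity\<close>

lemma continuous_act: "continuous_on (ball 0 1) (act w)"
proof (induction w)
  case (Cons u w)
  have "continuous_on (ball 0 1) (transl k)" for k
    unfolding transl_def disk_transl_def using disk_transl_denom_nonzero[of "dirn k" apothem] apothem_bounds
    by (intro continuous_intros) auto
  then have "continuous_on (act w ` ball 0 1) (transl (index u))"
    by (rule continuous_on_subset) (auto intro: act_norm)
  then show ?case using continuous_on_compose[OF Cons] by (simp add: o_def)
qed (simp add: act_def)

lemma continuous_act_compose:
  assumes "continuous_on S f" "\<And>t. t \<in> S \<Longrightarrow> cmod (f t) < 1"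
  shows "continuous_on S (\<lambda>t. act w (f t))"
  by (rule continuous_on_compose2[OF continuous_act assms(1)]) (use assms(2) in auto)

lemma continuous_edge_pt: "continuous_on S (edge_pt k)"
  unfolding edge_pt_def by (intro continuous_intros) auto

lemma continuous_side: "continuous_on S (side k)"
  unfolding side_def wall_def by (intro continuous_intros)

lemma ping_pong_midpoint:
  assumes "u # w \<in> lists (letters g)" "\<not> D_reducible g (u # w)"
  shows "side (index u) (act (u # w) (edge_pt m (1/2))) \<ge> 0"
proof (rule continuous_ge_on_closure[where S = "{0..<1/2::real}" and f = "\<lambda>t. side (index u) (act (u # w) (edge_pt m t))"])
  show "continuous_on (closure {0..<1/2}) (\<lambda>t. side (index u) (act (u # w) (edge_pt m t)))"
    by (intro continuous_on_compose2[OF continuous_side[of UNIV]] continuous_act_compose continuous_edge_pt edge_pt_norm) auto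
  show "1/2 \<in> closure {0..<1/2::real}" by simp
  show "0 \<le> side (index u) (act (u # w) (edge_pt m t))" if "t \<in> {0..<1/2}" for t
    using ping_pong_word(1)[OF cell_edge_pt assms] that by (simp add: less_imp_le)
qed

lemma midpoint_not_in_cell:
  assumes "v \<in> lists (letters g)" "w \<in> lists (letters g)" "cell z"
  shows "act v z \<noteq> act w (edge_pt k (1/2))"
proof
  assume eq: "act v z = act w (edge_pt k (1/2))"
  have z: "cmod z < 1" using assms(3) by (simp add: cell_def)
  obtain r where r: "r \<in> lists (letters g)" "same_elt (winv w @ v) r" "\<not> D_reducible g r"
    using normal_form_exists[of "winv w @ v"] winv_letters assms(1,2) by auto
  have rz: "act r z = edge_pt k (1/2)" using weqD[OF r(2) z] eq act_winv[OF edge_pt_norm, of w k "1/2"] by simp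
  show False
  proof (cases r)
    case Nil
    then have "cell (edge_pt k (1/2))" using rz assms(3) by simp
    then show False using side_midpoint(2)[of k k] unfolding cell_def by (metis not_le)
  next
    case (Cons u r')
    then have "side (index u) (edge_pt k (1/2)) > 0" using ping_pong_word(1)[OF assms(3), of u r'] r rz by simp
    then show False using side_midpoint(1)[of "index u" k] by simp
  qed
qed

text \<open>A midpoint belongs to two closed cells. If the normal form of \<open>winv v @ w\<close>
  is non-empty, it must begin with \<open>letter_of k\<close>, the only wall through the midpoint; a
  second letter would have to be the inverse of the first.\<close>

lemma common_midpoint:
  assumes "v \<in> lists (letters g)" "w \<in> lists (letters g)" "act v (edge_pt k (1/2)) = act w (edge_pt m (1/2))"
  shows "(same_elt v w \<and> k mod N = m mod N) \<or> (same_elt (v @ [letter_of k]) w \<and> m mod N = (k + 2 * int g) mod N)"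
proof -
  have edge_pt_inj: "k mod N = m mod N" if "edge_pt k (1/2) = edge_pt m (1/2)" for k m
    using side_midpoint(2) that by metis
  obtain r where r: "r \<in> lists (letters g)" "same_elt (winv v @ w) r" "\<not> D_reducible g r"
    using normal_form_exists[of "winv v @ w"] winv_letters assms(1,2) by auto
  have rm: "act r (edge_pt m (1/2)) = edge_pt k (1/2)" using weqD[OF r(2) edge_pt_norm, of m "1/2"] assms(3) act_winv[OF edge_pt_norm, of v k "1/2"] by simp
  show ?thesis
  proof (cases r)
    case Nil
    have "same_elt v w" using r(2) Nil by (simp add: same_elt_cancel_iff)
    moreover have "m mod N = k mod N" using rm Nil by (intro edge_pt_inj) simp
    ultimately show ?thesis by simp
  next
    case (Cons u r')
    have "side (index u) (edge_pt k (1/2)) \<ge> 0" using ping_pong_midpoint[of u r' m] r rm Cons by simp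
    then have uk: "index u mod N = k mod N" unfolding side_midpoint(2) .
    have ud: "u = letter_of k" using uk r(1) Cons by (metis Cons_in_lists_iff letter_of_eq_iff letter_of_index)
    have r'm: "act r' (edge_pt m (1/2)) = edge_pt (k + 2 * int g) (1/2)"
    proof -
      have "transl (k + 2 * int g) (transl k (act r' (edge_pt m (1/2)))) = transl (k + 2 * int g) (edge_pt k (1/2))"
        using rm transl_cong[OF uk] by (simp add: Cons)
      also have "\<dots> = edge_pt (k + 2 * int g) (1/2)"
      proof -
        have "edge_pt k = edge_pt (k + 2 * int g + 2 * int g)" by (rule edge_pt_cong) (simp add: mod_eq_dvd_iff)
        then show ?thesis using transl_edge_pt[of "k + 2 * int g" "1/2"] by simp
      qed
      finally show ?thesis using transl_inverse(1)[OF act_norm[OF edge_pt_norm]] by simp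
    qed
    show ?thesis
    proof (cases r')
      case Nil
      have "m mod N = (k + 2 * int g) mod N" using r'm Nil by (intro edge_pt_inj) simp
      moreover have "same_elt (winv v @ w) [letter_of k]" using r(2) by (simp add: Cons Nil ud)
      then have "same_elt (v @ (winv v @ w)) (v @ [letter_of k])" by (intro same_elt_append same_elt_refl)
      then have "same_elt (v @ [letter_of k]) w" unfolding same_elt_def by (simp add: act_winv' act_norm)
      ultimately show ?thesis by simp
    next
      case (Cons u2 r2)
      have r'r: "r' \<in> lists (letters g)" "\<not> D_reducible g r'"
        using r \<open>r = u # r'\<close> D_reducible_sublist[of r' r] by (auto simp: sublist_Cons_right)
      have "side (index u2) (edge_pt (k + 2 * int g) (1/2)) \<ge> 0" using ping_pong_midpoint[of u2 r2 m] r'r r'm Cons by simp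
      then have "u2 = letter_of (k + 2 * int g)" unfolding side_midpoint(2)
        using r'r(1) Cons by (metis Cons_in_lists_iff letter_of_eq_iff letter_of_index)
      then have "r = [letter_of k, letter_of (k + 2 * int g)] @ r2" using ud Cons \<open>r = u # r'\<close> by simp
      then show ?thesis using r(3) pair_leading[of k] D_reducible_leading D_reducible_sublist sublist_append_rightI by metis
    qed
  qed
qed

end

section \<open>Lifting loops to edge paths\<close>

lemma tanh_artanh:
  fixes x :: real
  assumes "\<bar>x\<bar> < 1"
  shows "tanh (artanh x) = x"
proof -
  define y where "y = (1 + x) / (1 - x)"
  have p: "1 + x > 0" "1 - x > 0" using assms by auto
  then have y: "y > 0" by (simp add: y_def)
  have e: "exp (- 2 * artanh x) = inverse y"
    using y by (simp add: artanh_def y_def[symmetric] exp_minus)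
  have "tanh (artanh x) = (1 - inverse y) / (1 + inverse y)"
    unfolding tanh_real_altdef e ..
  also have "\<dots> = x"
  proof -
    have "1 - inverse y = 2 * x / (1 + x)" "1 + inverse y = 2 / (1 + x)"
      using p by (simp_all add: y_def field_simps)
    then show ?thesis using p by simp
  qed
  finally show ?thesis .
qed

context genus begin

lemma attracting_pt_dirn: "attracting_pt g j = dirn (int j - 1)"
proof -
  have "(real j - 1) * pi / (2 * real g) = (real j - 1) * alpha" by (simp add: alpha_def)
  then have "attracting_pt g j = cis (real j * pi) * cis ((real j - 1) * alpha)"
    unfolding attracting_pt_def by (simp add: Complex.DeMoivre[symmetric])
  also have "\<dots> = cis (real j * pi + (real j - 1) * alpha)" by (rule cis_mult)
  also have "real j * pi + (real j - 1) * alpha = pi + of_int (int j - 1) * (pi + alpha)"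
    by (simp add: algebra_simps)
  finally show ?thesis unfolding dirn_def .
qed

lemma delta_eq_transl: "cmod z < 1 \<Longrightarrow> delta g j z = transl (int j - 1) z"
  by (simp add: delta_def hyp_translation_def Moebius_function_simple transl_def disk_transl_def attracting_pt_dirn tanh_half_len)

lemma carrier_BijGroup: "carrier (BijGroup S) = Bij S"
  by (simp add: BijGroup_def)

lemma letter_elt_Bij: "letter_elt g u \<in> Bij poincare_disk"
  unfolding carrier_BijGroup[symmetric]
  by (cases u) (simp_all only: letter_elt.simps delta_Bij group.inv_closed[OF group_BijGroup])

lemma letter_elt_eq_transl:
  assumes z: "cmod z < 1"
  shows "letter_elt g u z = transl (index u) z"
proof (cases u)
  case (Pos j)
  then show ?thesis using delta_eq_transl[OF z] by simp
next
  case (Neg j)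
  have d: "delta g j \<in> Bij poincare_disk" using delta_Bij[of g j] unfolding carrier_BijGroup .
  have "letter_elt g u z = inv_into poincare_disk (delta g j) z"
    using z by (simp add: Neg inv_BijGroup[OF d])
  also have "\<dots> = transl (index u) z"
  proof (rule inv_into_f_eq)
    show "inj_on (delta g j) poincare_disk" using d by (simp add: Bij_def bij_betw_def)
    show "transl (index u) z \<in> poincare_disk" using transl_norm[OF z] by simp
    have "delta g j (transl (index u) z) = transl (int j - 1) (transl (int j - 1 + 2 * int g) z)"
      using delta_eq_transl[OF transl_norm[OF z]] by (simp add: Neg algebra_simps)
    then show "delta g j (transl (index u) z) = z" using transl_inverse(2)[OF z] by simp
  qed
  finally show ?thesis .
qed

lemma surface_group_act:
  assumes "\<gamma> \<in> carrier (surface_group g)"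
  shows "\<gamma> \<in> Bij poincare_disk \<and> (\<exists>w\<in>lists (letters g). \<forall>z. cmod z < 1 \<longrightarrow> \<gamma> z = act w z)"
proof -
  have letter: "letter_elt g u \<in> Bij poincare_disk \<and> (\<exists>w\<in>lists (letters g). \<forall>z. cmod z < 1 \<longrightarrow> letter_elt g u z = act w z)"
    if "u \<in> letters g" for u
    using that letter_elt_Bij letter_elt_eq_transl by (intro conjI bexI[of _ "[u]"]) auto
  have "\<gamma> \<in> generate (BijGroup poincare_disk) (delta g ` {1..2*g})" using assms by (simp add: surface_group_def)
  then show ?thesis
  proof (induction rule: generate.induct)
    case one
    have "\<one>\<^bsub>BijGroup poincare_disk\<^esub> = (\<lambda>z\<in>poincare_disk. z)" by (simp add: BijGroup_def)
    then show ?case by (simp only:) (intro conjI id_Bij bexI[of _ "[]"], auto)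
  next
    case (incl h)
    then obtain j where "j \<in> {1..2*g}" "h = letter_elt g (Pos j)" by auto
    then show ?case using letter[of "Pos j"] by (simp only: letters_def) blast
  next
    case (inv h)
    then obtain j where "j \<in> {1..2*g}" "inv\<^bsub>BijGroup poincare_disk\<^esub> h = letter_elt g (Neg j)" by auto
    then show ?case using letter[of "Neg j"] by (simp only: letters_def) blast
  next
    case (eng h1 h2)
    then obtain w1 w2 where w: "w1 \<in> lists (letters g)" "w2 \<in> lists (letters g)"
      "\<And>z. cmod z < 1 \<Longrightarrow> h1 z = act w1 z" "\<And>z. cmod z < 1 \<Longrightarrow> h2 z = act w2 z" by blast
    have m: "h1 \<otimes>\<^bsub>BijGroup poincare_disk\<^esub> h2 = compose poincare_disk h1 h2"
      using eng by (simp add: BijGroup_def)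
    have "compose poincare_disk h1 h2 z = act (w1 @ w2) z" if "cmod z < 1" for z
      using that w(3,4) act_norm[OF that, of w2] by (simp add: compose_def)
    then show ?case unfolding m using eng w(1,2) compose_Bij by (intro conjI bexI[of _ "w1 @ w2"]) auto
  qed
qed

lemma covering_eqD:
  assumes "covering g x = covering g y" "cmod x < 1" "cmod y < 1"
  shows "\<exists>w\<in>lists (letters g). x = act w y"
proof -
  have "(\<lambda>z\<in>poincare_disk. z) \<in> carrier (surface_group g)"
    using generate.one[of "BijGroup poincare_disk" "delta g ` {1..2*g}"]
    by (simp add: surface_group_def BijGroup_def)
  then have "x \<in> covering g x"
    unfolding covering_def orbit_def using assms(2) by (force intro!: exI[of _ "\<lambda>z\<in>poincare_disk. z"])
  then obtain \<gamma> where "\<gamma> \<in> carrier (surface_group g)" "x = \<gamma> y"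
    unfolding assms(1) unfolding covering_def orbit_def by auto
  then show ?thesis using surface_group_act[of \<gamma>] assms(3) by auto
qed

text \<open>The case of equality in the triangle inequality: the distances of \<open>c t\<close>
  from both ends add up to \<open>len\<close>, which puts it on the segment.\<close>

lemma geodesic_to_edge_pt:
  assumes "constant_speed_geodesic c" "c 0 = 0" "c 1 = edge_pt k 1" "t \<in> {0..1}"
  shows "c t = edge_pt k t"
proof -
  have hd: "hdist (c s) (c t) = \<bar>s - t\<bar> * hdist (c 0) (c 1)" if "s \<in> {0..1}" "t \<in> {0..1}" for s t
    using assms(1) that unfolding constant_speed_geodesic_def by blast
  define z where "z = c t"
  define r where "r = cmod z"
  have "c t \<in> poincare_disk" using assms(1,4) unfolding constant_speed_geodesic_def by blast
  then have r: "0 \<le> r" "r < 1" by (simp_all add: r_def z_def)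
  define T where "T = dirn k"
  have T: "cmod T = 1" by (simp add: T_def)
  have c1: "c 1 = of_real apothem * T" unfolding assms(3) edge_pt_def T_def using tanh_half_len by simp
  have "hdist (c 0) (c 1) = 2 * artanh (tanh (len / 2))"
    unfolding assms(2) c1 hdist_def tanh_half_len using apothem_bounds T by (simp add: norm_mult)
  then have l: "hdist (c 0) (c 1) = len" unfolding artanh_tanh_real by simp
  have "2 * artanh r = t * len"
    using hd[of 0 t] assms(2,4) unfolding l by (simp add: hdist_def r_def z_def)
  then have ar: "artanh r = t * len / 2" by simp
  have "tanh (artanh r) = r" by (rule tanh_artanh) (use r in simp)
  then have rt: "r = tanh (t * len / 2)" unfolding ar by (rule sym)
  define q where "q = cmod ((z - c 1) / (1 - cnj (c 1) * z))"
  have nz: "1 - cnj (c 1) * z \<noteq> 0"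
  proof
    assume "1 - cnj (c 1) * z = 0"
    then have "cmod (cnj (c 1) * z) = 1" by (metis eq_iff_diff_eq_0 norm_one)
    moreover have "cmod (cnj (c 1) * z) \<le> r" unfolding c1 r_def using apothem_bounds T mult_right_mono[of apothem 1 "cmod z"]
      by (simp add: norm_mult)
    ultimately show False using r by simp
  qed
  have "q < 1"
    using Moebius_function_norm_lt_1[of "c 1" z 0] apothem_bounds T r unfolding q_def Moebius_function_simple
    by (simp add: c1 norm_mult r_def)
  moreover have "2 * artanh q = (1 - t) * len"
    using hd[of t 1] assms(4) unfolding l by (simp add: hdist_def q_def z_def)
  then have aq: "artanh q = (1 - t) * len / 2" by simp
  moreover have "q \<ge> 0" by (simp add: q_def)
  ultimately have "tanh (artanh q) = q" by (intro tanh_artanh) simp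
  then have "q = tanh ((1 - t) * len / 2)" unfolding aq by (rule sym)
  also have "\<dots> = tanh (len / 2 + - (t * len / 2))" by (rule arg_cong[where f = tanh]) (simp add: field_simps)
  also have "\<dots> = (apothem - r) / (1 - apothem * r)"
    by (subst tanh_add) (auto simp: tanh_half_len rt)
  finally have q: "q = (apothem - r) / (1 - apothem * r)" .
  have ar1: "1 - apothem * r > 0" using apothem_bounds r mult_strict_mono[of apothem 1 r 1] by simp
  have qq: "q * cmod (1 - cnj (c 1) * z) = cmod (z - c 1)" using nz by (simp add: q_def norm_divide)
  define x where "x = Re (z * cnj T)"
  have r2: "(Re z)\<^sup>2 + (Im z)\<^sup>2 = r\<^sup>2" by (simp add: r_def cmod_power2)
  have T2: "(Re T)\<^sup>2 + (Im T)\<^sup>2 = 1" using T by (simp add: cmod_power2[symmetric])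
  have n1: "(cmod (z - c 1))\<^sup>2 = r\<^sup>2 + apothem\<^sup>2 - 2 * apothem * x"
  proof -
    have "(cmod (z - c 1))\<^sup>2 = ((Re z)\<^sup>2 + (Im z)\<^sup>2) + apothem\<^sup>2 * ((Re T)\<^sup>2 + (Im T)\<^sup>2) - 2 * apothem * x"
      unfolding cmod_power2 c1 x_def by (simp add: power2_eq_square algebra_simps)
    then show ?thesis unfolding r2 T2 by simp
  qed
  have n2: "(cmod (1 - cnj (c 1) * z))\<^sup>2 = 1 + apothem\<^sup>2 * r\<^sup>2 - 2 * apothem * x"
  proof -
    have "(cmod (1 - cnj (c 1) * z))\<^sup>2 = 1 + apothem\<^sup>2 * (((Re T)\<^sup>2 + (Im T)\<^sup>2) * ((Re z)\<^sup>2 + (Im z)\<^sup>2)) - 2 * apothem * x"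
      unfolding cmod_power2 c1 x_def by (simp add: power2_eq_square algebra_simps)
    then show ?thesis unfolding r2 T2 by simp
  qed
  have "(apothem - r) * cmod (1 - cnj (c 1) * z) = cmod (z - c 1) * (1 - apothem * r)"
    using qq ar1 unfolding q by (simp add: field_simps)
  then have "((apothem - r) * cmod (1 - cnj (c 1) * z))\<^sup>2 = (cmod (z - c 1) * (1 - apothem * r))\<^sup>2" by simp
  then have "(apothem - r)\<^sup>2 * (1 + apothem\<^sup>2 * r\<^sup>2 - 2 * apothem * x) = (r\<^sup>2 + apothem\<^sup>2 - 2 * apothem * x) * (1 - apothem * r)\<^sup>2"
    unfolding power_mult_distrib n1 n2 .
  \<comment> \<open>The equation is linear in \<open>x\<close>. The cofactor of \<open>x - r\<close>
    is positive, so the projection \<open>x\<close> of \<open>z\<close> to the ray of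
    \<open>T\<close> equals \<open>cmod z\<close>.\<close>
  moreover have "(apothem - r)\<^sup>2 * (1 + apothem\<^sup>2 * r\<^sup>2 - 2 * apothem * x) - (r\<^sup>2 + apothem\<^sup>2 - 2 * apothem * x) * (1 - apothem * r)\<^sup>2
    = (2 * apothem * ((1 - apothem\<^sup>2) * (1 - r\<^sup>2))) * (x - r)"
    by (simp add: power2_eq_square algebra_simps)
  moreover have "2 * apothem * ((1 - apothem\<^sup>2) * (1 - r\<^sup>2)) > 0"
    using apothem_bounds r by (simp add: power_less_one_iff)
  ultimately have x: "x = r" by (metis eq_iff_diff_eq_0 mult_eq_0_iff less_irrefl)
  have "(cmod (z - of_real r * T))\<^sup>2 = ((Re z)\<^sup>2 + (Im z)\<^sup>2) + r\<^sup>2 * ((Re T)\<^sup>2 + (Im T)\<^sup>2) - 2 * r * x"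
    unfolding cmod_power2 x_def by (simp add: power2_eq_square algebra_simps)
  also have "\<dots> = 0" unfolding r2 T2 x by (simp add: power2_eq_square)
  finally have "z = of_real r * T" by simp
  then show ?thesis by (simp add: z_def edge_pt_def rt T_def)
qed

section \<open>Lifts of single edges\<close>

lemma open_cell: "open {z. cell z}"
proof -
  have "{z. cell z} = ball 0 1 \<inter> (\<Inter>m\<in>{0..<N}. {z. side m z < 0})"
  proof -
    have "(\<forall>m. side m z < 0) \<longleftrightarrow> (\<forall>m\<in>{0..<N}. side m z < 0)" for z
    proof
      assume *: "\<forall>m\<in>{0..<N}. side m z < 0"
      show "\<forall>m. side m z < 0"
      proof
        fix m show "side m z < 0" using *[rule_format, of "m mod N"] mod_bounds[of m] side_cong[of "m mod N" m] by simp
      qed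
    qed simp
    then show ?thesis unfolding cell_def by auto
  qed
  moreover have "open {z. side m z < 0}" for m
    by (intro open_Collect_less continuous_side continuous_on_const)
  ultimately show ?thesis by (simp add: open_INT open_Int)
qed

text \<open>The hypothesis gives a word for each time separately; connectedness makes it constant
  before 1/2, and continuity extends this to 1/2.\<close>

lemma half_edge_lift:
  assumes F: "continuous_on {0..1/2::real} F"
    and lift: "\<And>t. t \<in> {0..1/2} \<Longrightarrow> \<exists>x\<in>lists (letters g). F t = act x (edge_pt k t)"
  shows "\<exists>x\<in>lists (letters g). \<forall>t\<in>{0..1/2}. F t = act x (edge_pt k t)"
proof -
  define S where "S = {0..<1/2::real}"
  have SS: "S \<subseteq> {0..1/2}" by (auto simp: S_def)
  obtain x0 where x0: "x0 \<in> lists (letters g)" "F 0 = act x0 (edge_pt k 0)" using lift[of 0] by auto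
  have Fn: "cmod (F t) < 1" if "t \<in> {0..1/2}" for t using lift[OF that] act_norm[OF edge_pt_norm] by auto
  define G where "G t = F t - act x0 (edge_pt k t)" for t
  have Gc: "continuous_on {0..1/2} G" unfolding G_def
    by (intro continuous_on_diff F continuous_act_compose continuous_edge_pt edge_pt_norm)
  define A where "A = {t \<in> S. G t = 0}"
  have "closedin (top_of_set S) A"
    unfolding A_def by (rule continuous_closedin_preimage_constant[OF continuous_on_subset[OF Gc SS]])
  \<comment> \<open>Openness of \<open>A\<close>: a point of \<open>F\<close> in the image of the
    cell under \<open>x0\<close> can only lie on the half-edge of \<open>x0\<close>, because the
    cells are disjoint.\<close>
  moreover have "A = S \<inter> (\<lambda>t. act (winv x0) (F t)) -` {z. cell z}"
  proof (intro Set.set_eqI iffI)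
    fix t assume "t \<in> A"
    then have t: "t \<in> S" "F t = act x0 (edge_pt k t)" by (auto simp: A_def G_def)
    then show "t \<in> S \<inter> (\<lambda>t. act (winv x0) (F t)) -` {z. cell z}"
      using act_winv[OF edge_pt_norm] cell_edge_pt by (auto simp: S_def)
  next
    fix t assume t: "t \<in> S \<inter> (\<lambda>t. act (winv x0) (F t)) -` {z. cell z}"
    then have tS: "t \<in> {0..1/2}" "0 \<le> t" "t < 1/2" by (auto simp: S_def)
    obtain x where x: "x \<in> lists (letters g)" "F t = act x (edge_pt k t)" using lift[OF tS(1)] by auto
    have "act x0 (act (winv x0) (F t)) = act x (edge_pt k t)" using act_winv'[OF Fn[OF tS(1)]] x(2) by simp
    then have "same_elt x0 x" using cells_disjoint(1)[OF x0(1) x(1) _ cell_edge_pt[OF tS(2,3)]] t by auto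
    then have "G t = 0" using x(2) weqD[OF _ edge_pt_norm] by (simp add: G_def)
    then show "t \<in> A" using t by (auto simp: A_def)
  qed
  moreover have "openin (top_of_set S) (S \<inter> (\<lambda>t. act (winv x0) (F t)) -` {z. cell z})"
    by (rule continuous_openin_preimage_gen[OF continuous_act_compose[OF continuous_on_subset[OF F SS]] open_cell])
      (use Fn SS in blast)
  ultimately have "closedin (top_of_set S) A" "openin (top_of_set S) A" by (simp_all only:)
  moreover have "connected S" by (simp add: S_def)
  moreover have "0 \<in> A" using x0(2) by (simp add: A_def S_def G_def)
  ultimately have "A = S" unfolding connected_clopen by blast
  have "G t = 0" if "t \<in> {0..1/2}" for t
  proof (rule continuous_constant_on_closure[where S = S and f = G])
    show "continuous_on (closure S) G" using Gc by (simp add: S_def)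
    show "t \<in> closure S" using that by (simp add: S_def)
    show "G s = 0" if "s \<in> S" for s using that \<open>A = S\<close> by (auto simp: A_def)
  qed
  then show ?thesis using x0(1) by (intro bexI[of _ x0]) (auto simp: G_def)
qed

lemma edge_pt_reverse: "edge_pt k (1 - t) = transl k (edge_pt (k + 2 * int g) t)"
  using transl_edge_pt[of k "1 - t"] by simp

text \<open>The edge leaves the cell of \<open>x\<close> at its midpoint. The second half is
  therefore lifted from the far end, and \<open>common_midpoint\<close> matches the two
  words.\<close>

lemma edge_lift:
  assumes F: "continuous_on {0..1::real} F"
    and lift: "\<And>t. t \<in> {0..1} \<Longrightarrow> \<exists>x\<in>lists (letters g). F t = act x (edge_pt k t)"
  shows "\<exists>x\<in>lists (letters g). \<forall>t\<in>{0..1}. F t = act x (edge_pt k t)"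
proof -
  have dk: "act [letter_of k] z = transl k z" for z using act_map_letter_of[of "[k]" z] by simp
  obtain x where x: "x \<in> lists (letters g)" "\<And>t. t \<in> {0..1/2} \<Longrightarrow> F t = act x (edge_pt k t)"
    using half_edge_lift[of F k] lift continuous_on_subset[OF F] by force
  have "\<exists>y\<in>lists (letters g). \<forall>t\<in>{0..1/2}. F (1 - t) = act y (edge_pt (k + 2 * int g) t)"
  proof (rule half_edge_lift)
    show "continuous_on {0..1/2} (\<lambda>t. F (1 - t))"
      by (intro continuous_on_compose2[OF F] continuous_intros) auto
    fix t :: real assume "t \<in> {0..1/2}"
    then obtain y where y: "y \<in> lists (letters g)" "F (1 - t) = act y (edge_pt k (1 - t))" using lift[of "1 - t"] by auto
    then have "F (1 - t) = act (y @ [letter_of k]) (edge_pt (k + 2 * int g) t)" unfolding act_simps(3) dk edge_pt_reverse by simp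
    then show "\<exists>x\<in>lists (letters g). F (1 - t) = act x (edge_pt (k + 2 * int g) t)"
      using y(1) letter_of_letters by (intro bexI[of _ "y @ [letter_of k]"]) auto
  qed
  then obtain y where y: "y \<in> lists (letters g)" "\<And>t. t \<in> {0..1/2} \<Longrightarrow> F (1 - t) = act y (edge_pt (k + 2 * int g) t)" by blast
  have "act x (edge_pt k (1/2)) = act y (edge_pt (k + 2 * int g) (1/2))" using x(2)[of "1/2"] y(2)[of "1/2"] by simp
  then have "same_elt (x @ [letter_of k]) y"
  proof -
    have "k mod N \<noteq> (k + 2 * int g) mod N" using mod_opp[of k] g2 by auto
    then show ?thesis
      using common_midpoint[OF x(1) y(1) \<open>act x (edge_pt k (1/2)) = act y (edge_pt (k + 2 * int g) (1/2))\<close>] by blast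
  qed
  have "F t = act x (edge_pt k t)" if t: "t \<in> {0..1}" for t
  proof (cases "t \<le> 1/2")
    case False
    have "F t = act y (edge_pt (k + 2 * int g) (1 - t))" using y(2)[of "1 - t"] False t by simp
    also have "\<dots> = act (x @ [letter_of k]) (edge_pt (k + 2 * int g) (1 - t))" using weqD[OF \<open>same_elt (x @ [letter_of k]) y\<close> edge_pt_norm] by simp
    also have "\<dots> = act x (edge_pt k t)" unfolding act_simps(3) dk transl_edge_pt ..
    finally show ?thesis .
  qed (use x t in auto)
  then show ?thesis using x(1) by blast
qed


section \<open>Common values of two edge paths\<close>

text \<open>A bi-infinite edge path that takes unit time for each edge and is at the vertex \<open>act (x k) 0\<close> at
  time \<open>k\<close>.\<close>

definition trace :: "(real \<Rightarrow> complex) \<Rightarrow> (int \<Rightarrow> letter) \<Rightarrow> (int \<Rightarrow> letter list) \<Rightarrow> bool" where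
  "trace F u x \<longleftrightarrow>
     (\<forall>k. u k \<in> letters g \<and> x k \<in> lists (letters g) \<and> same_elt (x (k + 1)) (x k @ [u k]) \<and>
       (\<forall>t\<in>{0..1}. F (of_int k + t) = act (x k) (edge_pt (index (u k)) t))) \<and>
     (\<forall>i m. \<not> D_reducible g (map (\<lambda>r. u (i + int r)) [0..<m]))"

lemma traceD:
  assumes "trace F u x"
  shows "u k \<in> letters g" "x k \<in> lists (letters g)" "same_elt (x (k + 1)) (x k @ [u k])"
    "t \<in> {0..1} \<Longrightarrow> F (of_int k + t) = act (x k) (edge_pt (index (u k)) t)"
    "\<not> D_reducible g (map (\<lambda>r. u (i + int r)) [0..<m])"
  using assms unfolding trace_def by blast+

lemma edge_pt_linv: "edge_pt (index (linv u)) = edge_pt (index u + 2 * int g)"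
  by (cases u) (auto intro!: edge_pt_cong simp: mod_eq_dvd_iff)

lemma act_edge_reverse: "act (x @ [u]) (edge_pt (index (linv u)) t) = act x (edge_pt (index u) (1 - t))"
  by (simp add: edge_pt_linv edge_pt_reverse)

lemma lifting_trace:
  assumes "cyclically_D_reduced g w" "piecewise_geodesic_loop g w \<phi>" "lifting g \<phi> f"
  shows "\<exists>u x. trace (\<lambda>s. f (s / real (length w))) u x"
proof -
  define n where "n = length w"
  have wl: "w \<in> lists (letters g)" and wne: "w \<noteq> []"
    and geo: "\<And>k. k < n \<Longrightarrow> geodesic_loop_representing g (letter_elt g (w ! k)) (\<lambda>t. \<phi> (p_circle ((real k + t) / real n)))"
    using assms(2) unfolding piecewise_geodesic_loop_def n_def by (auto simp: word_elt_def)
  have n: "n > 0" using wne by (simp add: n_def)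
  have fc: "continuous_on UNIV f" "\<And>t. cmod (f t) < 1" "\<And>t. covering g (f t) = \<phi> (p_circle t)"
    using assms(3) unfolding lifting_def by (auto simp: image_subset_iff)
  define F where "F s = f (s / real n)" for s
  have Fc: "continuous_on UNIV F" unfolding F_def using n
    by (intro continuous_on_compose2[OF fc(1)] continuous_intros) auto
  define u where "u k = w ! nat (k mod int n)" for k
  have ul: "u k \<in> letters g" for k
  proof -
    have "nat (k mod int n) < n" using n by (simp add: nat_less_iff)
    then show ?thesis using wl unfolding u_def n_def by (simp add: in_lists_conv_set)
  qed
  have "\<exists>x\<in>lists (letters g). \<forall>t\<in>{0..1}. F (of_int k + t) = act x (edge_pt (index (u k)) t)" for k
  proof (rule edge_lift)
    show "continuous_on {0..1} (\<lambda>t. F (of_int k + t))"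
      by (intro continuous_on_compose2[OF Fc] continuous_intros) auto
    fix t :: real assume t: "t \<in> {0..1}"
    define q where "q = nat (k mod int n)"
    have q: "q < n" "int q = k mod int n" using n by (auto simp: q_def nat_less_iff)
    obtain c where c: "constant_speed_geodesic c" "c 0 = 0" "c 1 = letter_elt g (w ! q) 0"
      "\<forall>t\<in>{0..1}. \<phi> (p_circle ((real q + t) / real n)) = covering g (c t)"
      using geo[OF q(1)] unfolding geodesic_loop_representing_def by blast
    have "c 1 = edge_pt (index (u k)) 1"
      using c(3) letter_elt_eq_transl[of 0 "w ! q"] transl_edge_pt[of "index (w ! q)" 1] by (simp add: u_def q_def edge_pt_0)
    then have ct: "c t = edge_pt (index (u k)) t" by (rule geodesic_to_edge_pt[OF c(1,2) _ t])
    \<comment> \<open>Shifting by whole periods changes neither the letter nor the point of the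
      circle.\<close>
    have "k = int q + int n * (k div int n)" using q(2) mod_mult_div_eq[of k "int n"] by simp
    then have "of_int k = real q + real n * of_int (k div int n)"
      by (metis of_int_add of_int_mult of_int_of_nat_eq)
    then have "(of_int k + t) / real n = (real q + t) / real n + of_int (k div int n)"
      using n by (simp add: field_simps)
    then have "p_circle ((of_int k + t) / real n) = p_circle ((real q + t) / real n)"
      unfolding p_circle_def by (simp add: distrib_left cis_mult[symmetric] cis_multiple_2pi)
    then have "covering g (F (of_int k + t)) = covering g (edge_pt (index (u k)) t)"
      unfolding F_def fc(3) using c(4) t ct by simp
    then show "\<exists>x\<in>lists (letters g). F (of_int k + t) = act x (edge_pt (index (u k)) t)"
      using covering_eqD fc(2) edge_pt_norm unfolding F_def by blast
  qed
  then obtain x where x: "\<And>k. x k \<in> lists (letters g)"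
    "\<And>k t. t \<in> {0..1} \<Longrightarrow> F (of_int k + t) = act (x k) (edge_pt (index (u k)) t)" by metis
  \<comment> \<open>The two edges meeting at time \<open>k + 1\<close> give that vertex as two
    images of 0. Disjointness of the cells then identifies the elements.\<close>
  have "same_elt (x (k + 1)) (x k @ [u k])" for k
  proof (rule cells_disjoint(1)[OF _ _ cell_0 cell_0])
    have "act (x (k + 1)) 0 = F (of_int k + 1)" using x(2)[of 0 "k + 1"] by (simp add: edge_pt_0)
    also have "\<dots> = act (x k @ [u k]) 0"
      using x(2)[of 1 k] act_edge_reverse[of "x k" "u k" 0] by (simp add: edge_pt_0)
    finally show "act (x (k + 1)) 0 = act (x k @ [u k]) 0" .
  qed (use x(1) ul in auto)
  moreover have "\<not> D_reducible g (map (\<lambda>r. u (i + int r)) [0..<m])" for i m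
    unfolding u_def n_def by (rule periodic_D_reduced[OF wne assms(1)])
  ultimately have "trace F u x" unfolding trace_def using x ul by blast
  then show ?thesis unfolding F_def n_def by blast
qed

lemma trace_word:
  assumes "trace F u x"
  shows "same_elt (x (i + int m)) (x i @ map (\<lambda>r. u (i + int r)) [0..<m])"
proof (induction m)
  case (Suc m)
  have "same_elt (x (i + int m + 1)) (x (i + int m) @ [u (i + int m)])" by (rule traceD(3)[OF assms])
  also have "same_elt (x (i + int m) @ [u (i + int m)]) ((x i @ map (\<lambda>r. u (i + int r)) [0..<m]) @ [u (i + int m)])"
    by (rule same_elt_append[OF Suc same_elt_refl])
  finally show ?case by (simp add: algebra_simps)
qed simp

lemma same_elt_cancel_left:
  assumes "same_elt v v'" "same_elt (v @ w) (v' @ w')"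
  shows "same_elt w w'"
  unfolding same_elt_def
proof (intro allI impI)
  fix z :: complex assume z: "cmod z < 1"
  show "act w z = act w' z"
    by (rule act_inj[OF assms(1) act_norm[OF z] act_norm[OF z]]) (use weqD[OF assms(2) z] in simp)
qed

text \<open>Between the common vertices both paths spell \<open>D\<close>-reduced words for the same
  element. By uniqueness the words agree, so the paths also take the same time.\<close>

lemma common_vertices_path:
  assumes F: "trace F u x" and H: "trace H v y"
    and "same_elt (x i) (y j)" "same_elt (x (i + int a)) (y (j + int b))"
  shows "a = b" "r < a \<Longrightarrow> u (i + int r) = v (j + int r)" "r \<le> a \<Longrightarrow> same_elt (x (i + int r)) (y (j + int r))"
proof -
  define U V where "U m = map (\<lambda>r. u (i + int r)) [0..<m]" and "V m = map (\<lambda>r. v (j + int r)) [0..<m]" for m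
  have "same_elt (x i @ U a) (x (i + int a))" unfolding U_def by (rule same_elt_sym[OF trace_word[OF F]])
  also note assms(4)
  also have "same_elt (y (j + int b)) (y j @ V b)" unfolding V_def by (rule trace_word[OF H])
  finally have "same_elt (U a) (V b)" by (rule same_elt_cancel_left[OF assms(3)])
  moreover have "U a \<in> lists (letters g)" "V b \<in> lists (letters g)"
    using traceD(1)[OF F] traceD(1)[OF H] by (auto simp: U_def V_def)
  ultimately have UV: "U a = V b"
    using traceD(5)[OF F, of i a] traceD(5)[OF H, of j b] unfolding U_def V_def by (intro D_reduced_unique)
  show ab: "a = b" using arg_cong[OF UV, of length] by (simp add: U_def V_def)
  have uv: "u (i + int r) = v (j + int r)" if "r < a" for r
    using arg_cong[OF UV, of "\<lambda>l. l ! r"] that ab by (simp add: U_def V_def)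
  then show "r < a \<Longrightarrow> u (i + int r) = v (j + int r)" .
  assume "r \<le> a"
  then have "U r = V r" using uv by (auto simp: U_def V_def)
  have "same_elt (x (i + int r)) (x i @ U r)" unfolding U_def by (rule trace_word[OF F])
  also have "same_elt (x i @ U r) (y j @ V r)" unfolding \<open>U r = V r\<close> by (rule same_elt_append[OF assms(3) same_elt_refl])
  also have "same_elt (y j @ V r) (y (j + int r))" unfolding V_def by (rule same_elt_sym[OF trace_word[OF H]])
  finally show "same_elt (x (i + int r)) (y (j + int r))" .
qed

text \<open>The word remains reduced by \<open>D_reducible_winv\<close>. The shift
  \<open>- k - 1\<close> occurs because the reversed edge leaving time \<open>- k\<close> is the one
  that began at \<open>- k - 1\<close>.\<close>

lemma trace_reverse:
  assumes F: "trace F u x"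
  shows "trace (\<lambda>s. F (- s)) (\<lambda>k. linv (u (- k - 1))) (\<lambda>k. x (- k))"
  unfolding trace_def
proof (intro conjI allI ballI)
  fix k :: int
  show "linv (u (- k - 1)) \<in> letters g" using traceD(1)[OF F, of "- k - 1"] by (auto simp: letters_def)
  show "x (- k) \<in> lists (letters g)" by (rule traceD(2)[OF F])
  define u' where "u' = u (- k - 1)"
  have w: "same_elt (x (- k)) (x (- k - 1) @ [u'])" using traceD(3)[OF F, of "- k - 1"] by (simp add: u'_def)
  show "same_elt (x (- (k + 1))) (x (- k) @ [linv (u (- k - 1))])"
    unfolding same_elt_def
  proof (intro allI impI)
    fix z :: complex assume z: "cmod z < 1"
    have "act (x (- k) @ [linv u']) z = act (x (- k - 1)) (transl (index u') (transl (index (linv u')) z))"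
      using weqD[OF w transl_norm[OF z]] by simp
    also have "\<dots> = act (x (- k - 1)) z" using transl_linv[OF z, of "linv u'"] by simp
    finally show "act (x (- (k + 1))) z = act (x (- k) @ [linv (u (- k - 1))]) z" by (simp add: u'_def)
  qed
  fix t :: real assume t: "t \<in> {0..1}"
  have "F (- (of_int k + t)) = F (of_int (- k - 1) + (1 - t))" by (rule arg_cong[where f = F]) simp
  also have "\<dots> = act (x (- k - 1)) (edge_pt (index u') (1 - t))" using traceD(4)[OF F, of "1 - t" "- k - 1"] t by (simp add: u'_def)
  also have "\<dots> = act (x (- k)) (edge_pt (index (linv u')) t)"
    unfolding act_edge_reverse[symmetric] by (rule weqD[OF same_elt_sym[OF w] edge_pt_norm])
  finally show "F (- (of_int k + t)) = act (x (- k)) (edge_pt (index (linv (u (- k - 1)))) t)" by (simp add: u'_def)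
next
  fix i m
  have "map (\<lambda>r. linv (u (- (i + int r) - 1))) [0..<m] = winv (map (\<lambda>r. u ((- i - int m) + int r)) [0..<m])"
  proof (rule nth_equalityI)
    fix r assume "r < length (map (\<lambda>r. linv (u (- (i + int r) - 1))) [0..<m])"
    then have r: "r < m" "(- i - int m) + int (m - Suc r) = - (i + int r) - 1" by simp_all
    have "winv (map (\<lambda>r. u ((- i - int m) + int r)) [0..<m]) ! r = linv (u ((- i - int m) + int (m - Suc r)))"
      using r(1) by (simp add: winv_def rev_nth)
    then show "map (\<lambda>r. linv (u (- (i + int r) - 1))) [0..<m] ! r = winv (map (\<lambda>r. u ((- i - int m) + int r)) [0..<m]) ! r"
      unfolding r(2) using r(1) by simp
  qed simp
  then show "\<not> D_reducible g (map (\<lambda>r. linv (u (- (i + int r) - 1))) [0..<m])"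
    using traceD(5)[OF F, of "- i - int m" m] by (simp only: D_reducible_winv) simp
qed

section \<open>Connecting common vertices\<close>

lemma segment_component:
  fixes a b p q :: real
  assumes "\<And>r. r \<in> {0..1} \<Longrightarrow> (a + r * p, b + r * q) \<in> S"
  shows "connected_component S (a, b) (a + p, b + q)"
proof (rule connected_componentI)
  show "connected ((\<lambda>r. (a + r * p, b + r * q)) ` {0..1})"
    by (intro connected_continuous_image continuous_intros) auto
  show "(\<lambda>r. (a + r * p, b + r * q)) ` {0..1} \<subseteq> S" using assms by auto
  show "(a, b) \<in> (\<lambda>r. (a + r * p, b + r * q)) ` {0..1}" by (rule image_eqI[of _ _ 0]) auto
  show "(a + p, b + q) \<in> (\<lambda>r. (a + r * p, b + r * q)) ` {0..1}" by (rule image_eqI[of _ _ 1]) auto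
qed

lemma common_vertices_forward:
  assumes F: "trace F u x" and H: "trace H v y"
    and "same_elt (x i) (y j)" "same_elt (x i') (y j')" "i \<le> i'" "j \<le> j'"
  shows "connected_component (CVP F H) (of_int i, of_int j) (of_int i', of_int j')"
proof -
  obtain a b where ab: "i' = i + int a" "j' = j + int b" using assms(5,6) by (metis zle_iff_zadd)
  note P = common_vertices_path[OF F H assms(3), of a b, OF assms(4)[unfolded ab]]
  have "connected_component (CVP F H) (of_int i, of_int j) (of_int (i + int r), of_int (j + int r))" if "r \<le> a" for r
    using that
  proof (induction r)
    case 0
    have "act (x i) 0 = act (y j) 0" by (rule weqD[OF assms(3)]) simp
    then have "F (of_int i) = H (of_int j)"
      using traceD(4)[OF F, of 0 i] traceD(4)[OF H, of 0 j] by (simp add: edge_pt_0)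
    then show ?case by (simp add: connected_component_refl CVP_def)
  next
    case (Suc r)
    have "connected_component (CVP F H) (of_int (i + int r), of_int (j + int r)) (of_int (i + int r) + 1, of_int (j + int r) + 1)"
    proof (rule segment_component)
      fix t :: real assume t: "t \<in> {0..1}"
      have "F (of_int (i + int r) + t) = act (x (i + int r)) (edge_pt (index (u (i + int r))) t)" by (rule traceD(4)[OF F t])
      also have "\<dots> = act (y (j + int r)) (edge_pt (index (v (j + int r))) t)"
        using P(2)[of r] weqD[OF P(3)[of r] edge_pt_norm] Suc.prems by simp
      also have "\<dots> = H (of_int (j + int r) + t)" by (rule traceD(4)[OF H t, symmetric])
      finally show "(of_int (i + int r) + t * 1, of_int (j + int r) + t * 1) \<in> CVP F H" by (simp add: CVP_def)
    qed
    then have "connected_component (CVP F H) (of_int (i + int r), of_int (j + int r)) (of_int (i + int (Suc r)), of_int (j + int (Suc r)))"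
      by (simp add: algebra_simps)
    moreover have "connected_component (CVP F H) (of_int i, of_int j) (of_int (i + int r), of_int (j + int r))"
      using Suc by simp
    ultimately show ?case by (rule connected_component_trans[rotated])
  qed
  from this[of a] show ?thesis unfolding ab P(1)[symmetric] by simp
qed

text \<open>The paths may meet the two vertices in opposite orders. Then the second path is reversed
  and the connecting set is mirrored.\<close>

lemma common_vertices_connected:
  assumes F: "trace F u x" and H: "trace H v y"
    and ij: "same_elt (x i) (y j)" "same_elt (x i') (y j')"
  shows "connected_component (CVP F H) (of_int i, of_int j) (of_int i', of_int j')"
proof -
  have *: "connected_component (CVP F H) (of_int i, of_int j) (of_int i', of_int j')"
    if ij: "same_elt (x i) (y j)" "same_elt (x i') (y j')" and le: "i \<le> i'" for i j i' j'
  proof (cases "j \<le> j'")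
    case True
    then show ?thesis using common_vertices_forward[OF F H ij le] by simp
  next
    case False
    have "connected_component (CVP F (\<lambda>s. H (- s))) (of_int i, of_int (- j)) (of_int i', of_int (- j'))"
      using common_vertices_forward[OF F trace_reverse[OF H], of i "- j" i' "- j'"] ij le False by simp
    then obtain T where T: "connected T" "T \<subseteq> CVP F (\<lambda>s. H (- s))"
      "(of_int i, of_int (- j)) \<in> T" "(of_int i', of_int (- j')) \<in> T" unfolding connected_component_def by blast
    define m where "m p = (fst p, - snd p)" for p :: "real \<times> real"
    show ?thesis
    proof (rule connected_componentI)
      show "connected (m ` T)" unfolding m_def by (intro connected_continuous_image T(1) continuous_intros)
      show "m ` T \<subseteq> CVP F H" using T(2) by (auto simp: m_def CVP_def)
      show "(of_int i, of_int j) \<in> m ` T" using T(3) by (force simp: m_def)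
      show "(of_int i', of_int j') \<in> m ` T" using T(4) by (force simp: m_def)
    qed
  qed
  show ?thesis
  proof (cases "i \<le> i'")
    case False
    then show ?thesis using *[OF ij(2,1)] connected_component_sym by auto
  qed (use *[OF ij] in blast)
qed

text \<open>An edge seen from one end, forwards or backwards in time; in use \<open>d\<close> is 1
  or -1. Since every time is within 1/2 of an integer, each value of a path is reached from the
  centre of a cell along half an edge.\<close>

definition half_edge :: "(real \<Rightarrow> complex) \<Rightarrow> (int \<Rightarrow> letter list) \<Rightarrow> int \<Rightarrow> int \<Rightarrow> letter \<Rightarrow> bool" where
  "half_edge F x i d a \<longleftrightarrow> x i \<in> lists (letters g) \<and> a \<in> letters g \<and> same_elt (x (i + d)) (x i @ [a]) \<and>
     x (i + d) \<in> lists (letters g) \<and>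
     (\<forall>r\<in>{0..1}. F (of_int i + r * of_int d) = act (x i) (edge_pt (index a) r))"

lemma half_edge_flip:
  assumes "half_edge F x i d a"
  shows "half_edge F x (i + d) (- d) (linv a)"
  unfolding half_edge_def
proof (intro conjI ballI)
  have w: "same_elt (x (i + d)) (x i @ [a])" using assms by (simp add: half_edge_def)
  show "x (i + d) \<in> lists (letters g)" "linv a \<in> letters g" "x (i + d + - d) \<in> lists (letters g)"
    using assms by (auto simp: half_edge_def letters_def)
  show "same_elt (x (i + d + - d)) (x (i + d) @ [linv a])"
    unfolding same_elt_def
  proof (intro allI impI)
    fix z :: complex assume z: "cmod z < 1"
    show "act (x (i + d + - d)) z = act (x (i + d) @ [linv a]) z"
      using weqD[OF w transl_norm[OF z]] transl_linv[OF z, of "linv a"] by simp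
  qed
  fix r :: real assume r: "r \<in> {0..1}"
  have "F (of_int (i + d) + r * of_int (- d)) = F (of_int i + (1 - r) * of_int d)"
    by (rule arg_cong[where f = F]) (simp add: algebra_simps)
  also have "\<dots> = act (x i) (edge_pt (index a) (1 - r))" using assms r by (simp add: half_edge_def)
  also have "\<dots> = act (x (i + d)) (edge_pt (index (linv a)) r)"
    unfolding act_edge_reverse[symmetric] by (rule weqD[OF same_elt_sym[OF w] edge_pt_norm])
  finally show "F (of_int (i + d) + r * of_int (- d)) = act (x (i + d)) (edge_pt (index (linv a)) r)" .
qed

lemma trace_half_edge:
  fixes s :: real
  assumes F: "trace F u x"
  obtains i d a \<tau> where "half_edge F x i d a" "0 \<le> \<tau>" "\<tau> \<le> 1/2" "s = of_int i + \<tau> * of_int d"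
proof -
  define k where "k = \<lfloor>s\<rfloor>"
  have s: "of_int k \<le> s" "s < of_int k + 1" by (auto simp: k_def)
  have h: "half_edge F x k 1 (u k)" using traceD[OF F] by (simp add: half_edge_def)
  show ?thesis
  proof (cases "s - of_int k \<le> 1/2")
    case True
    then show ?thesis using that[OF h, of "s - of_int k"] s by simp
  next
    case False
    then show ?thesis using that[OF half_edge_flip[OF h], of "of_int k + 1 - s"] s by simp
  qed
qed

lemma half_edges_component:
  assumes "half_edge F x i d a" "half_edge H y j d' b" "same_elt (x i) (y j)" "\<tau> \<in> {0..1}"
    and "\<tau> = 0 \<or> index a mod N = index b mod N"
  shows "connected_component (CVP F H) (of_int i, of_int j) (of_int i + \<tau> * of_int d, of_int j + \<tau> * of_int d')"
proof (rule segment_component)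
  fix r :: real assume r: "r \<in> {0..1}"
  have rt: "r * \<tau> \<in> {0..1}" using r assms(4) by (auto simp: mult_le_one)
  have "edge_pt (index a) (r * \<tau>) = edge_pt (index b) (r * \<tau>)" using assms(5) edge_pt_cong[of "index a" "index b"] by (auto simp: edge_pt_0)
  then have "F (of_int i + (r * \<tau>) * of_int d) = H (of_int j + (r * \<tau>) * of_int d')"
    using assms(1,2) rt weqD[OF assms(3) edge_pt_norm] unfolding half_edge_def by simp
  then show "(of_int i + r * (\<tau> * of_int d), of_int j + r * (\<tau> * of_int d')) \<in> CVP F H"
    by (simp add: CVP_def mult.assoc)
qed

text \<open>Before their midpoints, two half-edges with a common value lie in the same cell and run
  back to its centre together. A midpoint can only coincide with a midpoint.\<close>

lemma common_value_to_vertex: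
  assumes F: "trace F u x" and H: "trace H v y" and eq: "F s = H t"
  shows "\<exists>i j. same_elt (x i) (y j) \<and> connected_component (CVP F H) (of_int i, of_int j) (s, t)"
proof -
  obtain i d a \<tau> where f: "half_edge F x i d a" "0 \<le> \<tau>" "\<tau> \<le> 1/2" "s = of_int i + \<tau> * of_int d"
    using trace_half_edge[OF F] .
  obtain j d' b \<tau>' where h: "half_edge H y j d' b" "0 \<le> \<tau>'" "\<tau>' \<le> 1/2" "t = of_int j + \<tau>' * of_int d'"
    using trace_half_edge[OF H] .
  have xl: "x i \<in> lists (letters g)" "a \<in> letters g" "y j \<in> lists (letters g)" "b \<in> letters g"
    using f(1) h(1) by (auto simp: half_edge_def)
  have e: "act (x i) (edge_pt (index a) \<tau>) = act (y j) (edge_pt (index b) \<tau>')"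
    using eq f h unfolding half_edge_def by simp
  consider "\<tau> < 1/2" "\<tau>' < 1/2" | "\<tau> = 1/2" "\<tau>' < 1/2" | "\<tau> < 1/2" "\<tau>' = 1/2" | "\<tau> = 1/2" "\<tau>' = 1/2"
    using f(3) h(3) by linarith
  then show ?thesis
  proof cases
    case 1
    note c = cells_disjoint[OF xl(1,3) cell_edge_pt[OF f(2) 1(1)] cell_edge_pt[OF h(2) 1(2)] e]
    have r: "tanh (\<tau> * len / 2) \<ge> 0" "tanh (\<tau>' * len / 2) \<ge> 0" using f(2) h(2) len_pos by auto
    have "cmod (edge_pt (index a) \<tau>) = cmod (edge_pt (index b) \<tau>')" using c(2) by simp
    then have "tanh (\<tau> * len / 2) = tanh (\<tau>' * len / 2)" using r by (simp add: edge_pt_def norm_mult)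
    then have tt: "\<tau>' = \<tau>" using len_pos by simp
    \<comment> \<open>At the vertex itself the two directions may differ.\<close>
    have "\<tau> = 0 \<or> index a mod N = index b mod N"
    proof (cases "\<tau> = 0")
      case False
      then have "tanh (\<tau> * len / 2) \<noteq> 0" using len_pos by simp
      then have "dirn (index a) = dirn (index b)" using c(2) unfolding tt edge_pt_def by simp
      then show ?thesis by (simp add: dirn_inj)
    qed simp
    then show ?thesis using half_edges_component[OF f(1) h(1) c(1), of \<tau>] c(1) f h tt by auto
  next
    case 2
    then show ?thesis using midpoint_not_in_cell[OF xl(3,1) cell_edge_pt[OF h(2) 2(2)]] e by metis
  next
    case 3
    then show ?thesis using midpoint_not_in_cell[OF xl(1,3) cell_edge_pt[OF f(2) 3(1)]] e by metis
  next
    case 4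
    from common_midpoint[OF xl(1,3)] e 4
    consider "same_elt (x i) (y j)" "index a mod N = index b mod N"
      | "same_elt (x i @ [letter_of (index a)]) (y j)" "index b mod N = (index a + 2 * int g) mod N" by blast
    then show ?thesis
    proof cases
      case 1
      then show ?thesis using half_edges_component[OF f(1) h(1) 1(1), of \<tau>] f h 4 by auto
    next
      case 2
      \<comment> \<open>The half-edges reach the midpoint from opposite sides of the wall. Seen from
        its far end \<open>x (i + d)\<close>, the first starts at the same vertex and in the same
        direction as the second.\<close>
      have "same_elt (x (i + d)) (x i @ [a])" using f(1) by (simp add: half_edge_def)
      also have "same_elt (x i @ [a]) (y j)" using 2(1) xl(2) by (simp add: letter_of_index)
      finally have w: "same_elt (x (i + d)) (y j)" .
      have "index (linv a) mod N = (index a + 2 * int g) mod N" by (cases a) (auto simp: mod_eq_dvd_iff)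
      then have "index (linv a) mod N = index b mod N" using 2(2) by simp
      then have "connected_component (CVP F H) (of_int (i + d), of_int j)
          (of_int (i + d) + 1/2 * of_int (- d), of_int j + 1/2 * of_int d')"
        by (intro half_edges_component[OF half_edge_flip[OF f(1)] h(1) w]) simp_all
      moreover have "of_int (i + d) + 1/2 * of_int (- d) = s" "of_int j + 1/2 * of_int d' = t"
        using f(4) h(4) 4 by (simp_all add: field_simps)
      ultimately show ?thesis using w by metis
    qed
  qed
qed

section \<open>Connectedness of the set of common value pairs\<close>

lemma traces_CVP_connected:
  assumes F: "trace F u x" and H: "trace H v y"
  shows "connected (CVP F H)"
  unfolding connected_iff_connected_component
proof (intro ballI)
  fix p q assume "p \<in> CVP F H" "q \<in> CVP F H"
  then have e: "F (fst p) = H (snd p)" "F (fst q) = H (snd q)" by (auto simp: CVP_def)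
  obtain i j where p: "same_elt (x i) (y j)" "connected_component (CVP F H) (of_int i, of_int j) p"
    using common_value_to_vertex[OF F H e(1)] by auto
  obtain i' j' where q: "same_elt (x i') (y j')" "connected_component (CVP F H) (of_int i', of_int j') q"
    using common_value_to_vertex[OF F H e(2)] by auto
  show "connected_component (CVP F H) p q"
    using connected_component_trans[OF connected_component_sym[OF p(2)]
        connected_component_trans[OF common_vertices_connected[OF F H p(1) q(1)] q(2)]] .
qed

lemma CVP_rescale:
  assumes "n > 0" "m > 0"
  shows "CVP f h = (\<lambda>p. (fst p / n, snd p / m)) ` CVP (\<lambda>s. f (s / n)) (\<lambda>s. h (s / m :: real))"
proof (intro Set.set_eqI iffI)
  fix p assume "p \<in> CVP f h"
  then show "p \<in> (\<lambda>p. (fst p / n, snd p / m)) ` CVP (\<lambda>s. f (s / n)) (\<lambda>s. h (s / m))"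
    using assms by (intro image_eqI[of _ _ "(fst p * n, snd p * m)"]) (auto simp: CVP_def)
qed (auto simp: CVP_def)

lemma liftings_CVP_connected:
  assumes "cyclically_D_reduced g v" "piecewise_geodesic_loop g v \<phi>" "lifting g \<phi> f"
    and "cyclically_D_reduced g w" "piecewise_geodesic_loop g w \<psi>" "lifting g \<psi> h"
  shows "connected (CVP f h)"
proof -
  have ne: "real (length v) > 0" "real (length w) > 0"
    using assms(2,5) unfolding piecewise_geodesic_loop_def by (auto simp: word_elt_def)
  have "connected (CVP (\<lambda>s. f (s / real (length v))) (\<lambda>s. h (s / real (length w))))"
    using lifting_trace[OF assms(1-3)] lifting_trace[OF assms(4-6)] traces_CVP_connected by blast
  then show ?thesis
    by (subst CVP_rescale[OF ne], intro connected_continuous_image continuous_intros) (use ne in auto)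
qed

end

theorem theorem4p3:
  fixes g :: nat
    and v w :: "letter list"
    and \<phi> \<psi> :: "complex \<Rightarrow> complex set"
  assumes "g \<ge> 2"
    and "cyclically_D_reduced g v" and "piecewise_geodesic_loop g v \<phi>"
    and "cyclically_D_reduced g w" and "piecewise_geodesic_loop g w \<psi>"
  shows "(\<forall>f h. lifting g \<phi> f \<longrightarrow> lifting g \<psi> h \<longrightarrow> connected (CVP f h)) \<and>
         (\<forall>K. common_value_class g \<phi> \<psi> K \<longrightarrow> connected K)"
proof -
  interpret genus g by unfold_locales (rule assms(1))
  have c: "connected (CVP f h)" if "lifting g \<phi> f" "lifting g \<psi> h" for f h
    by (rule liftings_CVP_connected[OF assms(2,3) that(1) assms(4,5) that(2)])
  have "continuous_on S (map_prod p_circle p_circle)" for S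
    unfolding map_prod_def p_circle_def case_prod_beta by (intro continuous_intros)
  then have "connected K" if "common_value_class g \<phi> \<psi> K" for K
    using that c unfolding common_value_class_def by (auto intro: connected_continuous_image)
  then show ?thesis using c by blast
qed

end
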